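(* ApproxEnum (given a graph database $\mathcal D$ and an RPQ $q$, enumerate some $q(\mathcal D)$-approximation) can be solved with preprocessing time $O(|\mathcal D|\,|q|)$ and delay $O(1)$.
   Context: $\Sigma$ is a fixed finite alphabet of constant size. A graph database over $\Sigma$ is a pair $\mathcal{D}=(V_{\mathcal D},E_{\mathcal D})$ with a finite node set and arc set $E_{\mathcal D}\subseteq V_{\mathcal D}\times\Sigma\times V_{\mathcal D}$, of size $|\mathcal D|=\max\{|V_{\mathcal D}|,|E_{\mathcal D}|\}$, represented by adjacency lists. A path from $u$ to $v$ is a sequence $u=w_0,a_1,w_1,\dots,a_k,w_k=v$ ($k\ge0$) with $(w_{i-1},a_i,w_i)\in E_{\mathcal D}$, labelled by $a_1\cdots a_k$. An RPQ $q$ is a regular expression over $\Sigma$ (built from $\varepsilon$, letters, concatenation, alternation, Kleene plus), $|q|$ its length; $q(\mathcal D)$ is the set of node pairs $(u,v)$ such that some path from $u$ to $v$ is labelled by a word in the language of $q$. A $q(\mathcal D)$-approximation is a set $A\subseteq q(\mathcal D)$ such that for all nodes $u,v$ with $(u,v)\in q(\mathcal D)$ there exist nodes $u',v'$ with $(u,v')\in A$ and $(u',v)\in A$. Model: RAM with logarithmic word size. Enumeration: preprocessing phase, then enumeration phase outputting every element of the chosen set exactly once and signalling termination; delay = maximum time between start and first output, between consecutive outputs, and between last output and termination. *)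

theory Defs
  imports Complex_Main "HOL-Library.Cardinality"
begin

section \<open>Graph databases and regular path queries\<close>

type_synonym ('v, 'a) graph_db = "'v set \<times> ('v \<times> 'a \<times> 'v) set"

definition graph_db :: "('v, 'a) graph_db \<Rightarrow> bool" where
  "graph_db D \<longleftrightarrow> finite (fst D) \<and> snd D \<subseteq> fst D \<times> UNIV \<times> fst D"

definition db_size :: "('v, 'a) graph_db \<Rightarrow> nat" where
  "db_size D = max (card (fst D)) (card (snd D))"

inductive db_path :: "('v, 'a) graph_db \<Rightarrow> 'v \<Rightarrow> 'a list \<Rightarrow> 'v \<Rightarrow> bool"
  for D :: "('v, 'a) graph_db" where
  path_Nil: "u \<in> fst D \<Longrightarrow> db_path D u [] u"
| path_Cons: "(u, a, x) \<in> snd D \<Longrightarrow> db_path D x w v \<Longrightarrow> db_path D u (a # w) v"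

datatype 'a rpq =
    Eps
  | Sym 'a
  | Cat "'a rpq" "'a rpq"
  | Alt "'a rpq" "'a rpq"
  | Plus "'a rpq"

fun lang :: "'a rpq \<Rightarrow> 'a list set" where
  "lang Eps = {[]}"
| "lang (Sym a) = {[a]}"
| "lang (Cat r s) = {x @ y |x y. x \<in> lang r \<and> y \<in> lang s}"
| "lang (Alt r s) = lang r \<union> lang s"
| "lang (Plus r) = {concat ws |ws. ws \<noteq> [] \<and> set ws \<subseteq> lang r}"

definition answers :: "'a rpq \<Rightarrow> ('v, 'a) graph_db \<Rightarrow> ('v \<times> 'v) set" where
  "answers q D = {(u, v). \<exists>w \<in> lang q. db_path D u w v}"

definition approximation ::
  "'a rpq \<Rightarrow> ('v, 'a) graph_db \<Rightarrow> ('v \<times> 'v) set \<Rightarrow> bool" where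
  "approximation q D A \<longleftrightarrow> A \<subseteq> answers q D \<and>
     (\<forall>(u, v) \<in> answers q D. (\<exists>v'. (u, v') \<in> A) \<and> (\<exists>u'. (u', v) \<in> A))"

text \<open>
  A query is written as a string in infix notation, with parentheses around each concatenation
  and each alternation and with the Kleene plus as a postfix operator, so that the string
  determines the query.  Its length is the number of symbols of that string.
\<close>

datatype 'a token = TEps | TSym 'a | TCat | TAlt | TPlus | TOpen | TClose

fun rpq_string :: "'a rpq \<Rightarrow> 'a token list" where
  "rpq_string Eps = [TEps]"
| "rpq_string (Sym a) = [TSym a]"
| "rpq_string (Cat r s) = [TOpen] @ rpq_string r @ [TCat] @ rpq_string s @ [TClose]"
| "rpq_string (Alt r s) = [TOpen] @ rpq_string r @ [TAlt] @ rpq_string s @ [TClose]"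
| "rpq_string (Plus r) = rpq_string r @ [TPlus]"

definition rpq_size :: "'a rpq \<Rightarrow> nat" where
  "rpq_size q = length (rpq_string q)"


section \<open>Random access machine\<close>

text \<open>
  A program is a finite list of unit-cost instructions.  It uses the registers it names (hence
  boundedly many) and a memory addressed through registers.  All contents of registers and
  memory cells are words of \<open>w\<close> bits, that is, naturals below \<open>2 ^ w\<close>.  The first argument of
  an instruction that computes or loads a value is the target register; \<open>Store r s\<close> writes
  register \<open>s\<close> to the memory cell whose address is in register \<open>r\<close>.  Jump targets are positions
  in the program.
\<close>

datatype instr =
    Const nat nat
  | Move nat nat
  | Add nat nat nat
  | Sub nat nat nat
  | Mul nat nat nat
  | Div nat nat nat
  | Load nat nat
  | Store nat nat
  | Jump nat
  | JumpZero nat nat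
  | JumpLess nat nat nat
  | Output nat nat
  | Halt

record config =
  pc :: nat
  regs :: "nat \<Rightarrow> nat"
  mem :: "nat \<Rightarrow> nat"

definition halted :: "instr list \<Rightarrow> config \<Rightarrow> bool" where
  "halted P c \<longleftrightarrow> pc c \<ge> length P \<or> P ! pc c = Halt"

definition set_reg :: "nat \<Rightarrow> nat \<Rightarrow> nat \<Rightarrow> config \<Rightarrow> config" where
  "set_reg w r x c = c\<lparr>regs := (regs c)(r := x mod 2 ^ w), pc := Suc (pc c)\<rparr>"

definition jump_if :: "bool \<Rightarrow> nat \<Rightarrow> config \<Rightarrow> config" where
  "jump_if b l c = c\<lparr>pc := (if b then l else Suc (pc c))\<rparr>"

text \<open>Subtraction is truncated at \<open>0\<close>, and division by \<open>0\<close> yields \<open>0\<close>.\<close>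

fun exec_instr :: "nat \<Rightarrow> instr \<Rightarrow> config \<Rightarrow> config" where
  "exec_instr w (Const r x) c = set_reg w r x c"
| "exec_instr w (Move r s) c = set_reg w r (regs c s) c"
| "exec_instr w (Add r s t) c = set_reg w r (regs c s + regs c t) c"
| "exec_instr w (Sub r s t) c = set_reg w r (regs c s - regs c t) c"
| "exec_instr w (Mul r s t) c = set_reg w r (regs c s * regs c t) c"
| "exec_instr w (Div r s t) c = set_reg w r (regs c s div regs c t) c"
| "exec_instr w (Load r s) c = set_reg w r (mem c (regs c s)) c"
| "exec_instr w (Store r s) c =
     c\<lparr>mem := (mem c)(regs c r := regs c s), pc := Suc (pc c)\<rparr>"
| "exec_instr w (Jump l) c = jump_if True l c"
| "exec_instr w (JumpZero r l) c = jump_if (regs c r = 0) l c"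
| "exec_instr w (JumpLess r s l) c = jump_if (regs c r < regs c s) l c"
| "exec_instr w (Output r s) c = c\<lparr>pc := Suc (pc c)\<rparr>"
| "exec_instr w Halt c = c"

definition step :: "instr list \<Rightarrow> nat \<Rightarrow> config \<Rightarrow> config" where
  "step P w c = (if halted P c then c else exec_instr w (P ! pc c) c)"

definition initial :: "nat \<Rightarrow> nat list \<Rightarrow> config" where
  "initial w inp = \<lparr>pc = 0, regs = (\<lambda>_. 0),
     mem = (\<lambda>i. if i < length inp then inp ! i mod 2 ^ w else 0)\<rparr>"

definition config_at :: "instr list \<Rightarrow> nat \<Rightarrow> nat list \<Rightarrow> nat \<Rightarrow> config" where
  "config_at P w inp t = (step P w ^^ t) (initial w inp)"

text \<open>The pair of words that is output by the next step, if any.\<close>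

definition emitted :: "instr list \<Rightarrow> config \<Rightarrow> (nat \<times> nat) option" where
  "emitted P c = (if halted P c then None else
     (case P ! pc c of Output r s \<Rightarrow> Some (regs c r, regs c s) | _ \<Rightarrow> None))"

text \<open>Logarithmic word size: \<open>k\<close> times the logarithm of the number of input words.\<close>

definition word_size :: "nat \<Rightarrow> nat list \<Rightarrow> nat" where
  "word_size k inp = k * nat \<lceil>log 2 (real (length inp) + 2)\<rceil>"

text \<open>
  The run of \<open>P\<close> on \<open>inp\<close> halts after outputting each element of \<open>S\<close> exactly once and nothing
  else; the first \<open>T\<close> steps (the preprocessing phase) output nothing, and the delay of the
  remaining steps (the enumeration phase) is at most \<open>d\<close>.  Here \<open>ts\<close> lists the times of the
  outputs and \<open>H\<close> is the time of termination.
\<close>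

definition enumerates ::
  "instr list \<Rightarrow> nat \<Rightarrow> nat list \<Rightarrow> nat \<Rightarrow> nat \<Rightarrow> (nat \<times> nat) set \<Rightarrow> bool" where
  "enumerates P w inp T d S \<longleftrightarrow>
     (\<exists>ts H. halted P (config_at P w inp H) \<and>
        (\<forall>t < H. \<not> halted P (config_at P w inp t)) \<and>
        sorted_wrt (<) ts \<and>
        set ts = {t. emitted P (config_at P w inp t) \<noteq> None} \<and>
        (let outs = map (\<lambda>t. the (emitted P (config_at P w inp t))) ts
         in distinct outs \<and> set outs = S) \<and>
        (\<forall>t \<in> set ts. T \<le> t) \<and> T \<le> H \<and>
        (let events = T # ts @ [H]
         in \<forall>i. Suc i < length events \<longrightarrow> events ! Suc i - events ! i \<le> d))"


section \<open>Representation of the input\<close>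

text \<open>
  The list \<open>vs\<close> numbers the nodes, and \<open>adj ! i\<close> lists, in any order and without repetition, the
  arcs leaving the \<open>i\<close>-th node, each given by its label and the number of its target.
\<close>

definition adj_lists ::
  "('v, 'a) graph_db \<Rightarrow> 'v list \<Rightarrow> ('a \<times> nat) list list \<Rightarrow> bool" where
  "adj_lists D vs adj \<longleftrightarrow> distinct vs \<and> set vs = fst D \<and> length adj = length vs \<and>
     (\<forall>i < length vs. distinct (adj ! i) \<and>
        set (adj ! i) = {(a, j). j < length vs \<and> (vs ! i, a, vs ! j) \<in> snd D})"

fun token_code :: "('a \<Rightarrow> nat) \<Rightarrow> 'a token \<Rightarrow> nat" where
  "token_code code TEps = 0"
| "token_code code TOpen = 1"
| "token_code code TClose = 2"
| "token_code code TCat = 3"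
| "token_code code TAlt = 4"
| "token_code code TPlus = 5"
| "token_code code (TSym a) = 6 + code a"

text \<open>
  The input words: the number of nodes, the length of the query, the symbols of the query, and
  then, for each node, its out-degree followed by the label and the target of each outgoing arc.
\<close>

definition input_words ::
  "('a \<Rightarrow> nat) \<Rightarrow> ('a \<times> nat) list list \<Rightarrow> 'a rpq \<Rightarrow> nat list" where
  "input_words code adj q =
     [length adj, rpq_size q] @ map (token_code code) (rpq_string q) @
     concat (map (\<lambda>l. length l # concat (map (\<lambda>(a, j). [code a, j]) l)) adj)"

end

theory Submission
  imports Defs
begin

text \<open>
  The query is turned into an automaton with \<open>O(|q|)\<close> states and edges, and the product of the
  database with this automaton has \<open>O(|D| |q|)\<close> nodes and edges.  One search of the product from
  all initial nodes \<open>(u, 0)\<close> propagates a single source to each reached node, and so yields for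
  every \<open>v\<close> with an answer \<open>(u, v)\<close> one such \<open>u\<close>; a search of the reversed product yields for
  every \<open>u\<close> one such \<open>v\<close>.  These at most \<open>2 |V|\<close> pairs form an approximation.  They are
  computed in the preprocessing phase, without repetition, and are then just listed.

  The machine program is compiled from a small structured language, in which the algorithm is
  verified with weakest preconditions.
\<close>

section \<open>A structured language and its compilation\<close>

text \<open>An approximation asks for one partner per node and coordinate, and this is what avoids
  the cost of evaluating \<open>q\<close> completely: in a search from all sources at once, every
  product node takes the label of the source that reaches it first and is never revisited, so the
  search costs no more than plain reachability. A label says nothing about the other sources, hence
  the second search, in the reversed product, for the other coordinate. The linear bound shapes the
  rest. The automaton keeps its epsilon edges, since eliminating them may square the number of
  edges. Memory is initially zero, and zero is made to mean "no label" and "empty list", so no array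
  has to be cleared. Databases without nodes get a branch of their own, because
  \<open>|D| |q|\<close> is then zero and even reading the query is too expensive. Finally, all
  stored values must fit into words: they are at most quadratic in the input length, so a constant
  multiple of the logarithm is enough.\<close>

datatype expr =
    Lit nat
  | Var nat
  | Arr nat expr
  | Inp expr
  | EAdd expr expr
  | ESub expr expr
  | EMul expr expr

datatype com =
    Skip
  | Assign nat expr
  | Write nat expr expr
  | Seq com com  (infixr ";;" 60)
  | IfLess expr expr com com
  | WhileLess expr expr com

text \<open>The component \<open>ticks\<close> is a ghost counter of loop iterations: the running time of the
  compiled program is at most a constant times one plus the number of ticks.\<close>

record state =
  vars :: "nat \<Rightarrow> nat"
  arrs :: "nat \<Rightarrow> nat \<Rightarrow> nat"
  ticks :: nat

fun written :: "com \<Rightarrow> nat set" where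
  "written Skip = {}"
| "written (Assign x e) = {x}"
| "written (Write a e f) = {}"
| "written (Seq c d) = written c \<union> written d"
| "written (IfLess e f c d) = written c \<union> written d"
| "written (WhileLess e f c) = written c"

fun written_arrs :: "com \<Rightarrow> nat set" where
  "written_arrs Skip = {}"
| "written_arrs (Assign x e) = {}"
| "written_arrs (Write a e f) = {a}"
| "written_arrs (Seq c d) = written_arrs c \<union> written_arrs d"
| "written_arrs (IfLess e f c d) = written_arrs c \<union> written_arrs d"
| "written_arrs (WhileLess e f c) = written_arrs c"

text \<open>A purely syntactic approximation of what a command may change. The loop rules supply it
  for free, so that invariants mention only what the loop modifies.\<close>

definition frame :: "com \<Rightarrow> state \<Rightarrow> state \<Rightarrow> bool" where
  "frame c s s' \<longleftrightarrow> (\<forall>x. x \<notin> written c \<longrightarrow> vars s' x = vars s x) \<and>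
     (\<forall>a. a \<notin> written_arrs c \<longrightarrow> arrs s' a = arrs s a)"

text \<open>All values stay below \<open>Z\<close>; a computation that would exceed this bound has no semantics.\<close>

locale machine =
  fixes Z :: nat and inp :: "nat list"
begin

fun val :: "state \<Rightarrow> expr \<Rightarrow> nat" where
  "val s (Lit k) = k"
| "val s (Var x) = vars s x"
| "val s (Arr a e) = arrs s a (val s e)"
| "val s (Inp e) = inp ! val s e"
| "val s (EAdd e f) = val s e + val s f"
| "val s (ESub e f) = val s e - val s f"
| "val s (EMul e f) = val s e * val s f"

text \<open>Only operations that can create a large value are checked. Variables and cells are below
  \<open>Z\<close> in every state that corresponds to a machine configuration, input words are
  bounded in the locale \<open>compiled\<close>, and subtraction cannot exceed its first
  operand.\<close>

fun safe :: "state \<Rightarrow> expr \<Rightarrow> bool" where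
  "safe s (Lit k) \<longleftrightarrow> k < Z"
| "safe s (Var x) \<longleftrightarrow> True"
| "safe s (Arr a e) \<longleftrightarrow> safe s e"
| "safe s (Inp e) \<longleftrightarrow> safe s e \<and> val s e < length inp"
| "safe s (EAdd e f) \<longleftrightarrow> safe s e \<and> safe s f \<and> val s e + val s f < Z"
| "safe s (ESub e f) \<longleftrightarrow> safe s e \<and> safe s f"
| "safe s (EMul e f) \<longleftrightarrow> safe s e \<and> safe s f \<and> val s e * val s f < Z"

inductive big :: "com \<Rightarrow> state \<Rightarrow> state \<Rightarrow> bool" where
  big_Skip: "big Skip s s"
| big_Assign: "safe s e \<Longrightarrow> big (Assign x e) s (s\<lparr>vars := (vars s)(x := val s e)\<rparr>)"
| big_Write: "safe s e \<Longrightarrow> safe s f \<Longrightarrow>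
    big (Write a e f) s (s\<lparr>arrs := (arrs s)(a := (arrs s a)(val s e := val s f))\<rparr>)"
| big_Seq: "big c s s1 \<Longrightarrow> big d s1 s2 \<Longrightarrow> big (Seq c d) s s2"
| big_IfTrue: "safe s e \<Longrightarrow> safe s f \<Longrightarrow> val s e < val s f \<Longrightarrow> big c s s' \<Longrightarrow>
    big (IfLess e f c d) s s'"
| big_IfFalse: "safe s e \<Longrightarrow> safe s f \<Longrightarrow> \<not> val s e < val s f \<Longrightarrow> big d s s' \<Longrightarrow>
    big (IfLess e f c d) s s'"
| big_WhileFalse: "safe s e \<Longrightarrow> safe s f \<Longrightarrow> \<not> val s e < val s f \<Longrightarrow>
    big (WhileLess e f c) s s"
| big_WhileTrue: "safe s e \<Longrightarrow> safe s f \<Longrightarrow> val s e < val s f \<Longrightarrow> big c s s1 \<Longrightarrow>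
    big (WhileLess e f c) (s1\<lparr>ticks := Suc (ticks s1)\<rparr>) s2 \<Longrightarrow> big (WhileLess e f c) s s2"

lemma big_ticks: "big c s s' \<Longrightarrow> ticks s \<le> ticks s'"
  by (induction rule: big.induct) auto

lemma big_frame: "big c s s' \<Longrightarrow> frame c s s'"
  unfolding frame_def by (induction rule: big.induct) auto

section \<open>Weakest preconditions for total correctness\<close>

definition wp :: "com \<Rightarrow> (state \<Rightarrow> bool) \<Rightarrow> state \<Rightarrow> bool" where
  "wp c Q s \<longleftrightarrow> (\<exists>s'. big c s s' \<and> Q s')"

lemma wp_Skip [simp]: "wp Skip Q s \<longleftrightarrow> Q s"
  by (auto simp: wp_def elim: big.cases intro: big.intros)

lemma wp_Assign [simp]:
  "wp (Assign x e) Q s \<longleftrightarrow> safe s e \<and> Q (s\<lparr>vars := (vars s)(x := val s e)\<rparr>)"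
  by (auto simp: wp_def elim: big.cases intro: big.intros)

lemma wp_Write [simp]:
  "wp (Write a e f) Q s \<longleftrightarrow> safe s e \<and> safe s f \<and>
     Q (s\<lparr>arrs := (arrs s)(a := (arrs s a)(val s e := val s f))\<rparr>)"
  by (auto simp: wp_def elim: big.cases intro: big.intros)

lemma wp_Seq [simp]: "wp (Seq c d) Q s \<longleftrightarrow> wp c (wp d Q) s"
  unfolding wp_def by (subst big.simps) auto

lemma wp_IfLess [simp]:
  "wp (IfLess e f c d) Q s \<longleftrightarrow> safe s e \<and> safe s f \<and>
     (if val s e < val s f then wp c Q s else wp d Q s)"
  unfolding wp_def by (subst big.simps) auto

lemma wp_frame: "wp c (\<lambda>s'. frame c s s' \<longrightarrow> Q s') s \<Longrightarrow> wp c Q s"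
  unfolding wp_def using big_frame by blast

lemma wp_mono: "wp c Q s \<Longrightarrow> (\<And>s'. Q s' \<Longrightarrow> frame c s s' \<Longrightarrow> R s') \<Longrightarrow> wp c R s"
  unfolding wp_def using big_frame by blast

text \<open>The bound \<open>K\<close> on the ticks serves as the termination argument.\<close>

lemma wp_While:
  assumes init: "I s0"
    and bound: "\<And>s. I s \<Longrightarrow> frame c s0 s \<Longrightarrow> ticks s \<le> K"
    and safe: "\<And>s. I s \<Longrightarrow> frame c s0 s \<Longrightarrow> safe s e \<and> safe s f"
    and body: "\<And>s. I s \<Longrightarrow> frame c s0 s \<Longrightarrow> val s e < val s f \<Longrightarrow>
      wp c (\<lambda>s'. I (s'\<lparr>ticks := Suc (ticks s')\<rparr>)) s"
    and post: "\<And>s. I s \<Longrightarrow> frame c s0 s \<Longrightarrow> \<not> val s e < val s f \<Longrightarrow> Q s"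
  shows "wp (WhileLess e f c) Q s0"
proof -
  have "wp (WhileLess e f c) Q s" if "I s" "frame c s0 s" for s
    using that
  proof (induction "K - ticks s" arbitrary: s rule: less_induct)
    case less
    note sf = safe[OF less.prems]
    show ?case
    proof (cases "val s e < val s f")
      case False
      then show ?thesis using post[OF less.prems] sf unfolding wp_def
        by (meson big_WhileFalse)
    next
      case True
      from body[OF less.prems True] obtain s1 where s1: "big c s s1"
        and I1: "I (s1\<lparr>ticks := Suc (ticks s1)\<rparr>)" unfolding wp_def by blast
      have fr: "frame c s0 (s1\<lparr>ticks := Suc (ticks s1)\<rparr>)"
        using big_frame[OF s1] less.prems(2) by (auto simp: frame_def)
      \<comment> \<open>The bound has to hold after the increment as well: only then does the
        truncated difference \<open>K - ticks\<close> strictly decrease.\<close>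
      have "ticks (s1\<lparr>ticks := Suc (ticks s1)\<rparr>) \<le> K" using bound[OF I1 fr] .
      then have "K - ticks (s1\<lparr>ticks := Suc (ticks s1)\<rparr>) < K - ticks s"
        using big_ticks[OF s1] by simp
      from less.hyps[OF this I1 fr] show ?thesis
        using big_WhileTrue[OF _ _ True s1] sf unfolding wp_def by blast
    qed
  qed
  moreover have "frame c s0 s0" by (simp add: frame_def)
  ultimately show ?thesis using init by blast
qed

end

definition For :: "nat \<Rightarrow> nat \<Rightarrow> com \<Rightarrow> com" where
  "For i y c = Assign i (Lit 0) ;;
     WhileLess (Var i) (Var y) (c ;; Assign i (EAdd (Var i) (Lit 1)))"

lemma written_For [simp]: "written (For i y c) = insert i (written c)"
  and written_arrs_For [simp]: "written_arrs (For i y c) = written_arrs c"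
  by (auto simp: For_def)

context machine
begin

text \<open>The counter and the clock are handled here once and for all: a caller gives an invariant
  \<open>J\<close> indexed by the round and a bound \<open>T k\<close> on the ticks inside round
  \<open>k\<close>; each round itself adds one more tick.\<close>

lemma wp_For:
  assumes i: "i \<notin> written c" "i \<noteq> y" and y: "y \<notin> written c"
    and n: "n = vars s0 y" "n < Z"
    and init: "J 0 (s0\<lparr>vars := (vars s0)(i := 0)\<rparr>)"
    and body: "\<And>k s. k < n \<Longrightarrow> J k s \<Longrightarrow> frame (For i y c) s0 s \<Longrightarrow> vars s i = k \<Longrightarrow>
      wp c (\<lambda>s'. J (Suc k) (s'\<lparr>vars := (vars s')(i := Suc k), ticks := Suc (ticks s')\<rparr>) \<and>
        ticks s' \<le> ticks s + T k) s"
    and post: "\<And>s. J n s \<Longrightarrow> frame (For i y c) s0 s \<Longrightarrow> ticks s \<le> ticks s0 + n + sum T {..<n} \<Longrightarrow> Q s"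
  shows "wp (For i y c) Q s0"
\<comment> \<open>The literal \<open>1\<close> in the increment is safe only if
  \<open>1 < Z\<close>. Otherwise \<open>Z = 1\<close> and \<open>n = 0\<close>, and the body is
  never entered.\<close>
proof (cases "1 < Z")
  case True
  let ?c = "c ;; Assign i (EAdd (Var i) (Lit 1))"
  let ?s = "s0\<lparr>vars := (vars s0)(i := 0)\<rparr>"
  let ?I = "\<lambda>s. vars s i \<le> n \<and> J (vars s i) s \<and> ticks s \<le> ticks s0 + vars s i + sum T {..<vars s i}"
  have fr: "frame (For i y c) s0 s" if "frame ?c ?s s" for s
    using that by (auto simp: frame_def)
  have "wp (WhileLess (Var i) (Var y) ?c) Q ?s"
  proof (rule wp_While[where I = ?I and K = "ticks s0 + n + sum T {..<n}"])
    show "?I ?s" using init by simp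
  next
    fix s assume I: "?I s"
    then have "sum T {..<vars s i} \<le> sum T {..<n}" by (intro sum_mono2) auto
    then show "ticks s \<le> ticks s0 + n + sum T {..<n}" using I by linarith
  next
    fix s assume I: "?I s" and f: "frame ?c ?s s" and "val s (Var i) < val s (Var y)"
    moreover have yn: "vars s y = n" using f y i n by (simp add: frame_def)
    ultimately have lt: "vars s i < n" by simp
    have "wp c (\<lambda>s'. J (Suc (vars s i)) (s'\<lparr>vars := (vars s')(i := Suc (vars s i)),
         ticks := Suc (ticks s')\<rparr>) \<and> ticks s' \<le> ticks s + T (vars s i)) s"
      using body[OF lt _ fr[OF f]] I by blast
    then have "wp c (\<lambda>s'. wp (Assign i (EAdd (Var i) (Lit 1)))
        (\<lambda>s'. ?I (s'\<lparr>ticks := Suc (ticks s')\<rparr>)) s') s"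
    proof (rule wp_mono)
      fix s'
      assume *: "J (Suc (vars s i)) (s'\<lparr>vars := (vars s')(i := Suc (vars s i)),
         ticks := Suc (ticks s')\<rparr>) \<and> ticks s' \<le> ticks s + T (vars s i)" and "frame c s s'"
      then have "vars s' i = vars s i" using i by (simp add: frame_def)
      then show "wp (Assign i (EAdd (Var i) (Lit 1))) (\<lambda>s'. ?I (s'\<lparr>ticks := Suc (ticks s')\<rparr>)) s'"
        using * I lt n True by simp
    qed
    then show "wp ?c (\<lambda>s'. ?I (s'\<lparr>ticks := Suc (ticks s')\<rparr>)) s" by (simp only: wp_Seq)
  next
    fix s assume I: "?I s" and f: "frame ?c ?s s" and "\<not> val s (Var i) < val s (Var y)"
    moreover have yn: "vars s y = n" using f y i n by (simp add: frame_def)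
    ultimately have "vars s i = n" by simp
    then show "Q s" using post[OF _ fr[OF f]] I by simp
  qed simp
  then show ?thesis using True by (simp add: For_def)
next
  case False
  then have "n = 0" "Z = 1" using n by auto
  let ?s = "s0\<lparr>vars := (vars s0)(i := 0)\<rparr>"
  have "big (Assign i (Lit 0)) s0 ?s" using big_Assign[of s0 "Lit 0" i] n by simp
  moreover have "big (WhileLess (Var i) (Var y) (c ;; Assign i (EAdd (Var i) (Lit 1)))) ?s ?s"
    using n i \<open>n = 0\<close> by (intro big_WhileFalse) auto
  ultimately have "big (For i y c) s0 ?s" unfolding For_def by (rule big_Seq)
  moreover have "Q (s0\<lparr>vars := (vars s0)(i := 0)\<rparr>)"
    using post init \<open>n = 0\<close> by (simp add: frame_def)
  ultimately show ?thesis unfolding wp_def by blast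
qed

end

section \<open>Compilation into machine instructions\<close>

text \<open>Variables occupy registers \<open>0\<close> to \<open>29\<close>, register \<open>30\<close> holds the base address \<open>B\<close> of the
  arrays, and higher registers hold intermediate results.  Cell \<open>i\<close> of array \<open>a\<close> has the
  address \<open>B + 16 * i + a\<close>, so that no bound on the size of an array is fixed in advance.\<close>

fun legal_expr :: "expr \<Rightarrow> bool" where
  "legal_expr (Lit k) \<longleftrightarrow> True"
| "legal_expr (Var x) \<longleftrightarrow> x < 30"
| "legal_expr (Arr a e) \<longleftrightarrow> a < 16 \<and> legal_expr e"
| "legal_expr (Inp e) \<longleftrightarrow> legal_expr e"
| "legal_expr (EAdd e f) \<longleftrightarrow> legal_expr e \<and> legal_expr f"
| "legal_expr (ESub e f) \<longleftrightarrow> legal_expr e \<and> legal_expr f"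
| "legal_expr (EMul e f) \<longleftrightarrow> legal_expr e \<and> legal_expr f"

fun legal :: "com \<Rightarrow> bool" where
  "legal Skip \<longleftrightarrow> True"
| "legal (Assign x e) \<longleftrightarrow> x < 30 \<and> legal_expr e"
| "legal (Write a e f) \<longleftrightarrow> a < 16 \<and> legal_expr e \<and> legal_expr f"
| "legal (Seq c d) \<longleftrightarrow> legal c \<and> legal d"
| "legal (IfLess e f c d) \<longleftrightarrow> legal_expr e \<and> legal_expr f \<and> legal c \<and> legal d"
| "legal (WhileLess e f c) \<longleftrightarrow> legal_expr e \<and> legal_expr f \<and> legal c"

lemma legal_For [simp]: "legal (For i y c) \<longleftrightarrow> i < 30 \<and> y < 30 \<and> legal c"
  by (auto simp: For_def)

definition address :: "nat \<Rightarrow> nat \<Rightarrow> instr list" where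
  "address a t = [Const (Suc t) 16, Mul t t (Suc t), Const (Suc t) a, Add t t (Suc t), Add t t 30]"

text \<open>Registers from \<open>t\<close> upwards act as an evaluation stack: the result ends up
  in \<open>t\<close>, a second operand is evaluated from \<open>Suc t\<close> on, and registers
  below \<open>t\<close> survive.\<close>

fun compile_expr :: "expr \<Rightarrow> nat \<Rightarrow> instr list" where
  "compile_expr (Lit k) t = [Const t k]"
| "compile_expr (Var x) t = [Move t x]"
| "compile_expr (Arr a e) t = compile_expr e t @ address a t @ [Load t t]"
| "compile_expr (Inp e) t = compile_expr e t @ [Load t t]"
| "compile_expr (EAdd e f) t = compile_expr e t @ compile_expr f (Suc t) @ [Add t t (Suc t)]"
| "compile_expr (ESub e f) t = compile_expr e t @ compile_expr f (Suc t) @ [Sub t t (Suc t)]"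
| "compile_expr (EMul e f) t = compile_expr e t @ compile_expr f (Suc t) @ [Mul t t (Suc t)]"

definition test :: "expr \<Rightarrow> expr \<Rightarrow> instr list" where
  "test e f = compile_expr e 31 @ compile_expr f 32"

text \<open>Jump targets are absolute, so the code depends on its own position \<open>p\<close>. The
  false branch is laid out before the true branch because the test jumps when it succeeds.\<close>

fun compile :: "com \<Rightarrow> nat \<Rightarrow> instr list" where
  "compile Skip p = []"
| "compile (Assign x e) p = compile_expr e 31 @ [Move x 31]"
| "compile (Write a e f) p =
     (compile_expr e 31 @ address a 31) @ compile_expr f 32 @ [Store 31 32]"
| "compile (Seq c d) p = (let cc = compile c p in cc @ compile d (p + length cc))"
| "compile (IfLess e f c d) p =
     (let b = test e f; cd = compile d (p + length b + 1);
          cc = compile c (p + length b + length cd + 2)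
      in b @ [JumpLess 31 32 (p + length b + length cd + 2)] @ cd @
         [Jump (p + length b + length cd + 2 + length cc)] @ cc)"
| "compile (WhileLess e f c) p =
     (let b = test e f; cc = compile c (p + length b + 2)
      in b @ [JumpLess 31 32 (p + length b + 2), Jump (p + length b + length cc + 3)] @ cc @
         [Jump p])"

text \<open>Every loop is charged for a single round; the number of rounds enters through
  \<open>ticks\<close> in \<open>run_compile\<close>.\<close>

fun cost :: "com \<Rightarrow> nat" where
  "cost Skip = 0"
| "cost (Assign x e) = length (compile_expr e 31) + 1"
| "cost (Write a e f) = length (compile_expr e 31) + length (compile_expr f 32) + 6"
| "cost (Seq c d) = cost c + cost d"
| "cost (IfLess e f c d) = length (test e f) + 2 + cost c + cost d"
| "cost (WhileLess e f c) = length (test e f) + 3 + cost c"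

fun straight :: "instr \<Rightarrow> bool" where
  "straight (Jump l) \<longleftrightarrow> False"
| "straight (JumpZero r l) \<longleftrightarrow> False"
| "straight (JumpLess r s l) \<longleftrightarrow> False"
| "straight (Output r s) \<longleftrightarrow> False"
| "straight Halt \<longleftrightarrow> False"
| "straight _ \<longleftrightarrow> True"

lemma straight_compile_expr: "i \<in> set (compile_expr e t) \<Longrightarrow> straight i"
  by (induction e arbitrary: t) (auto simp: address_def)

fun silent :: "instr \<Rightarrow> bool" where
  "silent (Output r s) \<longleftrightarrow> False"
| "silent Halt \<longleftrightarrow> False"
| "silent _ \<longleftrightarrow> True"

lemma silent_if_straight: "straight i \<Longrightarrow> silent i"
  by (cases i) auto

lemma silent_compile: "i \<in> set (compile c p) \<Longrightarrow> silent i"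
  by (induction c arbitrary: p)
    (auto simp: Let_def test_def address_def dest!: straight_compile_expr intro: silent_if_straight)

section \<open>Simulation of the structured language by the machine\<close>

text \<open>The first \<open>h\<close> instructions of \<open>P\<close> are the preprocessing phase.\<close>

locale compiled = machine +
  fixes P :: "instr list" and w B h :: nat
  assumes h: "h \<le> length P" and silent_P: "i < h \<Longrightarrow> silent (P ! i)"
    and Z: "2 \<le> Z" and word: "B + 16 * Z \<le> 2 ^ w"
    and B: "length inp \<le> B" and inp_less: "x \<in> set inp \<Longrightarrow> x < Z"
begin

text \<open>The condition on \<open>pc\<close> leaves out the final configuration: preprocessing
  ends precisely by reaching \<open>h\<close>, and below \<open>h\<close> no instruction outputs or
  halts.\<close>

definition runs :: "nat \<Rightarrow> config \<Rightarrow> config \<Rightarrow> bool" where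
  "runs n c c' \<longleftrightarrow> (step P w ^^ n) c = c' \<and> (\<forall>i<n. pc ((step P w ^^ i) c) < h)"

lemma runs_0: "runs 0 c c"
  by (simp add: runs_def)

lemma runs_trans:
  assumes "runs m c c'" "runs n c' c''"
  shows "runs (m + n) c c''"
  unfolding runs_def
proof (intro conjI allI impI)
  show "(step P w ^^ (m + n)) c = c''"
    using assms by (simp add: runs_def add.commute[of m] funpow_add)
next
  fix i assume i: "i < m + n"
  show "pc ((step P w ^^ i) c) < h"
  proof (cases "i < m")
    case False
    then obtain d where "i = d + m" "d < n" using i
      by (metis add.commute le_Suc_ex nat_add_left_cancel_less not_less)
    then show ?thesis using assms by (simp add: runs_def funpow_add)
  qed (use assms in \<open>simp add: runs_def\<close>)
qed

lemma step_eq: "pc c < h \<Longrightarrow> step P w c = exec_instr w (P ! pc c) c"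
  using h silent_P[of "pc c"] by (auto simp: step_def halted_def)

lemma runs_1: "pc c < h \<Longrightarrow> runs 1 c (exec_instr w (P ! pc c) c)"
  by (simp add: runs_def step_eq)

definition code_at :: "nat \<Rightarrow> instr list \<Rightarrow> bool" where
  "code_at p code \<longleftrightarrow> (\<forall>i<length code. p + i < h \<and> P ! (p + i) = code ! i)"

lemma code_at_Nil [simp]: "code_at p []"
  by (simp add: code_at_def)

lemma code_at_Cons [simp]: "code_at p (i # code) \<longleftrightarrow> p < h \<and> P ! p = i \<and> code_at (Suc p) code"
  unfolding code_at_def by (auto simp: less_Suc_eq_0_disj)

lemma code_at_append [simp]:
  "code_at p (xs @ ys) \<longleftrightarrow> code_at p xs \<and> code_at (p + length xs) ys"
  by (induction xs arbitrary: p) auto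

lemma pc_exec_straight: "straight i \<Longrightarrow> pc (exec_instr w i c) = Suc (pc c)"
  by (cases i) (auto simp: set_reg_def)

lemma runs_straight:
  assumes "code_at (pc c) code" "\<And>i. i \<in> set code \<Longrightarrow> straight i"
  shows "runs (length code) c (fold (exec_instr w) code c)"
  using assms
proof (induction code arbitrary: c)
  case (Cons i code)
  have "runs 1 c (exec_instr w i c)" using runs_1[of c] Cons.prems by simp
  moreover have "runs (length code) (exec_instr w i c) (fold (exec_instr w) code (exec_instr w i c))"
    using Cons by (simp add: pc_exec_straight)
  ultimately show ?case using runs_trans by fastforce
qed (simp add: runs_0)

text \<open>Variables and cells without a place in the machine are bounded too, so that
  \<open>val_less\<close> holds for every safe expression, whether or not it is legal.\<close>

definition sim :: "state \<Rightarrow> config \<Rightarrow> bool" where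
  "sim s c \<longleftrightarrow> (\<forall>x. vars s x < Z) \<and> (\<forall>a i. arrs s a i < Z) \<and>
     (\<forall>x<30. regs c x = vars s x) \<and> regs c 30 = B \<and>
     (\<forall>i<length inp. mem c i = inp ! i) \<and>
     (\<forall>a<16. \<forall>i<Z. mem c (B + 16 * i + a) = arrs s a i)"

lemma sim_cong: "sim s c \<Longrightarrow> (\<And>r. r \<le> 30 \<Longrightarrow> regs c' r = regs c r) \<Longrightarrow> mem c' = mem c \<Longrightarrow> sim s c'"
  by (simp add: sim_def)

lemma val_less: "sim s c \<Longrightarrow> safe s e \<Longrightarrow> val s e < Z"
  by (induction e) (auto simp: sim_def inp_less)

lemma fold_address:
  assumes "regs c t = i" "i < Z" "a < 16" "regs c 30 = B" "31 \<le> t"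
  shows "let c' = fold (exec_instr w) (address a t) c in
    regs c' t = B + 16 * i + a \<and> (\<forall>r<t. regs c' r = regs c r) \<and> mem c' = mem c \<and>
    pc c' = pc c + length (address a t)"
proof -
  have *: "16 < (2::nat) ^ w" using word Z by linarith
  have "B + 16 * i + a < 2 ^ w" using word assms by linarith
  moreover from this have "i * 16 < 2 ^ w" "i * 16 + a < 2 ^ w" "i * 16 + a + B < 2 ^ w"
    by linarith+
  ultimately show ?thesis using assms *
    by (auto simp: address_def set_reg_def Let_def)
qed

lemma fold_compile_expr:
  assumes "sim s c" "safe s e" "legal_expr e" "31 \<le> t"
  shows "let c' = fold (exec_instr w) (compile_expr e t) c in
    regs c' t = val s e \<and> (\<forall>r<t. regs c' r = regs c r) \<and> mem c' = mem c \<and>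
    pc c' = pc c + length (compile_expr e t)"
  using assms
proof (induction e arbitrary: t c)
  case (Lit k)
  then show ?case using word by (simp add: set_reg_def)
next
  case (Var x)
  then have "vars s x < Z" "regs c x = vars s x" by (auto simp: sim_def)
  then show ?case using word by (simp add: set_reg_def)
next
  case (Arr a e)
  define c1 where "c1 = fold (exec_instr w) (compile_expr e t) c"
  have 1: "regs c1 t = val s e" "\<forall>r<t. regs c1 r = regs c r" "mem c1 = mem c"
    "pc c1 = pc c + length (compile_expr e t)"
    using Arr.IH[OF Arr.prems(1) _ _ Arr.prems(4)] Arr.prems by (auto simp: c1_def Let_def)
  have v: "val s e < Z" using val_less[OF Arr.prems(1)] Arr.prems(2) by simp
  define c2 where "c2 = fold (exec_instr w) (address a t) c1"
  have 2: "regs c2 t = B + 16 * val s e + a" "\<forall>r<t. regs c2 r = regs c1 r" "mem c2 = mem c1"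
    "pc c2 = pc c1 + length (address a t)"
    using fold_address[OF 1(1) v, of a] Arr.prems 1(2) by (auto simp: c2_def Let_def sim_def)
  have "mem c (B + 16 * val s e + a) = arrs s a (val s e)" using Arr.prems v by (simp add: sim_def)
  moreover have "arrs s a (val s e) < Z" using Arr.prems(1) by (simp add: sim_def)
  then have "arrs s a (val s e) < 2 ^ w" using word by linarith
  ultimately show ?case using 1 2
    by (simp add: Let_def c1_def[symmetric] c2_def[symmetric] set_reg_def)
next
  case (Inp e)
  define c1 where "c1 = fold (exec_instr w) (compile_expr e t) c"
  have 1: "regs c1 t = val s e" "\<forall>r<t. regs c1 r = regs c r" "mem c1 = mem c"
    "pc c1 = pc c + length (compile_expr e t)"
    using Inp.IH[OF Inp.prems(1) _ _ Inp.prems(4)] Inp.prems by (auto simp: c1_def Let_def)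
  have "mem c (val s e) = inp ! val s e" "inp ! val s e < Z"
    using Inp.prems by (auto simp: sim_def inp_less)
  then show ?case using 1 word
    by (simp add: Let_def c1_def[symmetric] set_reg_def)
next
  case (EAdd e f)
  define c1 where "c1 = fold (exec_instr w) (compile_expr e t) c"
  have 1: "regs c1 t = val s e" "\<forall>r<t. regs c1 r = regs c r" "mem c1 = mem c"
    "pc c1 = pc c + length (compile_expr e t)"
    using EAdd.IH(1)[OF EAdd.prems(1) _ _ EAdd.prems(4)] EAdd.prems by (auto simp: c1_def Let_def)
  have s1: "sim s c1" using sim_cong[OF EAdd.prems(1)] 1 EAdd.prems(4) by simp
  define c2 where "c2 = fold (exec_instr w) (compile_expr f (Suc t)) c1"
  have 2: "regs c2 (Suc t) = val s f" "\<forall>r<Suc t. regs c2 r = regs c1 r" "mem c2 = mem c1"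
    "pc c2 = pc c1 + length (compile_expr f (Suc t))"
    using EAdd.IH(2)[OF s1, of "Suc t"] EAdd.prems by (auto simp: c2_def Let_def)
  show ?case using 1 2 word EAdd.prems
    by (simp add: Let_def c1_def[symmetric] c2_def[symmetric] set_reg_def)
next
  case (ESub e f)
  define c1 where "c1 = fold (exec_instr w) (compile_expr e t) c"
  have 1: "regs c1 t = val s e" "\<forall>r<t. regs c1 r = regs c r" "mem c1 = mem c"
    "pc c1 = pc c + length (compile_expr e t)"
    using ESub.IH(1)[OF ESub.prems(1) _ _ ESub.prems(4)] ESub.prems by (auto simp: c1_def Let_def)
  have s1: "sim s c1" using sim_cong[OF ESub.prems(1)] 1 ESub.prems(4) by simp
  define c2 where "c2 = fold (exec_instr w) (compile_expr f (Suc t)) c1"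
  have 2: "regs c2 (Suc t) = val s f" "\<forall>r<Suc t. regs c2 r = regs c1 r" "mem c2 = mem c1"
    "pc c2 = pc c1 + length (compile_expr f (Suc t))"
    using ESub.IH(2)[OF s1, of "Suc t"] ESub.prems by (auto simp: c2_def Let_def)
  have "val s e < Z" using val_less[OF ESub.prems(1)] ESub.prems(2) by simp
  then show ?case using 1 2 word ESub.prems
    by (simp add: Let_def c1_def[symmetric] c2_def[symmetric] set_reg_def)
next
  case (EMul e f)
  define c1 where "c1 = fold (exec_instr w) (compile_expr e t) c"
  have 1: "regs c1 t = val s e" "\<forall>r<t. regs c1 r = regs c r" "mem c1 = mem c"
    "pc c1 = pc c + length (compile_expr e t)"
    using EMul.IH(1)[OF EMul.prems(1) _ _ EMul.prems(4)] EMul.prems by (auto simp: c1_def Let_def)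
  have s1: "sim s c1" using sim_cong[OF EMul.prems(1)] 1 EMul.prems(4) by simp
  define c2 where "c2 = fold (exec_instr w) (compile_expr f (Suc t)) c1"
  have 2: "regs c2 (Suc t) = val s f" "\<forall>r<Suc t. regs c2 r = regs c1 r" "mem c2 = mem c1"
    "pc c2 = pc c1 + length (compile_expr f (Suc t))"
    using EMul.IH(2)[OF s1, of "Suc t"] EMul.prems by (auto simp: c2_def Let_def)
  show ?case using 1 2 word EMul.prems
    by (simp add: Let_def c1_def[symmetric] c2_def[symmetric] set_reg_def)
qed

lemma run_expr:
  assumes "sim s c" "safe s e" "legal_expr e" "31 \<le> t" "code_at (pc c) (compile_expr e t)"
  obtains c' where "runs (length (compile_expr e t)) c c'" "sim s c'" "regs c' t = val s e"
    "\<forall>r<t. regs c' r = regs c r" "mem c' = mem c" "pc c' = pc c + length (compile_expr e t)"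
proof
  let ?c = "fold (exec_instr w) (compile_expr e t) c"
  show "runs (length (compile_expr e t)) c ?c"
    using runs_straight assms(5) straight_compile_expr by blast
  have "regs ?c t = val s e \<and> (\<forall>r<t. regs ?c r = regs c r) \<and> mem ?c = mem c \<and>
      pc ?c = pc c + length (compile_expr e t)"
    using fold_compile_expr[OF assms(1-4)] by (simp add: Let_def)
  then show "regs ?c t = val s e" "\<forall>r<t. regs ?c r = regs c r" "mem ?c = mem c"
      "pc ?c = pc c + length (compile_expr e t)" by auto
  then show "sim s ?c" using sim_cong[OF assms(1)] assms(4) by simp
qed

lemma run_test:
  assumes "sim s c" "safe s e" "safe s f" "legal_expr e" "legal_expr f"
    "code_at (pc c) (test e f)"
  obtains c' where "runs (length (test e f)) c c'" "sim s c'" "regs c' 31 = val s e"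
    "regs c' 32 = val s f" "pc c' = pc c + length (test e f)"
proof -
  obtain c1 where 1: "runs (length (compile_expr e 31)) c c1" "sim s c1" "regs c1 31 = val s e"
    "pc c1 = pc c + length (compile_expr e 31)"
    using run_expr[OF assms(1,2,4), of 31] assms(6) by (auto simp: test_def)
  obtain c2 where 2: "runs (length (compile_expr f 32)) c1 c2" "sim s c2" "regs c2 32 = val s f"
    "\<forall>r<32. regs c2 r = regs c1 r" "pc c2 = pc c1 + length (compile_expr f 32)"
    using run_expr[OF 1(2) assms(3,5), of 32] assms(6) 1(4) by (auto simp: test_def)
  show thesis
  proof (rule that[of c2])
    show "runs (length (test e f)) c c2" using runs_trans[OF 1(1) 2(1)] by (simp add: test_def)
    show "regs c2 31 = val s e" using 1(3) 2(4) by simp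
  qed (use 1 2 in \<open>auto simp: test_def\<close>)
qed

lemma sim_pc [simp]: "sim s (c\<lparr>pc := p\<rparr>) = sim s c"
  by (simp add: sim_def)

lemma sim_ticks [simp]: "sim (s\<lparr>ticks := t\<rparr>) c = sim s c"
  by (simp add: sim_def)

lemma run_Assign:
  assumes "sim s c" "safe s e" "legal (Assign x e)" "code_at (pc c) (compile (Assign x e) (pc c))"
  shows "\<exists>c'. runs (cost (Assign x e)) c c' \<and> sim (s\<lparr>vars := (vars s)(x := val s e)\<rparr>) c' \<and>
    pc c' = pc c + length (compile (Assign x e) (pc c))"
proof -
  obtain c1 where 1: "runs (length (compile_expr e 31)) c c1" "sim s c1" "regs c1 31 = val s e"
    "pc c1 = pc c + length (compile_expr e 31)"
    using run_expr[OF assms(1,2), of 31] assms(3,4) by auto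
  have v: "val s e < Z" using val_less assms by blast
  then have vm: "val s e mod 2 ^ w = val s e" using word by simp
  have "runs 1 c1 (exec_instr w (Move x 31) c1)" using runs_1[of c1] 1 assms by simp
  then have "runs (cost (Assign x e)) c (exec_instr w (Move x 31) c1)"
    using runs_trans[OF 1(1), of 1] by simp
  moreover have "sim (s\<lparr>vars := (vars s)(x := val s e)\<rparr>) (exec_instr w (Move x 31) c1)"
    using 1 v vm assms by (auto simp: sim_def set_reg_def)
  ultimately show ?thesis using 1 by (auto simp: set_reg_def)
qed

lemma run_Write:
  assumes "sim s c" "safe s e" "safe s f" "legal (Write a e f)"
    "code_at (pc c) (compile (Write a e f) (pc c))"
  shows "\<exists>c'. runs (cost (Write a e f)) c c' \<and>
    sim (s\<lparr>arrs := (arrs s)(a := (arrs s a)(val s e := val s f))\<rparr>) c' \<and>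
    pc c' = pc c + length (compile (Write a e f) (pc c))"
proof -
  obtain c1 where 1: "runs (length (compile_expr e 31)) c c1" "sim s c1" "regs c1 31 = val s e"
    "pc c1 = pc c + length (compile_expr e 31)"
    using run_expr[OF assms(1,2), of 31] assms(4,5) by auto
  have v: "val s e < Z" "val s f < Z" using val_less assms by blast+
  define c2 where "c2 = fold (exec_instr w) (address a 31) c1"
  have 2: "regs c2 31 = B + 16 * val s e + a" "\<forall>r<31. regs c2 r = regs c1 r" "mem c2 = mem c1"
    "pc c2 = pc c1 + length (address a 31)"
    using fold_address[OF 1(3) v(1), of a] assms 1 by (auto simp: c2_def Let_def sim_def)
  have r2: "runs (length (address a 31)) c1 c2" unfolding c2_def
    by (rule runs_straight) (use assms 1 in \<open>auto simp: address_def\<close>)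
  have s2: "sim s c2" using sim_cong[OF 1(2)] 2 by simp
  have "code_at (pc c2) (compile_expr f 32)" using assms 1 2 by (simp add: add.assoc)
  then obtain c3 where 3: "runs (length (compile_expr f 32)) c2 c3" "sim s c3" "regs c3 32 = val s f"
    "\<forall>r<32. regs c3 r = regs c2 r" "mem c3 = mem c2" "pc c3 = pc c2 + length (compile_expr f 32)"
    using run_expr[OF s2 assms(3), of 32] assms(4) by auto
  have "runs 1 c3 (exec_instr w (Store 31 32) c3)"
    using runs_1[of c3] 1 2 3 assms by (simp add: add.assoc)
  then have "runs (length (compile_expr e 31) + (length (address a 31) + (length (compile_expr f 32) + 1)))
      c (exec_instr w (Store 31 32) c3)"
    using runs_trans 1(1) r2 3(1) by meson
  then have "runs (cost (Write a e f)) c (exec_instr w (Store 31 32) c3)"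
    by (simp add: address_def eval_nat_numeral ac_simps)
  moreover have "sim (s\<lparr>arrs := (arrs s)(a := (arrs s a)(val s e := val s f))\<rparr>)
     (exec_instr w (Store 31 32) c3)"
  proof -
    \<comment> \<open>Interleaving the 16 arrays makes an address decode uniquely into quotient and
      remainder modulo 16, so the store changes no other cell; starting at \<open>B\<close> keeps it
      off the input.\<close>
    have adr: "B + 16 * i + b = B + 16 * val s e + a \<longleftrightarrow> i = val s e \<and> b = a"
      if "b < 16" for b i using that assms(4) by auto presburger+
    show ?thesis using 2 3 v assms B adr by (auto simp: sim_def)
  qed
  ultimately show ?thesis using 1 2 3 by (auto simp: add.assoc)
qed

text \<open>In a sequence both parts get the same factor, the total number of ticks plus one. A
  further loop round would contribute a second \<open>Suc\<close>; the tick counted for that round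
  pays for it.\<close>

theorem run_compile:
  assumes "big c s s'" "sim s cf" "legal c" "code_at (pc cf) (compile c (pc cf))"
  shows "\<exists>n cf'. n \<le> cost c * Suc (ticks s' - ticks s) \<and> runs n cf cf' \<and> sim s' cf' \<and>
    pc cf' = pc cf + length (compile c (pc cf))"
  using assms
proof (induction arbitrary: cf rule: big.induct)
  case (big_Skip s)
  then show ?case using runs_0 by force
next
  case (big_Assign s e x)
  then obtain c' where "runs (cost (Assign x e)) cf c'"
    "sim (s\<lparr>vars := (vars s)(x := val s e)\<rparr>) c'"
    "pc c' = pc cf + length (compile (Assign x e) (pc cf))"
    using run_Assign[of s cf e x] by blast
  then show ?case
    by (intro exI[of _ "cost (Assign x e)"] exI[of _ c']) (simp del: cost.simps compile.simps)
next
  case (big_Write s e f a)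
  then obtain c' where "runs (cost (Write a e f)) cf c'"
    "sim (s\<lparr>arrs := (arrs s)(a := (arrs s a)(val s e := val s f))\<rparr>) c'"
    "pc c' = pc cf + length (compile (Write a e f) (pc cf))"
    using run_Write[of s cf e f a] by blast
  then show ?case
    by (intro exI[of _ "cost (Write a e f)"] exI[of _ c']) (simp del: cost.simps compile.simps)
next
  case (big_Seq c s s1 d s2)
  obtain n1 c1 where 1: "n1 \<le> cost c * Suc (ticks s1 - ticks s)" "runs n1 cf c1" "sim s1 c1"
    "pc c1 = pc cf + length (compile c (pc cf))"
    using big_Seq.IH(1)[of cf] big_Seq.prems by (auto simp: Let_def)
  obtain n2 c2 where 2: "n2 \<le> cost d * Suc (ticks s2 - ticks s1)" "runs n2 c1 c2" "sim s2 c2"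
    "pc c2 = pc c1 + length (compile d (pc c1))"
    using big_Seq.IH(2)[of c1] big_Seq.prems 1 by (auto simp: Let_def)
  have t: "ticks s \<le> ticks s1" "ticks s1 \<le> ticks s2" using big_Seq.hyps big_ticks by auto
  have "n1 + n2 \<le> cost c * Suc (ticks s2 - ticks s) + cost d * Suc (ticks s2 - ticks s)"
    using 1(1) 2(1) t by (intro add_mono) (auto elim!: order_trans)
  then show ?case using runs_trans[OF 1(2) 2(2)] 1 2
    by (intro exI[of _ "n1 + n2"] exI[of _ c2]) (auto simp: Let_def algebra_simps)
next
  case (big_IfTrue s e f c s' d)
  obtain c1 where 1: "runs (length (test e f)) cf c1" "sim s c1" "regs c1 31 = val s e"
    "regs c1 32 = val s f" "pc c1 = pc cf + length (test e f)"
    using run_test[of s cf e f] big_IfTrue by (auto simp: Let_def)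
  define p where "p = pc cf + length (test e f) + length (compile d (pc cf + length (test e f) + 1)) + 2"
  let ?c2 = "c1\<lparr>pc := p\<rparr>"
  have "exec_instr w (JumpLess 31 32 p) c1 = ?c2"
    using 1 big_IfTrue.hyps by (simp add: jump_if_def)
  then have 2: "runs 1 c1 ?c2"
    using runs_1[of c1] 1 big_IfTrue.prems by (auto simp: Let_def p_def)
  obtain n3 c3 where 3: "n3 \<le> cost c * Suc (ticks s' - ticks s)" "runs n3 ?c2 c3" "sim s' c3"
    "pc c3 = p + length (compile c p)"
    using big_IfTrue.IH[of ?c2] big_IfTrue.prems 1 by (auto simp: Let_def p_def algebra_simps)
  have "length (test e f) + (1 + n3) \<le> cost (IfLess e f c d) * Suc (ticks s' - ticks s)"
    using 3(1) by (simp add: algebra_simps)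
  then show ?case using runs_trans[OF 1(1) runs_trans[OF 2 3(2)]] 1 3
    by (intro exI[of _ "length (test e f) + (1 + n3)"] exI[of _ c3]) (auto simp: Let_def p_def)
next
  case (big_IfFalse s e f d s' c)
  obtain c1 where 1: "runs (length (test e f)) cf c1" "sim s c1" "regs c1 31 = val s e"
    "regs c1 32 = val s f" "pc c1 = pc cf + length (test e f)"
    using run_test[of s cf e f] big_IfFalse by (auto simp: Let_def)
  define p where "p = pc cf + length (test e f) + length (compile d (pc cf + length (test e f) + 1)) + 2"
  let ?c2 = "c1\<lparr>pc := Suc (pc c1)\<rparr>"
  have "exec_instr w (JumpLess 31 32 p) c1 = ?c2"
    using 1 big_IfFalse.hyps by (simp add: jump_if_def)
  then have 2: "runs 1 c1 ?c2"
    using runs_1[of c1] 1 big_IfFalse.prems by (auto simp: Let_def p_def)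
  obtain n3 c3 where 3: "n3 \<le> cost d * Suc (ticks s' - ticks s)" "runs n3 ?c2 c3" "sim s' c3"
    "pc c3 = p - 1"
    using big_IfFalse.IH[of ?c2] big_IfFalse.prems 1 by (auto simp: Let_def p_def algebra_simps)
  define q where "q = p + length (compile c p)"
  have 4: "runs 1 c3 (c3\<lparr>pc := q\<rparr>)"
    using runs_1[of c3] 3 big_IfFalse.prems
    by (auto simp: Let_def p_def q_def jump_if_def algebra_simps)
  have "length (test e f) + (1 + (n3 + 1)) \<le> cost (IfLess e f c d) * Suc (ticks s' - ticks s)"
    using 3(1) by (simp add: algebra_simps)
  then show ?case using runs_trans[OF 1(1) runs_trans[OF 2 runs_trans[OF 3(2) 4]]] 1 3
    by (intro exI[of _ "length (test e f) + (1 + (n3 + 1))"] exI[of _ "c3\<lparr>pc := q\<rparr>"])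
      (auto simp: Let_def p_def q_def)
next
  case (big_WhileFalse s e f c)
  obtain c1 where 1: "runs (length (test e f)) cf c1" "sim s c1" "regs c1 31 = val s e"
    "regs c1 32 = val s f" "pc c1 = pc cf + length (test e f)"
    using run_test[of s cf e f] big_WhileFalse by (auto simp: Let_def)
  let ?q = "pc cf + length (compile (WhileLess e f c) (pc cf))"
  have 2: "runs 1 c1 (c1\<lparr>pc := Suc (pc c1)\<rparr>)"
    using runs_1[of c1] 1 big_WhileFalse by (auto simp: Let_def jump_if_def)
  have 3: "runs 1 (c1\<lparr>pc := Suc (pc c1)\<rparr>) (c1\<lparr>pc := ?q\<rparr>)"
    using runs_1[of "c1\<lparr>pc := Suc (pc c1)\<rparr>"] 1 big_WhileFalse
    by (auto simp: Let_def jump_if_def numeral_3_eq_3 add.assoc)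
  show ?case using runs_trans[OF 1(1) runs_trans[OF 2 3]] 1
    by (intro exI[of _ "length (test e f) + (1 + 1)"] exI[of _ "c1\<lparr>pc := ?q\<rparr>"]) auto
next
  case (big_WhileTrue s e f c s1 s2)
  obtain c1 where 1: "runs (length (test e f)) cf c1" "sim s c1" "regs c1 31 = val s e"
    "regs c1 32 = val s f" "pc c1 = pc cf + length (test e f)"
    using run_test[of s cf e f] big_WhileTrue by (auto simp: Let_def)
  define p where "p = pc cf + length (test e f) + 2"
  have 2: "runs 1 c1 (c1\<lparr>pc := p\<rparr>)"
    using runs_1[of c1] 1 big_WhileTrue.prems big_WhileTrue.hyps
    by (auto simp: Let_def jump_if_def p_def)
  obtain n3 c3 where 3: "n3 \<le> cost c * Suc (ticks s1 - ticks s)" "runs n3 (c1\<lparr>pc := p\<rparr>) c3" "sim s1 c3"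
    "pc c3 = p + length (compile c p)"
    using big_WhileTrue.IH(1)[of "c1\<lparr>pc := p\<rparr>"] big_WhileTrue.prems 1
    by (auto simp: Let_def p_def algebra_simps)
  have 4: "runs 1 c3 (c3\<lparr>pc := pc cf\<rparr>)"
    using runs_1[of c3] 3 big_WhileTrue.prems
    by (auto simp: Let_def p_def jump_if_def algebra_simps)
  obtain n5 c5 where 5: "n5 \<le> cost (WhileLess e f c) * Suc (ticks s2 - Suc (ticks s1))"
    "runs n5 (c3\<lparr>pc := pc cf\<rparr>) c5" "sim s2 c5"
    "pc c5 = pc cf + length (compile (WhileLess e f c) (pc cf))"
    using big_WhileTrue.IH(2)[of "c3\<lparr>pc := pc cf\<rparr>"] big_WhileTrue.prems 3 by auto
  have t: "ticks s \<le> ticks s1" "Suc (ticks s1) \<le> ticks s2"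
    using big_WhileTrue.hyps(4,5) big_ticks by fastforce+
  let ?K = "cost (WhileLess e f c)"
  have "length (test e f) + (1 + (n3 + 1)) \<le> ?K * Suc (ticks s1 - ticks s)"
    using 3(1) by (simp add: algebra_simps)
  then have "length (test e f) + (1 + (n3 + (1 + n5))) \<le>
      ?K * Suc (ticks s1 - ticks s) + ?K * Suc (ticks s2 - Suc (ticks s1))"
    using 5(1) by linarith
  also have "\<dots> = ?K * (Suc (ticks s1 - ticks s) + Suc (ticks s2 - Suc (ticks s1)))"
    by (simp only: distrib_left)
  also have "Suc (ticks s1 - ticks s) + Suc (ticks s2 - Suc (ticks s1)) = Suc (ticks s2 - ticks s)"
    using t by simp
  finally show ?case
    using runs_trans[OF 1(1) runs_trans[OF 2 runs_trans[OF 3(2) runs_trans[OF 4 5(2)]]]] 5 by blast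
qed

end

section \<open>Graph search with labels\<close>

text \<open>One more than the largest \<open>j < k\<close> with \<open>S j = x\<close>, and
  \<open>0\<close> if there is none. The shift by one lets zero-initialised memory represent empty
  adjacency lists.\<close>

fun last_edge :: "(nat \<Rightarrow> nat) \<Rightarrow> nat \<Rightarrow> nat \<Rightarrow> nat" where
  "last_edge S x 0 = 0"
| "last_edge S x (Suc k) = (if S k = x then Suc k else last_edge S x k)"

lemma last_edge_le: "last_edge S x k \<le> k"
  by (induction k) auto

lemma last_edge_source: "last_edge S x k \<noteq> 0 \<Longrightarrow> S (last_edge S x k - 1) = x"
  by (induction k) (auto split: if_splits)

lemma less_last_edge: "j < k \<Longrightarrow> S j = x \<Longrightarrow> j < last_edge S x k"
  by (induction k) (auto simp: less_Suc_eq)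

definition edges :: "nat \<Rightarrow> (nat \<Rightarrow> nat) \<Rightarrow> (nat \<Rightarrow> nat) \<Rightarrow> (nat \<times> nat) set" where
  "edges M S T = {(S j, T j) |j. j < M}"

text \<open>The search scans the edges that leave node \<open>x\<close> from the last one downwards; \<open>e\<close> is one more
  than the index of the next edge, and \<open>h\<close> nodes of the queue \<open>Q\<close> have been removed.\<close>

definition scanned ::
  "nat \<Rightarrow> (nat \<Rightarrow> nat) \<Rightarrow> (nat \<Rightarrow> nat) \<Rightarrow> nat \<Rightarrow> nat \<Rightarrow> nat \<Rightarrow> nat set" where
  "scanned M S Q h e x = {j. j < M \<and> S j \<in> Q ` {..<h} \<and> (S j = x \<longrightarrow> e \<le> j)}"

lemma finite_scanned [simp]: "finite (scanned M S Q h e x)"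
  by (simp add: scanned_def)

lemma card_scanned: "card (scanned M S Q h e x) \<le> M"
proof -
  have "scanned M S Q h e x \<subseteq> {..<M}" by (auto simp: scanned_def)
  then show ?thesis using card_mono[of "{..<M}"] by fastforce
qed

text \<open>A label \<open>Suc v\<close> names the source \<open>v\<close>, and the labelled nodes
  are exactly those that ever entered the queue. Scanned edges have labelled targets, which becomes
  closure under edges once everything is scanned. When \<open>e = 0\<close> no edge is pending, so
  the search may start with any value of \<open>x\<close>.\<close>

definition search_inv :: "nat \<Rightarrow> (nat \<Rightarrow> nat) \<Rightarrow> (nat \<Rightarrow> nat) \<Rightarrow> nat \<Rightarrow> nat \<Rightarrow> (nat \<Rightarrow> nat) \<Rightarrow>
  (nat \<Rightarrow> nat) \<Rightarrow> (nat \<Rightarrow> nat) \<Rightarrow> nat \<Rightarrow> nat \<Rightarrow> nat \<Rightarrow> nat \<Rightarrow> bool" where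
  "search_inv M S T N n src Q Lab h tail e x \<longleftrightarrow>
     h \<le> tail \<and> inj_on Q {..<tail} \<and> Q ` {..<tail} \<subseteq> {..<N} \<and>
     (\<forall>y. Lab y \<noteq> 0 \<longleftrightarrow> y \<in> Q ` {..<tail}) \<and>
     e \<le> M \<and> (e \<noteq> 0 \<longrightarrow> S (e - 1) = x \<and> x \<in> Q ` {..<h}) \<and>
     (\<forall>j \<in> scanned M S Q h e x. Lab (T j) \<noteq> 0) \<and>
     (\<forall>y. Lab y \<noteq> 0 \<longrightarrow> (\<exists>v<n. Lab y = Suc v \<and> (src v, y) \<in> (edges M S T)\<^sup>*)) \<and>
     (\<forall>v<n. Lab (src v) \<noteq> 0)"

lemma search_inv_le:
  assumes "search_inv M S T N n src Q Lab h tail e x"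
  shows "h \<le> tail" "tail \<le> N" "e \<le> M"
proof -
  have "inj_on Q {..<tail}" "Q ` {..<tail} \<subseteq> {..<N}" using assms by (auto simp: search_inv_def)
  then show "tail \<le> N" by (metis card_inj_on_le card_lessThan finite_lessThan)
qed (use assms in \<open>auto simp: search_inv_def\<close>)

lemma search_inv_label: "search_inv M S T N n src Q Lab h tail e x \<Longrightarrow> Lab y \<noteq> 0 \<Longrightarrow>
    \<exists>v<n. Lab y = Suc v \<and> (src v, y) \<in> (edges M S T)\<^sup>*"
  unfolding search_inv_def by blast

lemma search_inv_iff: "search_inv M S T N n src Q Lab h tail e x \<Longrightarrow>
    Lab y \<noteq> 0 \<longleftrightarrow> y \<in> Q ` {..<tail}"
  unfolding search_inv_def by blast

lemma search_inv_scanned: "search_inv M S T N n src Q Lab h tail e x \<Longrightarrow>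
    j \<in> scanned M S Q h e x \<Longrightarrow> Lab (T j) \<noteq> 0"
  and search_inv_source: "search_inv M S T N n src Q Lab h tail e x \<Longrightarrow> v < n \<Longrightarrow> Lab (src v) \<noteq> 0"
  unfolding search_inv_def by blast+

text \<open>Dequeuing scans no edge: by injectivity of \<open>Q\<close> the node was not dequeued
  before, and \<open>e'\<close> lies above all of its edges.\<close>

lemma search_inv_node:
  assumes inv: "search_inv M S T N n src Q Lab h tail 0 x" and h: "h < tail"
  defines "e' \<equiv> last_edge S (Q h) M"
  shows "search_inv M S T N n src Q Lab (Suc h) tail e' (Q h)"
    and "scanned M S Q (Suc h) e' (Q h) = scanned M S Q h 0 x"
proof -
  have "Q h \<notin> Q ` {..<h}"
  proof
    assume "Q h \<in> Q ` {..<h}"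
    then obtain i where "i < h" "Q h = Q i" by auto
    then show False using inv h unfolding search_inv_def inj_on_def
      by (metis lessThan_iff less_imp_neq less_trans)
  qed
  then show sc: "scanned M S Q (Suc h) e' (Q h) = scanned M S Q h 0 x"
    using less_last_edge[of _ M S "Q h"] unfolding e'_def
    by (fastforce simp: scanned_def lessThan_Suc)
  show "search_inv M S T N n src Q Lab (Suc h) tail e' (Q h)"
    using inv h last_edge_le[of S "Q h" M] last_edge_source[of S "Q h" M]
    unfolding search_inv_def sc by (auto simp: e'_def)
qed

text \<open>Going from \<open>e\<close> to \<open>e'\<close> scans exactly the edge
  \<open>e - 1\<close>, since the skipped indices belong to other sources. The cardinality claim
  pays for one round, and writing at \<open>tail\<close> leaves the dequeued prefix of the queue
  intact.\<close>

lemma search_inv_edge: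
  assumes inv: "search_inv M S T N n src Q Lab h tail e x" and e: "e \<noteq> 0"
    and TN: "T (e - 1) < N"
  defines "y \<equiv> T (e - 1)" and "e' \<equiv> last_edge S x (e - 1)"
  shows "Lab y \<noteq> 0 \<Longrightarrow> search_inv M S T N n src Q Lab h tail e' x"
    and "Lab y = 0 \<Longrightarrow>
      search_inv M S T N n src (Q(tail := y)) (Lab(y := Lab x)) h (Suc tail) e' x"
    and "card (scanned M S Q h e' x) = Suc (card (scanned M S Q h e x))"
    and "scanned M S (Q(tail := y)) h e' x = scanned M S Q h e' x"
proof -
  have S: "S (e - 1) = x" and x: "x \<in> Q ` {..<h}" and eM: "e \<le> M" and h: "h \<le> tail"
    using inv e by (auto simp: search_inv_def)
  have e': "e' \<le> e - 1" "e' \<noteq> 0 \<Longrightarrow> S (e' - 1) = x"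
    unfolding e'_def using last_edge_le[of S x] last_edge_source[of S x] by auto
  have sc: "scanned M S Q h e' x = insert (e - 1) (scanned M S Q h e x)"
  proof (intro set_eqI iffI)
    fix j assume j: "j \<in> scanned M S Q h e' x"
    show "j \<in> insert (e - 1) (scanned M S Q h e x)"
    proof (cases "S j = x \<and> j < e - 1")
      case True
      then have "j < e'" unfolding e'_def using less_last_edge by blast
      then show ?thesis using j True by (auto simp: scanned_def)
    next
      case False
      then show ?thesis using j e by (auto simp: scanned_def)
    qed
  next
    fix j assume "j \<in> insert (e - 1) (scanned M S Q h e x)"
    then show "j \<in> scanned M S Q h e' x"
      using e' e eM S x by (auto simp: scanned_def)
  qed
  have "e - 1 \<notin> scanned M S Q h e x" using e S by (auto simp: scanned_def)
  then show "card (scanned M S Q h e' x) = Suc (card (scanned M S Q h e x))"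
    by (simp add: sc)
  have Qh: "(Q(tail := y)) ` {..<h} = Q ` {..<h}" using h by auto
  show sc': "scanned M S (Q(tail := y)) h e' x = scanned M S Q h e' x"
    unfolding scanned_def Qh ..
  show "search_inv M S T N n src Q Lab h tail e' x" if "Lab y \<noteq> 0"
    using inv that e' eM x unfolding search_inv_def sc by (auto simp: y_def)
  assume y0: "Lab y = 0"
  have xt: "x \<in> Q ` {..<tail}" using x h by auto
  then have Lx: "Lab x \<noteq> 0" using inv by (auto simp: search_inv_def)
  then obtain v where v: "v < n" "Lab x = Suc v" "(src v, x) \<in> (edges M S T)\<^sup>*"
    using search_inv_label[OF inv] by blast
  have "(x, y) \<in> edges M S T" using S e eM by (force simp: edges_def y_def)
  with v(3) have vy: "(src v, y) \<in> (edges M S T)\<^sup>*" by simp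
  have yn: "y \<notin> Q ` {..<tail}" using search_inv_iff[OF inv, of y] y0 by simp
  have img: "(Q(tail := y)) ` {..<Suc tail} = insert y (Q ` {..<tail})"
    by (auto simp: lessThan_Suc)
  have inj: "inj_on (Q(tail := y)) {..<Suc tail}"
    using inv yn unfolding search_inv_def lessThan_Suc
    by (auto simp: inj_on_def)
  show "search_inv M S T N n src (Q(tail := y)) (Lab(y := Lab x)) h (Suc tail) e' x"
    unfolding search_inv_def sc' sc img Qh
  proof (intro conjI)
    show "\<forall>z. ((Lab(y := Lab x)) z \<noteq> 0) = (z \<in> insert y (Q ` {..<tail}))"
      using search_inv_iff[OF inv] Lx by simp
    show "\<forall>z. (Lab(y := Lab x)) z \<noteq> 0 \<longrightarrow>
        (\<exists>v<n. (Lab(y := Lab x)) z = Suc v \<and> (src v, z) \<in> (edges M S T)\<^sup>*)"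
      using search_inv_label[OF inv] v vy by auto
    show "insert y (Q ` {..<tail}) \<subseteq> {..<N}" using inv TN by (simp add: search_inv_def y_def)
    show "\<forall>j\<in>insert (e - 1) (scanned M S Q h e x). (Lab(y := Lab x)) (T j) \<noteq> 0"
      using search_inv_scanned[OF inv] Lx by (auto simp: y_def)
    show "\<forall>v<n. (Lab(y := Lab x)) (src v) \<noteq> 0"
      using search_inv_source[OF inv] Lx by simp
    show "e' \<noteq> 0 \<longrightarrow> S (e' - 1) = x \<and> x \<in> Q ` {..<h}" using e' x by blast
  qed (use inj h e' eM in auto)
qed

text \<open>With an empty queue and no pending edge, every edge out of a labelled node is scanned,
  so the labelled nodes are closed under edges.\<close>

lemma search_inv_final:
  assumes inv: "search_inv M S T N n src Q Lab tail tail 0 x"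
    and v: "v < n" and reach: "(src v, y) \<in> (edges M S T)\<^sup>*"
  shows "Lab y \<noteq> 0"
  using reach
proof (induction rule: rtrancl_induct)
  case base
  then show ?case using inv v by (auto simp: search_inv_def)
next
  case (step y z)
  then obtain j where "j < M" "y = S j" "z = T j" by (auto simp: edges_def)
  moreover have "y \<in> Q ` {..<tail}" using step.IH inv by (auto simp: search_inv_def)
  ultimately show ?case using inv by (auto simp: search_inv_def scanned_def)
qed

text \<open>Variables: \<open>0\<close> holds the number \<open>n\<close> of sources, \<open>2\<close> and \<open>4\<close> determine the source
  nodes \<open>v * K + off\<close>, and \<open>3\<close> holds the number of edges.  The edges are linked by
  the arrays \<open>H\<close> and \<open>X\<close>: \<open>H\<close> maps each node to its last outgoing edge, and \<open>X\<close>
  maps each edge to the previous edge with the same source.\<close>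

definition link :: "nat \<Rightarrow> nat \<Rightarrow> nat \<Rightarrow> com" where
  "link S H X = For 20 3
     (Write X (Var 20) (Arr H (Arr S (Var 20))) ;;
      Write H (Arr S (Var 20)) (EAdd (Var 20) (Lit 1)))"

definition seed :: "nat \<Rightarrow> nat \<Rightarrow> com" where
  "seed Q Lab = For 20 0
     (Assign 21 (EAdd (EMul (Var 20) (Var 2)) (Var 4)) ;;
      Write Lab (Var 21) (EAdd (Var 20) (Lit 1)) ;;
      Write Q (Var 20) (Var 21))"

text \<open>The loops over nodes and over their edges are merged into one, whose rounds either
  dequeue a node or scan an edge; the number of rounds is thus visibly a sum. Variables
  \<open>22\<close>, \<open>23\<close>, \<open>24\<close> and \<open>21\<close> hold
  \<open>tail\<close>, \<open>h\<close>, \<open>e\<close> and \<open>x\<close>. As \<open>h\<close>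
  never exceeds \<open>tail\<close>, the truncated subtraction in the guard is exact.\<close>

definition propagate :: "nat \<Rightarrow> nat \<Rightarrow> nat \<Rightarrow> nat \<Rightarrow> nat \<Rightarrow> com" where
  "propagate T H X Q Lab =
     Assign 22 (Var 0) ;; Assign 23 (Lit 0) ;; Assign 24 (Lit 0) ;;
     WhileLess (Lit 0) (EAdd (ESub (Var 22) (Var 23)) (Var 24))
       (IfLess (Lit 0) (Var 24)
         (Assign 25 (Arr T (ESub (Var 24) (Lit 1))) ;;
          Assign 24 (Arr X (ESub (Var 24) (Lit 1))) ;;
          IfLess (Arr Lab (Var 25)) (Lit 1)
            (Write Lab (Var 25) (Arr Lab (Var 21)) ;;
             Write Q (Var 22) (Var 25) ;;
             Assign 22 (EAdd (Var 22) (Lit 1)))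
            Skip)
         (Assign 21 (Arr Q (Var 23)) ;;
          Assign 23 (EAdd (Var 23) (Lit 1)) ;;
          Assign 24 (Arr H (Var 21))))"

text \<open>Arrays and source state are parameters because the same code runs along the edges from
  the initial state and, with \<open>S\<close> and \<open>T\<close> exchanged, against them from the
  final state.\<close>

definition search :: "nat \<Rightarrow> nat \<Rightarrow> nat \<Rightarrow> nat \<Rightarrow> nat \<Rightarrow> nat \<Rightarrow> com" where
  "search S T H X Q Lab = link S H X ;; seed Q Lab ;; propagate T H X Q Lab"

lemma written_search: "written (search S T H X Q Lab) = {20,21,22,23,24,25}"
  and written_arrs_search: "written_arrs (search S T H X Q Lab) = {H, X, Q, Lab}"
  by (auto simp: search_def link_def seed_def propagate_def)

lemma legal_search: "\<forall>a \<in> {S, T, H, X, Q, Lab}. a < 16 \<Longrightarrow> legal (search S T H X Q Lab)"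
  by (simp add: search_def link_def seed_def propagate_def)

section \<open>Correctness and running time of the search program\<close>

context machine
begin

text \<open>Prepending edge \<open>k\<close> to the list of its source is one step of the recursion
  that defines \<open>last_edge\<close>.\<close>

lemma wp_link:
  assumes d: "distinct [S, H, X]" and M: "M = vars s0 3" "M + 1 < Z"
    and H: "arrs s0 H = (\<lambda>_. 0)"
    and Q: "\<And>s. (\<And>x. arrs s H x = last_edge (arrs s0 S) x M) \<Longrightarrow>
      (\<And>j. j < M \<Longrightarrow> arrs s X j = last_edge (arrs s0 S) (arrs s0 S j) j) \<Longrightarrow>
      frame (link S H X) s0 s \<Longrightarrow> ticks s \<le> ticks s0 + M \<Longrightarrow> Q s"
  shows "wp (link S H X) Q s0"
  unfolding link_def
proof (rule wp_For[where n = M and T = "\<lambda>_. 0" and J = "\<lambda>k s.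
    (\<forall>x. arrs s H x = last_edge (arrs s0 S) x k) \<and>
    (\<forall>j<k. arrs s X j = last_edge (arrs s0 S) (arrs s0 S j) j)"], goal_cases)
  case (7 k s)
  then have "arrs s S = arrs s0 S" using d by (simp add: frame_def)
  then show ?case using 7 d M by (auto simp: less_Suc_eq)
next
  case (8 s)
  then show ?case by (intro Q) (auto simp: link_def)
qed (use M H in auto)

lemma wp_seed:
  assumes d: "Q \<noteq> Lab" and K: "K = vars s0 2" "off = vars s0 4" "off < K" and n: "n = vars s0 0"
    and small: "n * K + n + 1 < Z" and L: "arrs s0 Lab = (\<lambda>_. 0)"
    and post: "\<And>s. (\<And>v. v < n \<Longrightarrow> arrs s Lab (v * K + off) = Suc v) \<Longrightarrow>
      (\<And>y. y \<notin> (\<lambda>v. v * K + off) ` {..<n} \<Longrightarrow> arrs s Lab y = 0) \<Longrightarrow>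
      (\<And>v. v < n \<Longrightarrow> arrs s Q v = v * K + off) \<Longrightarrow>
      frame (seed Q Lab) s0 s \<Longrightarrow> ticks s \<le> ticks s0 + n \<Longrightarrow> R s"
  shows "wp (seed Q Lab) R s0"
  unfolding seed_def
proof (rule wp_For[where n = n and T = "\<lambda>_. 0" and J = "\<lambda>k s.
    (\<forall>v<k. arrs s Lab (v * K + off) = Suc v) \<and>
    (\<forall>y. y \<notin> (\<lambda>v. v * K + off) ` {..<k} \<longrightarrow> arrs s Lab y = 0) \<and>
    (\<forall>v<k. arrs s Q v = v * K + off)"], goal_cases)
  case (7 k s)
  then have *: "vars s 2 = K" "vars s 4 = off" using K by (auto simp: frame_def)
  have "Suc k * K \<le> n * K" using 7 by (intro mult_le_mono1) simp
  then have "k * K + off < n * K" using K by simp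
  moreover from this have "k * K < n * K" by linarith
  ultimately have "k * K + off < Z" "k * K < Z" "k + 1 < Z" using 7 small by linarith+
  moreover have "v * K + off \<noteq> k * K + off" if "v < k" for v using that K by simp
  ultimately show ?case using 7 d * by (auto simp: lessThan_Suc less_Suc_eq)
next
  case (8 s)
  then show ?case by (intro post) (auto simp: seed_def)
qed (use n small L in auto)

lemma wp_propagate:
  fixes s0 :: state
  assumes d: "distinct [T, H, X, Q, Lab]" and n: "n = vars s0 0" "n \<le> N" and small: "N + M + 1 < Z"
    and ST: "\<And>j. j < M \<Longrightarrow> arrs s0 T j < N"
    and H: "\<And>x. arrs s0 H x = last_edge S x M"
    and X: "\<And>j. j < M \<Longrightarrow> arrs s0 X j = last_edge S (S j) j"
    and src: "inj_on src {..<n}" "src ` {..<n} \<subseteq> {..<N}"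
    and Lab: "\<And>v. v < n \<Longrightarrow> arrs s0 Lab (src v) = Suc v"
      "\<And>y. y \<notin> src ` {..<n} \<Longrightarrow> arrs s0 Lab y = 0"
    and Q: "\<And>v. v < n \<Longrightarrow> arrs s0 Q v = src v"
    and post: "\<And>s. (\<And>y. arrs s Lab y \<noteq> 0 \<Longrightarrow> \<exists>v<n. arrs s Lab y = Suc v \<and>
        (src v, y) \<in> (edges M S (arrs s0 T))\<^sup>*) \<Longrightarrow>
      (\<And>v y. v < n \<Longrightarrow> (src v, y) \<in> (edges M S (arrs s0 T))\<^sup>* \<Longrightarrow> arrs s Lab y \<noteq> 0) \<Longrightarrow>
      frame (propagate T H X Q Lab) s0 s \<Longrightarrow> ticks s \<le> ticks s0 + N + M \<Longrightarrow> R s"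
  shows "wp (propagate T H X Q Lab) R s0"
proof -
  let ?T = "arrs s0 T"
  let ?inv = "\<lambda>s. search_inv M S ?T N n src (arrs s Q) (arrs s Lab) (vars s 23) (vars s 22)
    (vars s 24) (vars s 21)"
  let ?sc = "\<lambda>s. card (scanned M S (arrs s Q) (vars s 23) (vars s 24) (vars s 21))"
  let ?s = "s0\<lparr>vars := (vars s0)(22 := n, 23 := 0, 24 := 0)\<rparr>"
  have img: "arrs s0 Q ` {..<n} = src ` {..<n}" using Q by auto
  have init: "?inv ?s"
    unfolding search_inv_def
  proof (intro conjI)
    show "inj_on (arrs ?s Q) {..<vars ?s 22}"
      using inj_on_cong[of "{..<n}" "arrs s0 Q" src] Q src by simp
    show "\<forall>y. (arrs ?s Lab y \<noteq> 0) = (y \<in> arrs ?s Q ` {..<vars ?s 22})"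
    proof (intro allI)
      fix y
      show "(arrs ?s Lab y \<noteq> 0) = (y \<in> arrs ?s Q ` {..<vars ?s 22})"
        using Lab(1) Lab(2)[of y] img by (cases "y \<in> src ` {..<n}") auto
    qed
    show "\<forall>y. arrs ?s Lab y \<noteq> 0 \<longrightarrow>
        (\<exists>v<n. arrs ?s Lab y = Suc v \<and> (src v, y) \<in> (edges M S ?T)\<^sup>*)"
    proof (intro allI impI)
      fix y assume "arrs ?s Lab y \<noteq> 0"
      then have "y \<in> src ` {..<n}" using Lab(2)[of y] by auto
      then show "\<exists>v<n. arrs ?s Lab y = Suc v \<and> (src v, y) \<in> (edges M S ?T)\<^sup>*"
        using Lab(1) by auto
    qed
  qed (use src Lab img in \<open>auto simp: scanned_def\<close>)
  have frT: "arrs s T = ?T" "arrs s H = arrs s0 H" "arrs s X = arrs s0 X"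
    if "frame c ?s s" "written_arrs c \<subseteq> {Lab, Q}" for c s
    using that d by (auto simp: frame_def)
  show ?thesis
    unfolding propagate_def wp_Seq wp_Assign
  proof (intro conjI, goal_cases)
    case 4
    have "wp (WhileLess (Lit 0) (EAdd (ESub (Var 22) (Var 23)) (Var 24))
       (IfLess (Lit 0) (Var 24)
         (Assign 25 (Arr T (ESub (Var 24) (Lit 1))) ;;
          Assign 24 (Arr X (ESub (Var 24) (Lit 1))) ;;
          IfLess (Arr Lab (Var 25)) (Lit 1)
            (Write Lab (Var 25) (Arr Lab (Var 21)) ;;
             Write Q (Var 22) (Var 25) ;;
             Assign 22 (EAdd (Var 22) (Lit 1)))
            Skip)
         (Assign 21 (Arr Q (Var 23)) ;;
          Assign 23 (EAdd (Var 23) (Lit 1)) ;;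
          Assign 24 (Arr H (Var 21))))) R ?s" (is "wp (WhileLess _ _ ?body) R ?s")
    proof (rule wp_While[where K = "ticks s0 + N + M" and
          \<comment> \<open>Every round is paid for by one newly dequeued node or one newly scanned
            edge, of which there are at most \<open>N\<close> and \<open>M\<close>.\<close>
          I = "\<lambda>s. ?inv s \<and> ticks s \<le> ticks s0 + vars s 23 + ?sc s"], goal_cases)
      case 1
      then show ?case using init by simp
    next
      case (2 s)
      then have "?inv s" by blast
      then have "vars s 23 \<le> N" using search_inv_le[of M S ?T N n src] by (meson le_trans)
      then show ?case using 2 card_scanned[of M S "arrs s Q" "vars s 23" "vars s 24" "vars s 21"]
        by linarith
    next
      case (3 s)
      then have "?inv s" by blast
      then have "vars s 22 \<le> N" "vars s 24 \<le> M" using search_inv_le[of M S ?T N n src] by blast+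
      then show ?case using small by simp
    next
      case (4 s)
      then have inv: "?inv s" and tk: "ticks s \<le> ticks s0 + vars s 23 + ?sc s" by auto
      have fr: "arrs s T = ?T" "arrs s H = arrs s0 H" "arrs s X = arrs s0 X"
        using frT[OF 4(2)] by auto
      have le: "vars s 22 \<le> N" "vars s 24 \<le> M" "vars s 23 \<le> vars s 22"
        using search_inv_le[OF inv] by auto
      show ?case
      proof (cases "vars s 24 = 0")
        case True
        then have h: "vars s 23 < vars s 22" using 4 by simp
        have inv0: "search_inv M S ?T N n src (arrs s Q) (arrs s Lab) (vars s 23) (vars s 22) 0 (vars s 21)"
          using inv True by simp
        show ?thesis using True search_inv_node[OF inv0 h] tk small h le fr H by simp
      next
        case False
        have Tj: "?T (vars s 24 - 1) < N" using ST le False by simp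
        have Se: "S (vars s 24 - 1) = vars s 21" using inv False by (auto simp: search_inv_def)
        note e = search_inv_edge[where T = ?T, OF inv False Tj]
        have Xe: "arrs s X (vars s 24 - Suc 0) = last_edge S (vars s 21) (vars s 24 - Suc 0)"
          using fr X[of "vars s 24 - Suc 0"] Se le False by simp
        show ?thesis using False e tk small le fr Xe d by auto
      qed
    next
      case (5 s)
      then have z: "vars s 24 = 0" "\<not> vars s 23 < vars s 22" by auto
      have "?inv s" using 5 by blast
      then have "vars s 23 \<le> vars s 22" using search_inv_le(1) by blast
      then have "vars s 23 = vars s 22" using z by simp
      then have inv: "search_inv M S ?T N n src (arrs s Q) (arrs s Lab) (vars s 22) (vars s 22) 0 (vars s 21)"
        using 5 z by simp
      have "vars s 23 \<le> N" using \<open>vars s 23 = vars s 22\<close> search_inv_le(2)[OF inv] by simp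
      then have tk: "ticks s \<le> ticks s0 + N + M"
        using 5 card_scanned[of M S "arrs s Q" "vars s 23" "vars s 24" "vars s 21"] by linarith
      show ?case
      proof (rule post)
        show "\<exists>v<n. arrs s Lab y = Suc v \<and> (src v, y) \<in> (edges M S ?T)\<^sup>*" if "arrs s Lab y \<noteq> 0" for y
          using search_inv_label[OF inv that] .
        show "frame (propagate T H X Q Lab) s0 s"
          using 5(2) by (auto simp: frame_def propagate_def)
      qed (use search_inv_final[OF inv] tk in auto)
    qed
    then show ?case using n by simp
  qed (use small in auto)
qed

lemma wp_search:
  assumes d: "distinct [S, T, H, X, Q, Lab]" and n: "n = vars s0 0" and M: "M = vars s0 3"
    and K: "K = vars s0 2" "off = vars s0 4" "off < K"
    and small: "n * K + n + M + 1 < Z"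
    and ST: "\<And>j. j < M \<Longrightarrow> arrs s0 T j < n * K"
    and zero: "arrs s0 H = (\<lambda>_. 0)" "arrs s0 Lab = (\<lambda>_. 0)"
    and post: "\<And>s. (\<And>y. arrs s Lab y \<noteq> 0 \<Longrightarrow> \<exists>v<n. arrs s Lab y = Suc v \<and>
        (v * K + off, y) \<in> (edges M (arrs s0 S) (arrs s0 T))\<^sup>*) \<Longrightarrow>
      (\<And>v y. v < n \<Longrightarrow> (v * K + off, y) \<in> (edges M (arrs s0 S) (arrs s0 T))\<^sup>* \<Longrightarrow>
        arrs s Lab y \<noteq> 0) \<Longrightarrow>
      frame (search S T H X Q Lab) s0 s \<Longrightarrow> ticks s \<le> ticks s0 + n + n * K + 2 * M \<Longrightarrow> R s"
  shows "wp (search S T H X Q Lab) R s0"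
  unfolding search_def wp_Seq
proof (rule wp_link[of _ _ _ M], goal_cases)
  case (5 s1)
  have v1: "vars s1 0 = n" "vars s1 2 = K" "vars s1 4 = off"
    using 5(3) n K by (auto simp: frame_def link_def)
  have a1: "arrs s1 Lab = (\<lambda>_. 0)" "arrs s1 T = arrs s0 T"
    using 5(3) d zero by (auto simp: frame_def link_def)
  show ?case
  proof (rule wp_seed[of _ _ K _ off n], goal_cases)
    case (8 s2)
    have v2: "vars s2 0 = n" using 8(4) v1 by (auto simp: frame_def seed_def)
    have a2: "arrs s2 T = arrs s0 T" "arrs s2 H = arrs s1 H" "arrs s2 X = arrs s1 X"
      using 8(4) a1 d by (auto simp: frame_def seed_def)
    show ?case
    proof (rule wp_propagate[where S = "arrs s0 S" and M = M and N = "n * K" and n = n and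
          src = "\<lambda>v. v * K + off"], goal_cases)
      case 8
      show ?case using K by (auto simp: inj_on_def)
    next
      case 9
      show ?case
      proof clarsimp
        fix v assume "v < n"
        then have "Suc v * K \<le> n * K" by (intro mult_le_mono1) simp
        then show "v * K + off < n * K" using K by simp
      qed
    next
      case (13 s3)
      show ?case
      proof (rule post)
        show "frame (search S T H X Q Lab) s0 s3"
          using 13(3) 8(4) 5(3) unfolding frame_def search_def by auto
        show "ticks s3 \<le> ticks s0 + n + n * K + 2 * M"
          using 13(4) 8(5) 5(4) by simp
      qed (use 13 a2 in auto)
    qed (use 5 8 a2 v2 d small K ST in auto)
  qed (use K v1 a1 d small in auto)
qed (use d M small zero in auto)

end

section \<open>Answers and the product of database and query\<close>

lemma db_path_start: "graph_db D \<Longrightarrow> db_path D u w v \<Longrightarrow> u \<in> fst D"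
  by (erule db_path.cases) (auto simp: graph_db_def)

lemma db_path_end: "db_path D u w v \<Longrightarrow> v \<in> fst D"
  by (induction rule: db_path.induct)

lemma db_path_append:
  assumes "graph_db D"
  shows "db_path D u (x @ y) v \<longleftrightarrow> (\<exists>m. db_path D u x m \<and> db_path D m y v)"
proof
  show "db_path D u (x @ y) v \<Longrightarrow> \<exists>m. db_path D u x m \<and> db_path D m y v"
  proof (induction x arbitrary: u)
    case Nil
    then have "db_path D u [] u" using db_path_start[OF assms] by (auto intro: path_Nil)
    then show ?case using Nil by auto
  next
    case (Cons a x)
    then obtain z where z: "(u, a, z) \<in> snd D" "db_path D z (x @ y) v"
      by (auto elim: db_path.cases)
    then obtain m where "db_path D z x m" "db_path D m y v" using Cons.IH by blast
    then show ?case using path_Cons[OF z(1)] by blast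
  qed
  show "\<exists>m. db_path D u x m \<and> db_path D m y v \<Longrightarrow> db_path D u (x @ y) v"
  proof (elim exE conjE)
    fix m show "db_path D u x m \<Longrightarrow> db_path D m y v \<Longrightarrow> db_path D u (x @ y) v"
      by (induction rule: db_path.induct) (auto intro: db_path.intros)
  qed
qed

lemma answers_nodes: "graph_db D \<Longrightarrow> answers q D \<subseteq> fst D \<times> fst D"
  using db_path_start db_path_end unfolding answers_def by fast

lemma answers_Eps: "answers Eps D = Id_on (fst D)"
  by (auto simp: answers_def elim: db_path.cases intro: db_path.intros)

lemma answers_Sym: "graph_db D \<Longrightarrow> answers (Sym a) D = {(u, v). (u, a, v) \<in> snd D}"
  by (auto simp: answers_def graph_db_def elim!: db_path.cases[of D _ "_ # _"] db_path.cases[of D _ "[]"]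
      intro!: db_path.intros)

lemma answers_Cat: "graph_db D \<Longrightarrow> answers (Cat r s) D = answers r D O answers s D"
  by (fastforce simp: answers_def db_path_append)

lemma answers_Alt: "answers (Alt r s) D = answers r D \<union> answers s D"
  by (auto simp: answers_def)

lemma answers_Plus:
  assumes D: "graph_db D"
  shows "answers (Plus r) D = (answers r D)\<^sup>+"
proof (intro set_eqI iffI; clarify)
  fix u v assume "(u, v) \<in> answers (Plus r) D"
  then obtain ws where "ws \<noteq> []" "set ws \<subseteq> lang r" "db_path D u (concat ws) v"
    by (auto simp: answers_def)
  then show "(u, v) \<in> (answers r D)\<^sup>+"
  proof (induction ws arbitrary: u rule: list_nonempty_induct)
    case (single w)
    then show ?case by (auto simp: answers_def)
  next
    case (cons w ws)
    then obtain m where "db_path D u w m" "db_path D m (concat ws) v" by (auto simp: db_path_append[OF D])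
    then have "(u, m) \<in> answers r D" "(m, v) \<in> (answers r D)\<^sup>+"
      using cons by (auto simp: answers_def)
    then show ?case by (rule trancl_into_trancl2)
  qed
next
  fix u v assume "(u, v) \<in> (answers r D)\<^sup>+"
  then show "(u, v) \<in> answers (Plus r) D"
  proof (induction rule: trancl_induct)
    case (base v)
    then obtain w where "w \<in> lang r" "db_path D u w v" by (auto simp: answers_def)
    then show ?case by (auto simp: answers_def intro!: exI[of _ "[w]"] exI[of _ w])
  next
    case (step m v)
    then obtain ws w where "ws \<noteq> []" "set ws \<subseteq> lang r" "db_path D u (concat ws) m"
      "w \<in> lang r" "db_path D m w v" by (auto simp: answers_def)
    then have "db_path D u (concat (ws @ [w])) v" "set (ws @ [w]) \<subseteq> lang r" "ws @ [w] \<noteq> []"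
      by (auto simp: db_path_append[OF D])
    moreover from this have "concat (ws @ [w]) \<in> lang (Plus r)" unfolding lang.simps by blast
    ultimately show ?case unfolding answers_def by blast
  qed
qed

text \<open>The states of the query automaton are the gaps between the symbols of the query string:
  a subexpression that starts at position \<open>t\<close> has the initial state \<open>t\<close> and the final state
  \<open>t + rpq_size q\<close>.  The loop at a symbol is useless; it allows every symbol to contribute
  the same number of edges.\<close>

lemma rpq_size_simps [simp]:
  "rpq_size Eps = 1" "rpq_size (Sym a) = 1" "rpq_size (Plus r) = rpq_size r + 1"
  "rpq_size (Cat r s) = rpq_size r + rpq_size s + 3" "rpq_size (Alt r s) = rpq_size r + rpq_size s + 3"
  by (simp_all add: rpq_size_def)

lemma rpq_size_pos: "0 < rpq_size q"
  by (induction q) auto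

text \<open>A Thompson-style automaton read off the string: \<open>p\<close> is the position of the
  operator, \<open>c\<close> that of the closing parenthesis or of the plus sign. Each symbol
  accounts for at most two edges, which keeps the automaton linear in the query.\<close>

fun eps_edges :: "'a rpq \<Rightarrow> nat \<Rightarrow> (nat \<times> nat) set" where
  "eps_edges Eps t = {(t, t + 1)}"
| "eps_edges (Sym a) t = {(t, t)}"
| "eps_edges (Cat r s) t =
     (let p = t + 1 + rpq_size r; c = p + 1 + rpq_size s
      in {(t, t + 1), (p, p + 1), (c, c + 1)} \<union> eps_edges r (t + 1) \<union> eps_edges s (p + 1))"
| "eps_edges (Alt r s) t =
     (let p = t + 1 + rpq_size r; c = p + 1 + rpq_size s
      in {(t, t + 1), (t, p + 1), (p, c + 1), (c, c + 1)} \<union> eps_edges r (t + 1) \<union>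
         eps_edges s (p + 1))"
| "eps_edges (Plus r) t =
     (let c = t + rpq_size r in {(c, c + 1), (c, t)} \<union> eps_edges r t)"

fun sym_edges :: "'a rpq \<Rightarrow> nat \<Rightarrow> (nat \<times> 'a) set" where
  "sym_edges Eps t = {}"
| "sym_edges (Sym a) t = {(t, a)}"
| "sym_edges (Cat r s) t = sym_edges r (t + 1) \<union> sym_edges s (t + 2 + rpq_size r)"
| "sym_edges (Alt r s) t = sym_edges r (t + 1) \<union> sym_edges s (t + 2 + rpq_size r)"
| "sym_edges (Plus r) t = sym_edges r t"

definition product_edges ::
  "('v, 'a) graph_db \<Rightarrow> (nat \<times> nat) set \<Rightarrow> (nat \<times> 'a) set \<Rightarrow> (('v \<times> nat) \<times> ('v \<times> nat)) set" where
  "product_edges D Ee Ys =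
     {((u, p), (u, p')) |u p p'. u \<in> fst D \<and> (p, p') \<in> Ee} \<union>
     {((u, p), (v, p + 1)) |u p v. \<exists>a. (p, a) \<in> Ys \<and> (u, a, v) \<in> snd D}"

section \<open>Completeness and soundness of the product\<close>

lemma eps_edges_bounds: "(p, p') \<in> eps_edges q t \<Longrightarrow>
    t \<le> p \<and> p \<le> t + rpq_size q \<and> t \<le> p' \<and> p' \<le> t + rpq_size q"
  by (induction q arbitrary: t) (fastforce simp: Let_def)+

lemma sym_edges_bounds: "(p, a) \<in> sym_edges q t \<Longrightarrow> t \<le> p \<and> p < t + rpq_size q"
  by (induction q arbitrary: t) fastforce+

text \<open>Stated for arbitrary supersets \<open>Ee\<close> and \<open>Ys\<close>, so that the
  induction hypothesis for a subexpression speaks of the product with the whole automaton.\<close>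

lemma product_complete:
  assumes D: "graph_db D" and "(u, v) \<in> answers q D"
    and "eps_edges q t \<subseteq> Ee" "sym_edges q t \<subseteq> Ys"
  shows "((u, t), (v, t + rpq_size q)) \<in> (product_edges D Ee Ys)\<^sup>*"
  using assms(2-)
proof (induction q arbitrary: u v t)
  let ?G = "product_edges D Ee Ys"
  have eps: "((x, p), (x, p')) \<in> ?G" if "(p, p') \<in> Ee" "x \<in> fst D" for x p p'
    using that by (auto simp: product_edges_def)
  note nodes = answers_nodes[OF D]
  {
    case Eps
    then show ?case using eps[of t "t + 1" u] by (auto simp: answers_Eps)
  next
    case (Sym a)
    then have "((u, t), (v, t + 1)) \<in> ?G" by (auto simp: product_edges_def answers_Sym[OF D])
    then show ?case by auto
  next
    case (Cat r s)
    then obtain m where m: "(u, m) \<in> answers r D" "(m, v) \<in> answers s D"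
      by (auto simp: answers_Cat[OF D])
    let ?p = "t + 1 + rpq_size r" let ?c = "?p + 1 + rpq_size s"
    have V: "u \<in> fst D" "m \<in> fst D" "v \<in> fst D" using m nodes by fast+
    have "((u, t), (u, t + 1)) \<in> ?G" using eps V Cat.prems by (simp add: Let_def)
    moreover have "((u, t + 1), (m, ?p)) \<in> ?G\<^sup>*" using Cat.IH(1)[OF m(1), of "t + 1"] Cat.prems
      by (simp add: Let_def)
    moreover have "((m, ?p), (m, ?p + 1)) \<in> ?G" using eps V Cat.prems by (simp add: Let_def)
    moreover have "((m, ?p + 1), (v, ?c)) \<in> ?G\<^sup>*" using Cat.IH(2)[OF m(2), of "?p + 1"] Cat.prems
      by (simp add: Let_def)
    moreover have "((v, ?c), (v, ?c + 1)) \<in> ?G" using eps V Cat.prems by (simp add: Let_def)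
    ultimately have "((u, t), (v, ?c + 1)) \<in> ?G\<^sup>*"
      by (meson converse_rtrancl_into_rtrancl rtrancl.rtrancl_into_rtrancl rtrancl_trans)
    then show ?case by (simp add: algebra_simps eval_nat_numeral)
  next
    case (Alt r s)
    let ?p = "t + 1 + rpq_size r" let ?c = "?p + 1 + rpq_size s"
    have V: "u \<in> fst D" "v \<in> fst D" using Alt.prems(1) nodes by fast+
    have e: "((u, t), (u, t + 1)) \<in> ?G" "((u, t), (u, ?p + 1)) \<in> ?G"
       "((v, ?p), (v, ?c + 1)) \<in> ?G" "((v, ?c), (v, ?c + 1)) \<in> ?G"
      using eps V Alt.prems by (auto simp: Let_def)
    have "((u, t + 1), (v, ?p)) \<in> ?G\<^sup>* \<or> ((u, ?p + 1), (v, ?c)) \<in> ?G\<^sup>*"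
      using Alt.IH(1)[of u v "t + 1"] Alt.IH(2)[of u v "?p + 1"] Alt.prems
      by (auto simp: Let_def answers_Alt)
    then have "((u, t), (v, ?c + 1)) \<in> ?G\<^sup>*"
      using e by (meson converse_rtrancl_into_rtrancl rtrancl.rtrancl_into_rtrancl rtrancl_trans)
    then show ?case by (simp add: algebra_simps eval_nat_numeral)
  next
    case (Plus r)
    let ?c = "t + rpq_size r"
    have "(u, v) \<in> (answers r D)\<^sup>+" using Plus.prems(1) by (simp add: answers_Plus[OF D])
    then have "((u, t), (v, ?c)) \<in> ?G\<^sup>*"
    proof (induction rule: trancl_induct)
      case (base y)
      then show ?case using Plus.IH Plus.prems by (simp add: Let_def)
    next
      case (step y z)
      have "y \<in> fst D" using step nodes by fast
      then have "((y, ?c), (y, t)) \<in> ?G" using eps Plus.prems by (simp add: Let_def)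
      moreover have "((y, t), (z, ?c)) \<in> ?G\<^sup>*" using Plus.IH step Plus.prems by (simp add: Let_def)
      ultimately show ?case using step.IH by (meson converse_rtrancl_into_rtrancl rtrancl_trans)
    qed
    moreover have "v \<in> fst D" using Plus.prems(1) nodes by fast
    then have "((v, ?c), (v, ?c + 1)) \<in> ?G" using eps Plus.prems by (simp add: Let_def)
    ultimately show ?case by simp
  }
qed

definition backward_closed ::
  "('v, 'a) graph_db \<Rightarrow> (nat \<times> nat) set \<Rightarrow> (nat \<times> 'a) set \<Rightarrow> (nat \<Rightarrow> 'v set) \<Rightarrow> bool" where
  "backward_closed D Ee Ys R \<longleftrightarrow>
     (\<forall>(p, p') \<in> Ee. \<forall>u \<in> fst D. u \<in> R p' \<longrightarrow> u \<in> R p) \<and>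
     (\<forall>(p, a) \<in> Ys. \<forall>u v. (u, a, v) \<in> snd D \<longrightarrow> v \<in> R (p + 1) \<longrightarrow> u \<in> R p)"

lemma backward_closed_eps: "backward_closed D Ee Ys R \<Longrightarrow> (p, p') \<in> Ee \<Longrightarrow> u \<in> fst D \<Longrightarrow>
    u \<in> R p' \<Longrightarrow> u \<in> R p"
  unfolding backward_closed_def by blast

lemma backward_closed_sym: "backward_closed D Ee Ys R \<Longrightarrow> (p, a) \<in> Ys \<Longrightarrow> (u, a, v) \<in> snd D \<Longrightarrow>
    v \<in> R (p + 1) \<Longrightarrow> u \<in> R p"
  unfolding backward_closed_def by blast

text \<open>The edges of \<open>q\<close> stay among its own states; hence labellings of
  subexpressions can be glued together without disturbing each other.\<close>

lemma backward_closed_cong: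
  assumes "backward_closed D (eps_edges q t) (sym_edges q t) R"
    and "\<And>p. t \<le> p \<Longrightarrow> p \<le> t + rpq_size q \<Longrightarrow> R' p = R p"
  shows "backward_closed D (eps_edges q t) (sym_edges q t) R'"
  unfolding backward_closed_def
proof (intro conjI; clarify)
  fix p p' u assume "(p, p') \<in> eps_edges q t" "u \<in> fst D" "u \<in> R' p'"
  then show "u \<in> R' p" using assms eps_edges_bounds[of p p' q t] unfolding backward_closed_def
    by blast
next
  fix p a u v assume "(p, a) \<in> sym_edges q t" "(u, a, v) \<in> snd D" "v \<in> R' (p + 1)"
  moreover from this have "t \<le> p" "p + 1 \<le> t + rpq_size q" using sym_edges_bounds[of p a q t] by auto
  ultimately show "u \<in> R' p" using assms unfolding backward_closed_def by fastforce
qed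

text \<open>Soundness needs no decomposition of paths: for every set \<open>K\<close> of nodes that are accepted in
  the final state, the states can be labelled, consistently with all edges, such that the
  initial state is labelled with nodes that have an answer in \<open>K\<close> only.\<close>

lemma backward_labelling:
  assumes D: "graph_db D"
  shows "\<exists>R. backward_closed D (eps_edges q t) (sym_edges q t) R \<and> R (t + rpq_size q) = K \<and>
    R t \<subseteq> {u. \<exists>v\<in>K. (u, v) \<in> answers q D}"
proof (induction q arbitrary: t K)
  case Eps
  show ?case
    \<comment> \<open>\<open>K\<close> may contain elements that are not nodes, and for these the
      empty word gives no answer.\<close>
    by (rule exI[of _ "\<lambda>p. if p = t then K \<inter> fst D else K"])
      (auto simp: backward_closed_def answers_Eps)
next
  case (Sym a)
  show ?case
    by (rule exI[of _ "\<lambda>p. if p = t then {u. \<exists>v\<in>K. (u, a, v) \<in> snd D} else K"])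
      (auto simp: backward_closed_def answers_Sym[OF D])
next
  case (Cat r s)
  let ?p = "t + 1 + rpq_size r" let ?c = "?p + 1 + rpq_size s"
  \<comment> \<open>\<open>K\<close> is pulled back through \<open>s\<close> first; the labels found
    at the start of \<open>s\<close> then take the place of \<open>K\<close> for
    \<open>r\<close>.\<close>
  obtain R2 where R2: "backward_closed D (eps_edges s (?p + 1)) (sym_edges s (?p + 1)) R2"
    "R2 ?c = K" "R2 (?p + 1) \<subseteq> {u. \<exists>v\<in>K. (u, v) \<in> answers s D}"
    using Cat.IH(2)[of "?p + 1" K] by (auto simp: add.assoc)
  obtain R1 where R1: "backward_closed D (eps_edges r (t + 1)) (sym_edges r (t + 1)) R1"
    "R1 ?p = R2 (?p + 1)" "R1 (t + 1) \<subseteq> {u. \<exists>v\<in>R2 (?p + 1). (u, v) \<in> answers r D}"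
    using Cat.IH(1)[of "t + 1" "R2 (?p + 1)"] by auto
  define R where "R = (\<lambda>p. if p = t then R1 (t + 1) else if p \<le> ?p then R1 p
    else if p \<le> ?c then R2 p else K)"
  have "backward_closed D (eps_edges r (t + 1)) (sym_edges r (t + 1)) R"
    by (rule backward_closed_cong[OF R1(1)]) (auto simp: R_def)
  moreover have "backward_closed D (eps_edges s (?p + 1)) (sym_edges s (?p + 1)) R"
    by (rule backward_closed_cong[OF R2(1)]) (auto simp: R_def)
  moreover have "backward_closed D {(t, t + 1), (?p, ?p + 1), (?c, ?c + 1)} {} R"
    using R1 R2 by (auto simp: backward_closed_def R_def)
  ultimately have "backward_closed D (eps_edges (Cat r s) t) (sym_edges (Cat r s) t) R"
    by (simp add: Let_def backward_closed_def ball_Un)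
  moreover have "R (t + rpq_size (Cat r s)) = K" by (simp add: R_def)
  moreover have "R t \<subseteq> {u. \<exists>v\<in>K. (u, v) \<in> answers (Cat r s) D}"
    using R1(3) R2(3) by (fastforce simp: R_def answers_Cat[OF D])
  ultimately show ?case by blast
next
  case (Alt r s)
  let ?p = "t + 1 + rpq_size r" let ?c = "?p + 1 + rpq_size s"
  obtain R2 where R2: "backward_closed D (eps_edges s (?p + 1)) (sym_edges s (?p + 1)) R2"
    "R2 ?c = K" "R2 (?p + 1) \<subseteq> {u. \<exists>v\<in>K. (u, v) \<in> answers s D}"
    using Alt.IH(2)[of "?p + 1" K] by (auto simp: add.assoc)
  obtain R1 where R1: "backward_closed D (eps_edges r (t + 1)) (sym_edges r (t + 1)) R1"
    "R1 ?p = K" "R1 (t + 1) \<subseteq> {u. \<exists>v\<in>K. (u, v) \<in> answers r D}"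
    using Alt.IH(1)[of "t + 1" K] by auto
  define R where "R = (\<lambda>p. if p = t then R1 (t + 1) \<union> R2 (?p + 1) else if p \<le> ?p then R1 p
    else if p \<le> ?c then R2 p else K)"
  have "backward_closed D (eps_edges r (t + 1)) (sym_edges r (t + 1)) R"
    by (rule backward_closed_cong[OF R1(1)]) (auto simp: R_def)
  moreover have "backward_closed D (eps_edges s (?p + 1)) (sym_edges s (?p + 1)) R"
    by (rule backward_closed_cong[OF R2(1)]) (auto simp: R_def)
  moreover have "backward_closed D {(t, t + 1), (t, ?p + 1), (?p, ?c + 1), (?c, ?c + 1)} {} R"
    using R1 R2 by (auto simp: backward_closed_def R_def)
  ultimately have "backward_closed D (eps_edges (Alt r s) t) (sym_edges (Alt r s) t) R"
    by (simp add: Let_def backward_closed_def ball_Un)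
  moreover have "R (t + rpq_size (Alt r s)) = K" by (simp add: R_def)
  moreover have "R t \<subseteq> {u. \<exists>v\<in>K. (u, v) \<in> answers (Alt r s) D}"
    using R1(3) R2(3) by (fastforce simp: R_def answers_Alt)
  ultimately show ?case by blast
next
  case (Plus r)
  let ?c = "t + rpq_size r"
  \<comment> \<open>At the end of \<open>r\<close> a path may leave or return to \<open>t\<close>
    and iterate. \<open>K'\<close> allows for both: it contains \<open>K\<close> and, by
    \<open>start\<close> below, all of \<open>R1 t\<close>.\<close>
  define K' where "K' = K \<union> {u. \<exists>v\<in>K. (u, v) \<in> (answers r D)\<^sup>+}"
  obtain R1 where R1: "backward_closed D (eps_edges r t) (sym_edges r t) R1"
    "R1 ?c = K'" "R1 t \<subseteq> {u. \<exists>v\<in>K'. (u, v) \<in> answers r D}"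
    using Plus.IH by blast
  define R where "R = R1(Suc ?c := K)"
  have start: "R1 t \<subseteq> {u. \<exists>v\<in>K. (u, v) \<in> (answers r D)\<^sup>+}"
  proof
    fix u assume "u \<in> R1 t"
    then obtain v where "v \<in> K'" "(u, v) \<in> answers r D" using R1(3) by auto
    then show "u \<in> {u. \<exists>v\<in>K. (u, v) \<in> (answers r D)\<^sup>+}"
      by (auto simp: K'_def intro: trancl_into_trancl2 r_into_trancl)
  qed
  have "backward_closed D (eps_edges r t) (sym_edges r t) R"
    by (rule backward_closed_cong[OF R1(1)]) (auto simp: R_def)
  moreover have "backward_closed D {(?c, ?c + 1), (?c, t)} {} R"
    using R1(2) start by (auto simp: backward_closed_def R_def K'_def)
  ultimately have "backward_closed D (eps_edges (Plus r) t) (sym_edges (Plus r) t) R"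
    by (simp add: Let_def backward_closed_def)
  moreover have "R (t + rpq_size (Plus r)) = K" by (simp add: R_def)
  moreover have "R t \<subseteq> {u. \<exists>v\<in>K. (u, v) \<in> answers (Plus r) D}"
    using start by (auto simp: R_def answers_Plus[OF D])
  ultimately show ?case by blast
qed

text \<open>The labelling for \<open>K = {v}\<close> is carried backwards along the product path
  from its last node, where it holds by construction.\<close>

lemma product_sound:
  assumes D: "graph_db D"
    and "((u, t), (v, t + rpq_size q)) \<in> (product_edges D (eps_edges q t) (sym_edges q t))\<^sup>*"
  shows "(u, v) \<in> answers q D"
proof -
  obtain R where R: "backward_closed D (eps_edges q t) (sym_edges q t) R" "R (t + rpq_size q) = {v}"
    "R t \<subseteq> {u. (u, v) \<in> answers q D}"
    using backward_labelling[OF D, of q t "{v}"] by auto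
  have "fst x \<in> R (snd x)"
    if "(x, (v, t + rpq_size q)) \<in> (product_edges D (eps_edges q t) (sym_edges q t))\<^sup>*" for x
    using that
  proof (induction rule: converse_rtrancl_induct)
    case base
    then show ?case using R by simp
  next
    case (step y z)
    from step(1) consider
      u p p' where "y = (u, p)" "z = (u, p')" "u \<in> fst D" "(p, p') \<in> eps_edges q t"
    | u p v a where "y = (u, p)" "z = (v, p + 1)" "(p, a) \<in> sym_edges q t" "(u, a, v) \<in> snd D"
      by (auto simp: product_edges_def)
    then show ?case
    proof cases
      case 1
      then show ?thesis using backward_closed_eps[OF R(1)] step.IH by simp
    next
      case 2
      then show ?thesis using backward_closed_sym[OF R(1)] step.IH by simp
    qed
  qed
  from this[OF assms(2)] show ?thesis using R by auto
qed

theorem product_answers: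
  assumes "graph_db D"
  shows "((u, 0), (v, rpq_size q)) \<in> (product_edges D (eps_edges q 0) (sym_edges q 0))\<^sup>* \<longleftrightarrow>
    (u, v) \<in> answers q D"
  using product_complete[OF assms, of u v q 0] product_sound[OF assms, of u 0 v q] by auto

section \<open>Construction of the automaton\<close>

text \<open>The stacks \<open>opens\<close> and \<open>ops\<close> of height \<open>depth\<close> record, for each unclosed parenthesis, its
  position and the position of its operator; \<open>start\<close> is the start of the subexpression that
  was completed last.\<close>

record 'a parser =
  start :: nat
  depth :: nat
  opens :: "nat \<Rightarrow> nat"
  ops :: "nat \<Rightarrow> nat"
  eps :: "(nat \<times> nat) set"
  syms :: "(nat \<times> 'a) set"

text \<open>A one-pass description halfway between recursion on \<open>q\<close> and the machine
  loop. The target of the edge that skips the second alternative is known only at the closing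
  parenthesis, which is why operator positions are stacked as well.\<close>

fun parse_token :: "'a token list \<Rightarrow> nat \<Rightarrow> 'a token \<Rightarrow> 'a parser \<Rightarrow> 'a parser" where
  "parse_token ts t TEps c = c\<lparr>start := t, eps := eps c \<union> {(t, t + 1)}\<rparr>"
| "parse_token ts t (TSym a) c =
     c\<lparr>start := t, eps := eps c \<union> {(t, t)}, syms := syms c \<union> {(t, a)}\<rparr>"
| "parse_token ts t TOpen c = c\<lparr>depth := depth c + 1, opens := (opens c)(depth c := t),
     eps := eps c \<union> {(t, t + 1)}\<rparr>"
| "parse_token ts t TCat c = c\<lparr>ops := (ops c)(depth c - 1 := t), eps := eps c \<union> {(t, t + 1)}\<rparr>"
| "parse_token ts t TAlt c = c\<lparr>ops := (ops c)(depth c - 1 := t),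
     eps := eps c \<union> {(opens c (depth c - 1), t + 1)}\<rparr>"
| "parse_token ts t TClose c = c\<lparr>start := opens c (depth c - 1), depth := depth c - 1,
     eps := eps c \<union> {(t, t + 1)} \<union>
       (let p = ops c (depth c - 1) in if ts ! p = TAlt then {(p, t + 1)} else {})\<rparr>"
| "parse_token ts t TPlus c = c\<lparr>eps := eps c \<union> {(t, t + 1), (t, start c)}\<rparr>"

definition parse :: "'a token list \<Rightarrow> nat \<Rightarrow> nat \<Rightarrow> 'a parser \<Rightarrow> 'a parser" where
  "parse ts t t' c = fold (\<lambda>i. parse_token ts i (ts ! i)) [t..<t'] c"

lemma parse_Suc: "t \<le> t' \<Longrightarrow> parse ts t (Suc t') c = parse_token ts t' (ts ! t') (parse ts t t' c)"
  by (simp add: parse_def)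

lemma parse_refl: "parse ts t t c = c"
  by (simp add: parse_def)

lemma parse_trans: "t \<le> t' \<Longrightarrow> t' \<le> t'' \<Longrightarrow> parse ts t t'' c = parse ts t' t'' (parse ts t t' c)"
  using upt_add_eq_append[of t t' "t'' - t'"] by (simp add: parse_def)

text \<open>Stack cells from \<open>depth\<close> upwards may hold leftovers of subexpressions
  already closed, so only those below are preserved.\<close>

definition parsed :: "'a rpq \<Rightarrow> nat \<Rightarrow> 'a parser \<Rightarrow> 'a parser \<Rightarrow> bool" where
  "parsed q t c c' \<longleftrightarrow> start c' = t \<and> depth c' = depth c \<and>
     (\<forall>i<depth c. opens c' i = opens c i \<and> ops c' i = ops c i) \<and>
     eps c' = eps c \<union> eps_edges q t \<and> syms c' = syms c \<union> sym_edges q t"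

definition occurs :: "'a token list \<Rightarrow> nat \<Rightarrow> 'a token list \<Rightarrow> bool" where
  "occurs xs t ts \<longleftrightarrow> (\<forall>i<length xs. ts ! (t + i) = xs ! i)"

lemma occurs_append [simp]: "occurs (xs @ ys) t ts \<longleftrightarrow> occurs xs t ts \<and> occurs ys (t + length xs) ts"
proof
  assume *: "occurs (xs @ ys) t ts"
  then have "ts ! (t + length xs + i) = ys ! i" if "i < length ys" for i
    using that unfolding occurs_def
    by (metis add.assoc length_append nat_add_left_cancel_less nth_append_length_plus)
  with * show "occurs xs t ts \<and> occurs ys (t + length xs) ts"
    by (auto simp: occurs_def nth_append)
next
  assume *: "occurs xs t ts \<and> occurs ys (t + length xs) ts"
  show "occurs (xs @ ys) t ts" unfolding occurs_def
  proof (intro allI impI)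
    fix i assume "i < length (xs @ ys)"
    then show "ts ! (t + i) = (xs @ ys) ! i"
      using * by (cases "i < length xs") (auto simp: occurs_def nth_append dest: spec[of _ "i - length xs"])
  qed
qed

lemma occurs_single [simp]: "occurs [x] t ts \<longleftrightarrow> ts ! t = x"
  by (simp add: occurs_def)

lemma length_rpq_string [simp]: "length (rpq_string q) = rpq_size q"
  by (simp add: rpq_size_def)

text \<open>The position and the parser state are arbitrary, so that the claim applies to a
  subexpression inside open parentheses. Preservation of the lower stack lets the closing token find
  its own opening and operator again.\<close>

lemma parsed_parse:
  "occurs (rpq_string q) t ts \<Longrightarrow> parsed q t c (parse ts t (t + rpq_size q) c)"
proof (induction q arbitrary: t c)
  case Eps
  then show ?case by (simp add: parse_Suc parse_refl parsed_def)
next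
  case (Sym a)
  then show ?case by (simp add: parse_Suc parse_refl parsed_def)
next
  case (Plus r)
  then have "parsed r t c (parse ts t (t + rpq_size r) c)" by simp
  then show ?case using Plus.prems by (auto simp: parse_Suc parsed_def Let_def)
next
  case (Cat r s)
  define p where "p = Suc t + rpq_size r"
  define e where "e = Suc p + rpq_size s"
  have ts: "ts ! t = TOpen" "occurs (rpq_string r) (Suc t) ts" "ts ! p = TCat"
    "occurs (rpq_string s) (Suc p) ts" "ts ! e = TClose"
    using Cat.prems occurs_append[of "[TOpen]"] by (simp_all add: p_def e_def del: append_Cons)
  define c1 where "c1 = parse_token ts t TOpen c"
  define c2 where "c2 = parse ts (Suc t) p c1"
  define c3 where "c3 = parse_token ts p TCat c2"
  define c4 where "c4 = parse ts (Suc p) e c3"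
  have r: "parsed r (Suc t) c1 c2" using Cat.IH(1)[OF ts(2)] by (simp add: c2_def p_def)
  have s: "parsed s (Suc p) c3 c4" using Cat.IH(2)[OF ts(4)] by (simp add: c4_def e_def)
  have "parse ts t (Suc p) c = c3"
    using parse_trans[of t "Suc t" p ts c] ts
    by (simp add: p_def parse_Suc parse_refl c1_def c2_def c3_def)
  then have "parse ts t (Suc e) c = parse_token ts e TClose c4"
    using parse_trans[of t "Suc p" e ts c] ts by (simp add: p_def e_def parse_Suc c4_def)
  moreover have "t + rpq_size (Cat r s) = Suc e" by (simp add: p_def e_def)
  moreover have "parsed (Cat r s) t c (parse_token ts e TClose c4)"
    using r s ts unfolding parsed_def
    by (auto simp: c1_def c3_def Let_def p_def e_def less_Suc_eq)
  ultimately show ?case by (simp only:)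
next
  case (Alt r s)
  define p where "p = Suc t + rpq_size r"
  define e where "e = Suc p + rpq_size s"
  have ts: "ts ! t = TOpen" "occurs (rpq_string r) (Suc t) ts" "ts ! p = TAlt"
    "occurs (rpq_string s) (Suc p) ts" "ts ! e = TClose"
    using Alt.prems occurs_append[of "[TOpen]"] by (simp_all add: p_def e_def del: append_Cons)
  define c1 where "c1 = parse_token ts t TOpen c"
  define c2 where "c2 = parse ts (Suc t) p c1"
  define c3 where "c3 = parse_token ts p TAlt c2"
  define c4 where "c4 = parse ts (Suc p) e c3"
  have r: "parsed r (Suc t) c1 c2" using Alt.IH(1)[OF ts(2)] by (simp add: c2_def p_def)
  have s: "parsed s (Suc p) c3 c4" using Alt.IH(2)[OF ts(4)] by (simp add: c4_def e_def)
  have "parse ts t (Suc p) c = c3"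
    using parse_trans[of t "Suc t" p ts c] ts
    by (simp add: p_def parse_Suc parse_refl c1_def c2_def c3_def)
  then have "parse ts t (Suc e) c = parse_token ts e TClose c4"
    using parse_trans[of t "Suc p" e ts c] ts by (simp add: p_def e_def parse_Suc c4_def)
  moreover have "t + rpq_size (Alt r s) = Suc e" by (simp add: p_def e_def)
  moreover have "parsed (Alt r s) t c (parse_token ts e TClose c4)"
    using r s ts unfolding parsed_def
    by (auto simp: c1_def c3_def Let_def p_def e_def less_Suc_eq)
  ultimately show ?case by (simp only:)
qed

section \<open>Edge arrays and the layout of the input\<close>

lemma edges_0 [simp]: "edges 0 S T = {}"
  by (simp add: edges_def)

lemma edges_Suc [simp]: "edges (Suc M) S T = insert (S M, T M) (edges M S T)"
  by (auto simp: edges_def less_Suc_eq)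

lemma edges_image: "edges M S T = (\<lambda>j. (S j, T j)) ` {..<M}"
  by (auto simp: edges_def)

lemma edges_upd_source [simp]: "M \<le> i \<Longrightarrow> edges M (S(i := x)) T = edges M S T"
  unfolding edges_image by (intro image_cong) auto

lemma edges_upd_target [simp]: "M \<le> i \<Longrightarrow> edges M S (T(i := x)) = edges M S T"
  unfolding edges_image by (intro image_cong) auto

definition IfEq :: "expr \<Rightarrow> expr \<Rightarrow> com \<Rightarrow> com \<Rightarrow> com" where
  "IfEq e f c d = IfLess e f d (IfLess f e d c)"

lemma IfEq_simps [simp]:
  "written (IfEq e f c d) = written c \<union> written d"
  "written_arrs (IfEq e f c d) = written_arrs c \<union> written_arrs d"
  "legal (IfEq e f c d) \<longleftrightarrow> legal_expr e \<and> legal_expr f \<and> legal c \<and> legal d"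
  by (auto simp: IfEq_def)

lemma (in machine) wp_IfEq [simp]:
  "wp (IfEq e f c d) Q s \<longleftrightarrow> safe s e \<and> safe s f \<and>
     (if val s e = val s f then wp c Q s else wp d Q s)"
  by (auto simp: IfEq_def)

lemma token_code_Alt: "token_code code x = 4 \<longleftrightarrow> x = TAlt"
  by (cases x) auto

lemma token_code_Sym: "inj code \<Longrightarrow> token_code code x = 6 + code a \<longleftrightarrow> x = TSym a"
  by (cases x) (auto dest: injD)

definition degrees :: "('a \<times> nat) list list \<Rightarrow> nat \<Rightarrow> nat" where
  "degrees adj u = (\<Sum>x<u. length (adj ! x))"

definition row :: "('a \<Rightarrow> nat) \<Rightarrow> ('a \<times> nat) list \<Rightarrow> nat list" where
  "row code l = length l # concat (map (\<lambda>(a, j). [code a, j]) l)"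

lemma length_arcs: "length (concat (map (\<lambda>(a, j). [code a, j]) l)) = 2 * length l"
  by (induction l) auto

lemma length_row: "length (row code l) = 1 + 2 * length l"
  by (simp add: row_def length_arcs)

lemma nth_arcs:
  "k < length l \<Longrightarrow> concat (map (\<lambda>(a, j). [code a, j]) l) ! (2 * k) = code (fst (l ! k)) \<and>
     concat (map (\<lambda>(a, j). [code a, j]) l) ! (Suc (2 * k)) = snd (l ! k)"
proof (induction l arbitrary: k)
  case (Cons x l)
  then show ?case by (cases k) (auto split: prod.splits)
qed simp

lemma length_rows: "u \<le> length adj \<Longrightarrow>
    length (concat (map (row code) (take u adj))) = u + 2 * degrees adj u"
proof (induction u)
  case (Suc u)
  then show ?case by (simp add: take_Suc_conv_app_nth length_row degrees_def)
qed (simp add: degrees_def)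

lemma nth_rows:
  assumes "u < length adj" "i < length (row code (adj ! u))"
  shows "concat (map (row code) adj) ! (u + 2 * degrees adj u + i) = row code (adj ! u) ! i"
proof -
  have "adj = take u adj @ adj ! u # drop (Suc u) adj" using assms by (simp add: id_take_nth_drop)
  then have "concat (map (row code) adj) = concat (map (row code) (take u adj)) @
      row code (adj ! u) @ concat (map (row code) (drop (Suc u) adj))"
    by (metis concat.simps(2) concat_append list.simps(9) map_append)
  then show ?thesis using assms length_rows[of u adj code]
    by (simp add: nth_append)
qed

text \<open>The sum \<open>large\<close> adds up what the program has to represent: product nodes,
  product edges, input positions, and some slack for small literals.\<close>

locale encoded_input = machine Z "input_words code adj q"
  for Z :: nat and code :: "'a \<Rightarrow> nat" and adj :: "('a \<times> nat) list list" and q :: "'a rpq" +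
  assumes inj_code: "inj code"
    and targets: "l \<in> set adj \<Longrightarrow> (a, j) \<in> set l \<Longrightarrow> j < length adj"
    and code_less: "code a + 6 < Z"
    and large: "length adj * (rpq_size q + 1) + length adj + 2 * rpq_size q * length adj +
      rpq_size q * degrees adj (length adj) + length (input_words code adj q) +
      2 * rpq_size q + 20 < Z"
begin

abbreviation n :: nat where "n \<equiv> length adj"
abbreviation L :: nat where "L \<equiv> rpq_size q"
abbreviation ts :: "'a token list" where "ts \<equiv> rpq_string q"
abbreviation inp :: "nat list" where "inp \<equiv> input_words code adj q"

lemma inp_eq: "inp = [n, L] @ map (token_code code) ts @ concat (map (row code) adj)"
  by (simp add: input_words_def row_def[abs_def])

lemma inp_0 [simp]: "inp ! 0 = n" and inp_1 [simp]: "inp ! Suc 0 = L"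
  by (simp_all add: inp_eq)

lemma inp_token: "t < L \<Longrightarrow> inp ! Suc (Suc t) = token_code code (ts ! t)"
  by (simp add: inp_eq nth_append)

text \<open>Where the entry of node \<open>u\<close> begins in the input: two header words and the
  \<open>L\<close> query symbols, then one degree word per earlier node and two words per earlier
  arc.\<close>

definition pos :: "nat \<Rightarrow> nat" where
  "pos u = L + 2 + u + 2 * degrees adj u"

lemma length_inp: "length inp = pos n"
  using length_rows[of n adj code] by (simp add: inp_eq pos_def)

lemma degrees_Suc: "degrees adj (Suc u) = degrees adj u + length (adj ! u)"
  by (simp add: degrees_def)

lemma degrees_mono: "u \<le> v \<Longrightarrow> degrees adj u \<le> degrees adj v"
  unfolding degrees_def by (intro sum_mono2) auto

lemma inp_row: "u < n \<Longrightarrow> i < length (row code (adj ! u)) \<Longrightarrow>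
    inp ! (pos u + i) = row code (adj ! u) ! i"
  using nth_rows[of u adj i code] by (simp add: inp_eq pos_def nth_append add.assoc)

lemma inp_degree: "u < n \<Longrightarrow> inp ! pos u = length (adj ! u)"
  using inp_row[of u 0] by (simp add: row_def)

lemma inp_arc:
  assumes "u < n" "k < length (adj ! u)"
  shows "inp ! (pos u + 1 + 2 * k) = code (fst (adj ! u ! k))"
    and "inp ! (pos u + 2 + 2 * k) = snd (adj ! u ! k)"
  using inp_row[of u "1 + 2 * k"] inp_row[of u "2 + 2 * k"] assms nth_arcs[of k "adj ! u" code]
    length_row[of code "adj ! u"] by (simp_all add: row_def)

lemma pos_less: "u < n \<Longrightarrow> pos u + 2 * length (adj ! u) < length inp"
  using degrees_mono[of "Suc u" n] by (simp add: length_inp pos_def degrees_Suc)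

end

text \<open>Variables: \<open>1\<close> holds the length of the query, \<open>6\<close> and \<open>7\<close> hold \<open>start\<close> and \<open>depth\<close>, and \<open>9\<close>
  holds the current position.  The arrays \<open>4\<close> and \<open>5\<close> are the stacks, and the epsilon edges are
  stored in the arrays \<open>2\<close> and \<open>3\<close>, two edges for each symbol of the query.\<close>

definition parse_body :: com where
  "parse_body =
     Assign 10 (Inp (EAdd (Lit 2) (Var 9))) ;;
     Assign 11 (EMul (Lit 2) (Var 9)) ;;
     Assign 12 (EAdd (Var 11) (Lit 1)) ;;
     Write 2 (Var 11) (Var 9) ;; Write 3 (Var 11) (EAdd (Var 9) (Lit 1)) ;;
     Write 2 (Var 12) (Var 9) ;; Write 3 (Var 12) (EAdd (Var 9) (Lit 1)) ;;
     IfLess (Var 10) (Lit 1) (Assign 6 (Var 9)) (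
     IfLess (Var 10) (Lit 2)
       (Write 4 (Var 7) (Var 9) ;; Assign 7 (EAdd (Var 7) (Lit 1))) (
     IfLess (Var 10) (Lit 3)
       (Assign 7 (ESub (Var 7) (Lit 1)) ;; Assign 6 (Arr 4 (Var 7)) ;;
        IfEq (Inp (EAdd (Lit 2) (Arr 5 (Var 7)))) (Lit 4) (Write 2 (Var 12) (Arr 5 (Var 7))) Skip) (
     IfLess (Var 10) (Lit 4)
       (Write 5 (ESub (Var 7) (Lit 1)) (Var 9)) (
     IfLess (Var 10) (Lit 5)
       (Write 5 (ESub (Var 7) (Lit 1)) (Var 9) ;;
        Write 2 (Var 11) (Arr 4 (ESub (Var 7) (Lit 1))) ;;
        Write 2 (Var 12) (Arr 4 (ESub (Var 7) (Lit 1)))) (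
     IfLess (Var 10) (Lit 6)
       (Write 3 (Var 12) (Var 6))
       (Assign 6 (Var 9) ;; Write 3 (Var 11) (Var 9) ;; Write 3 (Var 12) (Var 9)))))))"

definition parse_com :: com where
  "parse_com = For 9 1 parse_body"

lemma written_parse_com: "written parse_com = {6, 7, 9, 10, 11, 12}"
  and written_arrs_parse_com: "written_arrs parse_com = {2, 3, 4, 5}"
  and legal_parse_com: "legal parse_com"
  by (auto simp: parse_com_def parse_body_def)

text \<open>All cells of \<open>ops\<close> are bounded because their contents are used as query
  positions when the input is read; the bound on \<open>depth\<close> keeps the stack pointer below
  \<open>Z\<close>.\<close>

definition represents :: "state \<Rightarrow> nat \<Rightarrow> 'a parser \<Rightarrow> bool" where
  "represents s t c \<longleftrightarrow> vars s 6 = start c \<and> vars s 7 = depth c \<and> arrs s 4 = opens c \<and>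
     arrs s 5 = ops c \<and> edges (2 * t) (arrs s 2) (arrs s 3) = eps c \<and> depth c \<le> t \<and>
     (\<forall>i. ops c i \<le> t)"

definition parser_init :: "'a parser" where
  "parser_init = \<lparr>start = 0, depth = 0, opens = (\<lambda>_. 0), ops = (\<lambda>_. 0), eps = {}, syms = {}\<rparr>"

lemma syms_parse: "syms (parse ts 0 t parser_init) = {(p, a). p < t \<and> ts ! p = TSym a}"
proof (induction t)
  case (Suc t)
  have "syms (parse_token ts t x c) = syms c \<union> {(p, a). p = t \<and> x = TSym a}"
    for x and c :: "'a parser" by (cases x) auto
  then show ?case using Suc by (auto simp: parse_Suc less_Suc_eq)
qed (simp add: parse_refl parser_init_def)

text \<open>The second equation is why the program stores no symbol edges: they can be read directly
  off the query string.\<close>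

lemma parse_rpq_string:
  "eps (parse (rpq_string q) 0 (rpq_size q) parser_init) = eps_edges q 0"
  "sym_edges q 0 = {(p, a). p < rpq_size q \<and> rpq_string q ! p = TSym a}"
proof -
  have "parsed q 0 parser_init (parse (rpq_string q) 0 (0 + rpq_size q) parser_init)"
    by (rule parsed_parse) (simp add: occurs_def)
  then show "eps (parse (rpq_string q) 0 (rpq_size q) parser_init) = eps_edges q 0"
    "sym_edges q 0 = {(p, a). p < rpq_size q \<and> rpq_string q ! p = TSym a}"
    by (simp_all add: parsed_def syms_parse) (simp_all add: parser_init_def)
qed

section \<open>Verification of the parsing loop\<close>

context encoded_input
begin

text \<open>The body writes the edge \<open>(t, t + 1)\<close> twice and then overwrites sources or
  targets according to the symbol. Duplicates are harmless, since \<open>edges\<close> is a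
  set.\<close>

lemma wp_parse_body:
  assumes t: "t < L" "vars s 9 = t" and rep: "represents s t c"
  shows "wp parse_body (\<lambda>s'. represents (s'\<lparr>vars := (vars s')(9 := Suc t), ticks := Suc (ticks s')\<rparr>)
    (Suc t) (parse_token ts t (ts ! t) c) \<and> ticks s' \<le> ticks s + 0) s"
proof -
  have Z: "2 * L + 20 < Z" "length inp < Z" using large by linarith+
  have tZ: "Suc (Suc t) < length inp" "2 * t + 2 < Z" "t + 2 < Z"
    using t Z by (auto simp: length_inp pos_def)
  have op: "ops c i < L" "Suc (Suc (ops c i)) < length inp" "ops c i + 2 < Z" for i
  proof -
    show "ops c i < L" using rep t by (auto simp: represents_def intro: le_less_trans)
    then show "Suc (Suc (ops c i)) < length inp" "ops c i + 2 < Z"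
      using Z by (auto simp: length_inp pos_def)
  qed
  note tok = inp_token[OF t(1)]
  note alt = inp_token[OF op(1)]
  have le: "depth c \<le> t" "\<And>i. ops c i \<le> t" using rep by (auto simp: represents_def)
  show ?thesis
    unfolding parse_body_def
    by (cases "ts ! t")
      (use rep t Z tZ op tok alt le in
        \<open>auto simp: represents_def Let_def le_Suc_eq token_code_Alt intro: le_SucI\<close>)
qed

lemma wp_parse:
  assumes "vars s0 1 = L" "vars s0 6 = 0" "vars s0 7 = 0" "arrs s0 4 = (\<lambda>_. 0)" "arrs s0 5 = (\<lambda>_. 0)"
    and post: "\<And>s. edges (2 * L) (arrs s 2) (arrs s 3) = eps_edges q 0 \<Longrightarrow>
      frame parse_com s0 s \<Longrightarrow> ticks s \<le> ticks s0 + L \<Longrightarrow> Q s"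
  shows "wp parse_com Q s0"
  unfolding parse_com_def
proof (rule wp_For[where n = L and T = "\<lambda>_. 0" and
      J = "\<lambda>t s. represents s t (parse ts 0 t parser_init)"], goal_cases)
  case (7 t s)
  then show ?case using wp_parse_body[of t s] by (simp add: parse_Suc)
next
  case (8 s)
  then show ?case by (intro post) (auto simp: represents_def parse_rpq_string parse_com_def)
qed (use assms large in \<open>auto simp: parse_body_def represents_def parse_refl parser_init_def\<close>)

end

section \<open>Construction of the product\<close>

definition emit :: "expr \<Rightarrow> expr \<Rightarrow> com" where
  "emit e f = Write 0 (Var 3) e ;; Write 1 (Var 3) f ;; Assign 3 (EAdd (Var 3) (Lit 1))"

definition eps_com :: com where
  "eps_com = Assign 5 (EMul (Lit 2) (Var 1)) ;;
     For 11 5 (For 12 0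
       (emit (EAdd (EMul (Var 12) (Var 2)) (Arr 2 (Var 11)))
             (EAdd (EMul (Var 12) (Var 2)) (Arr 3 (Var 11)))))"

text \<open>Variables \<open>12\<close>, \<open>15\<close> and \<open>16\<close> hold source, label
  and target of the current arc. Comparing it with every query symbol costs \<open>L\<close> rounds
  per arc, which the bound \<open>|D| |q|\<close> allows.\<close>

definition arc_com :: com where
  "arc_com = For 17 1
     (IfEq (Inp (EAdd (Lit 2) (Var 17))) (EAdd (Lit 6) (Var 15))
       (emit (EAdd (EMul (Var 12) (Var 2)) (Var 17))
             (EAdd (EMul (Var 16) (Var 2)) (EAdd (Var 17) (Lit 1)))) Skip)"

definition row_com :: com where
  "row_com = Assign 14 (Inp (Var 8)) ;; Assign 8 (EAdd (Var 8) (Lit 1)) ;;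
     For 13 14
       (Assign 15 (Inp (Var 8)) ;; Assign 16 (Inp (EAdd (Var 8) (Lit 1))) ;;
        Assign 8 (EAdd (Var 8) (Lit 2)) ;; arc_com)"

definition sym_com :: com where
  "sym_com = Assign 8 (EAdd (Lit 2) (Var 1)) ;; For 12 0 row_com"

lemma frame_simps [simp]:
  "written eps_com = {3, 5, 11, 12}" "written_arrs eps_com = {0, 1}" "legal eps_com"
  "written arc_com = {3, 17}" "written_arrs arc_com = {0, 1}" "legal arc_com"
  "written row_com = {3, 8, 13, 14, 15, 16, 17}" "written_arrs row_com = {0, 1}" "legal row_com"
  "written sym_com = {3, 8, 12, 13, 14, 15, 16, 17}" "written_arrs sym_com = {0, 1}" "legal sym_com"
  by (auto simp: eps_com_def arc_com_def row_com_def sym_com_def emit_def)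

context encoded_input
begin

abbreviation K :: nat where "K \<equiv> Suc L"

lemma large': "n * K + n + 2 * L * n + L * degrees adj n + length inp + 2 * L + 20 < Z"
  using large by simp

definition graph_edges :: "state \<Rightarrow> (nat \<times> nat) set" where
  "graph_edges s = edges (vars s 3) (arrs s 0) (arrs s 1)"

lemma node_less: "u < n \<Longrightarrow> p \<le> L \<Longrightarrow> u * K + p < n * K"
proof -
  assume "u < n" "p \<le> L"
  then have "Suc u * K \<le> n * K" by (intro mult_le_mono1) simp
  then show ?thesis using \<open>p \<le> L\<close> by simp
qed

lemma wp_eps:
  assumes v: "vars s0 0 = n" "vars s0 1 = L" "vars s0 2 = K" "vars s0 3 = 0"
    and bound: "\<And>j. j < 2 * L \<Longrightarrow> arrs s0 2 j \<le> L \<and> arrs s0 3 j \<le> L"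
    and post: "\<And>s. graph_edges s = (\<Union>u<n. (\<lambda>(p, p'). (u * K + p, u * K + p')) `
        edges (2 * L) (arrs s0 2) (arrs s0 3)) \<Longrightarrow> vars s 3 = 2 * L * n \<Longrightarrow>
      frame eps_com s0 s \<Longrightarrow> ticks s \<le> ticks s0 + 2 * L * (n + 1) \<Longrightarrow> Q s"
  shows "wp eps_com Q s0"
  unfolding eps_com_def wp_Seq wp_Assign
proof (intro conjI, goal_cases)
  case 2
  let ?X = "arrs s0 2" and ?Y = "arrs s0 3"
  let ?E = "\<lambda>e. \<Union>u<n. (\<lambda>(p, p'). (u * K + p, u * K + p')) ` edges e ?X ?Y"
  have Z: "n * K + n + 2 * L * n + 2 * L + 20 < Z" using large by simp
  show ?case
  proof (rule wp_For[where n = "2 * L" and T = "\<lambda>_. n" and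
        J = "\<lambda>e s. vars s 3 = e * n \<and> graph_edges s = ?E e"], goal_cases)
    case (7 e s)
    then have e: "e < 2 * L" by simp
    have fr: "vars s 0 = n" "vars s 1 = L" "vars s 2 = K" "arrs s 2 = ?X" "arrs s 3 = ?Y"
      "vars s 11 = e"
      using 7 v by (auto simp: frame_def emit_def)
    show ?case
    proof (rule wp_For[where n = n and T = "\<lambda>_. 0" and
          J = "\<lambda>u s'. vars s' 3 = e * n + u \<and> graph_edges s' =
            graph_edges s \<union> (\<Union>u'<u. {(u' * K + ?X e, u' * K + ?Y e)})"], goal_cases)
      case (7 u s')
      then have fr': "vars s' 2 = K" "vars s' 11 = e" "arrs s' 2 = ?X" "arrs s' 3 = ?Y" "vars s' 12 = u"
        using fr by (auto simp: frame_def emit_def)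
      have "Suc e * n \<le> 2 * L * n" using e by (intro mult_le_mono1) simp
      then have m: "e * n + u + 1 < Z" using 7 Z by simp
      have uK: "u * K + ?X e < n * K" "u * K + ?Y e < n * K" using 7 bound[OF e] node_less by auto
      then have "u * K < Z" "u * K + ?X e < Z" "u * K + ?Y e < Z" using Z by linarith+
      then show ?case using 7 fr' m Z by (auto simp: graph_edges_def emit_def lessThan_Suc)
    next
      case (8 s')
      have "?E (Suc e) = ?E e \<union> (\<Union>u<n. {(u * K + ?X e, u * K + ?Y e)})" by auto
      moreover have "vars s' 3 = e * n + n" "graph_edges s' = ?E e \<union>
          (\<Union>u<n. {(u * K + ?X e, u * K + ?Y e)})" using 8(1) 7(2) by simp_all
      ultimately have "vars s' 3 = Suc e * n" "graph_edges s' = ?E (Suc e)" by simp_all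
      then show ?case using 8(3) by (simp only: graph_edges_def) simp
    qed (use fr 7 Z in \<open>auto simp: emit_def graph_edges_def\<close>)
  next
    case (8 s)
    show ?case
    proof (rule post)
      show "frame eps_com s0 s"
        using 8(2) by (auto simp: frame_def) (auto simp: emit_def)
    qed (use 8 in \<open>auto simp: algebra_simps\<close>)
  qed (use v Z in \<open>auto simp: emit_def graph_edges_def\<close>)
qed (use v large in auto)

definition arc_edges :: "nat \<Rightarrow> 'a \<times> nat \<Rightarrow> nat \<Rightarrow> (nat \<times> nat) set" where
  "arc_edges u x m = {(u * K + p, snd x * K + Suc p) |p. p < m \<and> ts ! p = TSym (fst x)}"

lemma arc_edges_0 [simp]: "arc_edges u x 0 = {}"
  by (simp add: arc_edges_def)

lemma arc_edges_Suc: "arc_edges u x (Suc m) = arc_edges u x m \<union>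
    (if ts ! m = TSym (fst x) then {(u * K + m, snd x * K + Suc m)} else {})"
  by (auto simp: arc_edges_def less_Suc_eq)

lemma wp_arc:
  assumes v: "vars s0 1 = L" "vars s0 2 = K" "vars s0 12 = u" "vars s0 15 = code (fst x)"
      "vars s0 16 = snd x"
    and u: "u < n" "snd x < n" and M: "vars s0 3 + L < Z"
    and post: "\<And>s. graph_edges s = graph_edges s0 \<union> arc_edges u x L \<Longrightarrow>
      vars s 3 \<le> vars s0 3 + L \<Longrightarrow> frame arc_com s0 s \<Longrightarrow> ticks s \<le> ticks s0 + L \<Longrightarrow> Q s"
  shows "wp arc_com Q s0"
  unfolding arc_com_def
proof (rule wp_For[where n = L and T = "\<lambda>_. 0" and J = "\<lambda>p s. vars s 3 \<le> vars s0 3 + p \<and>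
      graph_edges s = graph_edges s0 \<union> arc_edges u x p"], goal_cases)
  case (7 p s)
  then have fr: "vars s 2 = K" "vars s 12 = u" "vars s 15 = code (fst x)" "vars s 16 = snd x"
    "vars s 17 = p"
    using v by (auto simp: frame_def emit_def)
  have Z: "n * K + 2 * L + 20 < Z" "length inp < Z" using large' by linarith+
  have uK: "u * K + p < n * K" "snd x * K + Suc p < n * K"
    using 7 node_less[OF u(1), of p] node_less[OF u(2), of "Suc p"] by auto
  then have "u * K < Z" "u * K + p < Z" "snd x * K < Z" "snd x * K + Suc p < Z" using Z by linarith+
  moreover have "Suc (Suc p) < length inp" using 7 by (auto simp: length_inp pos_def)
  moreover have "code (fst x) + 6 < Z" by (rule code_less)
  ultimately show ?case
    using 7 fr Z M by (auto simp: graph_edges_def emit_def arc_edges_Suc inp_token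
        token_code_Sym[OF inj_code] simp del: mult_Suc_right)
next
  case (8 s)
  then show ?case by (intro post) (auto simp: arc_com_def)
qed (use v large in \<open>auto simp: emit_def graph_edges_def\<close>)

definition row_edges :: "nat \<Rightarrow> nat \<Rightarrow> (nat \<times> nat) set" where
  "row_edges u k = (\<Union>i<k. arc_edges u (adj ! u ! i) L)"

lemma wp_row:
  assumes v: "vars s0 1 = L" "vars s0 2 = K" "vars s0 12 = u" "vars s0 8 = pos u"
    and u: "u < n" and M: "vars s0 3 + length (adj ! u) * L < Z"
    and post: "\<And>s. graph_edges s = graph_edges s0 \<union> row_edges u (length (adj ! u)) \<Longrightarrow>
      vars s 3 \<le> vars s0 3 + length (adj ! u) * L \<Longrightarrow> vars s 8 = pos (Suc u) \<Longrightarrow>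
      frame row_com s0 s \<Longrightarrow> ticks s \<le> ticks s0 + length (adj ! u) * K \<Longrightarrow> Q s"
  shows "wp row_com Q s0"
  unfolding row_com_def wp_Seq wp_Assign
proof (intro conjI, goal_cases)
  have Z: "length inp + 20 < Z" using large by linarith
  have p: "pos u + 2 * length (adj ! u) < length inp" using pos_less[OF u] .
  {
    case 1
    then show ?case using v p by simp
  next
    case 2
    then show ?case using v p Z by simp
  next
    case 3
    let ?d = "length (adj ! u)"
    show ?case
    proof (rule wp_For[where n = ?d and T = "\<lambda>_. L" and
          J = "\<lambda>k s. vars s 3 \<le> vars s0 3 + k * L \<and> vars s 8 = pos u + 1 + 2 * k \<and>
            graph_edges s = graph_edges s0 \<union> row_edges u k"], goal_cases)
      case (7 k s)
      then have fr: "vars s 1 = L" "vars s 2 = K" "vars s 12 = u" using v by (auto simp: frame_def)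
      have x: "inp ! (pos u + 1 + 2 * k) = code (fst (adj ! u ! k))"
        "inp ! (pos u + 2 + 2 * k) = snd (adj ! u ! k)"
        using inp_arc[OF u 7(1)] by auto
      have xn: "snd (adj ! u ! k) < n"
        using targets[of "adj ! u" "fst (adj ! u ! k)" "snd (adj ! u ! k)"] u 7(1) by simp
      have "Suc k * L \<le> ?d * L" using 7(1) by (intro mult_le_mono1) simp
      then have Mk: "vars s 3 + L < Z" using 7 M by simp
      let ?s = "s\<lparr>vars := (vars s)(15 := code (fst (adj ! u ! k)), 16 := snd (adj ! u ! k),
        8 := pos u + 1 + 2 * Suc k)\<rparr>"
      have "wp arc_com (\<lambda>s'. (vars s' 3 \<le> vars s0 3 + Suc k * L \<and> vars s' 8 = pos u + 1 + 2 * Suc k \<and>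
          graph_edges s' = graph_edges s0 \<union> row_edges u (Suc k)) \<and> ticks s' \<le> ticks s + L) ?s"
      proof (rule wp_arc[where u = u and x = "adj ! u ! k"], goal_cases)
        case (9 s')
        then show ?case using 7
          by (auto simp: frame_def graph_edges_def row_edges_def lessThan_Suc)
      qed (use fr u xn Mk in auto)
      then show ?case
        using 7 x p Z by (auto simp: graph_edges_def)
    next
      case (8 s)
      show ?case
      proof (rule post)
        show "frame row_com s0 s" using 8(2) by (auto simp: frame_def)
      qed (use 8 v inp_degree[OF u] in \<open>auto simp: pos_def degrees_Suc graph_edges_def\<close>)
    qed (use v inp_degree[OF u] p Z in \<open>auto simp: graph_edges_def row_edges_def\<close>)
  }
qed

lemma wp_sym:
  assumes v: "vars s0 0 = n" "vars s0 1 = L" "vars s0 2 = K" "vars s0 3 = 2 * L * n"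
    and post: "\<And>s. graph_edges s = graph_edges s0 \<union> (\<Union>u<n. row_edges u (length (adj ! u))) \<Longrightarrow>
      vars s 3 \<le> 2 * L * n + L * degrees adj n \<Longrightarrow>
      frame sym_com s0 s \<Longrightarrow> ticks s \<le> ticks s0 + n + K * degrees adj n \<Longrightarrow> Q s"
  shows "wp sym_com Q s0"
  unfolding sym_com_def wp_Seq wp_Assign
proof (intro conjI, goal_cases)
  case 2
  show ?case
  \<comment> \<open>Each arc of a row takes \<open>K = L + 1\<close> ticks: one for itself and
    \<open>L\<close> for the pass over the query.\<close>
  proof (rule wp_For[where n = n and T = "\<lambda>u. K * length (adj ! u)" and
        J = "\<lambda>u s. vars s 8 = pos u \<and> vars s 3 \<le> 2 * L * n + L * degrees adj u \<and>
          graph_edges s = graph_edges s0 \<union> (\<Union>x<u. row_edges x (length (adj ! x)))"], goal_cases)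
    case (7 u s)
    then have fr: "vars s 1 = L" "vars s 2 = K" "vars s 12 = u" using v by (auto simp: frame_def)
    have "L * degrees adj (Suc u) \<le> L * degrees adj n"
      using degrees_mono[of "Suc u" n] 7 by (intro mult_le_mono2) simp
    then have M: "vars s 3 + length (adj ! u) * L < Z"
      using 7 large by (simp add: degrees_Suc algebra_simps)
    show ?case
    proof (rule wp_row[where u = u], goal_cases)
      case (7 s')
      then show ?case using \<open>vars s 8 = _ \<and> _\<close>
        by (auto simp: graph_edges_def lessThan_Suc degrees_Suc algebra_simps)
    qed (use fr 7 M in auto)
  next
    case (8 s)
    show ?case
    proof (rule post)
      show "frame sym_com s0 s" using 8(2) by (auto simp: frame_def)
      show "ticks s \<le> ticks s0 + n + K * degrees adj n"
        using 8(3) by (simp add: degrees_def sum_distrib_left del: mult_Suc)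
    qed (use 8 in \<open>auto simp: graph_edges_def\<close>)
  qed (use v large in \<open>auto simp: graph_edges_def pos_def degrees_def\<close>)
qed (use v large in auto)

text \<open>The database on node numbers, as the input words present it;
  \<open>approximation_index\<close> leads back to \<open>D\<close>.\<close>

definition index_db :: "(nat, 'a) graph_db" where
  "index_db = ({..<n}, {(u, a, v). u < n \<and> (a, v) \<in> set (adj ! u)})"

lemma graph_db_index_db: "graph_db index_db"
  by (auto simp: graph_db_def index_db_def dest: targets[OF nth_mem])

definition node :: "nat \<times> nat \<Rightarrow> nat" where
  "node x = fst x * K + snd x"

abbreviation product :: "((nat \<times> nat) \<times> (nat \<times> nat)) set" where
  "product \<equiv> product_edges index_db (eps_edges q 0) (sym_edges q 0)"

lemma product_eq:
  "(\<Union>u<n. (\<lambda>(p, p'). (u * K + p, u * K + p')) ` eps_edges q 0) \<union>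
     (\<Union>u<n. row_edges u (length (adj ! u))) = (\<lambda>(x, y). (node x, node y)) ` product"
  (is "?E \<union> ?S = _")
proof -
  have "?E = (\<lambda>(x, y). (node x, node y)) ` {((u, p), (u, p')) |u p p'. u < n \<and> (p, p') \<in> eps_edges q 0}"
    by (force simp: node_def)
  moreover have "?S = (\<lambda>(x, y). (node x, node y)) ` {((u, p), (v, p + 1)) |u p v. \<exists>a.
      (p, a) \<in> sym_edges q 0 \<and> u < n \<and> (a, v) \<in> set (adj ! u)}" (is "_ = ?f ` ?A")
  proof (intro equalityI subsetI)
    fix z assume "z \<in> ?S"
    then obtain u i p where *: "u < n" "i < length (adj ! u)" "p < L" "ts ! p = TSym (fst (adj ! u ! i))"
      and z: "z = (u * K + p, snd (adj ! u ! i) * K + Suc p)"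
      by (auto simp: row_edges_def arc_edges_def)
    have "(fst (adj ! u ! i), snd (adj ! u ! i)) \<in> set (adj ! u)" using * by simp
    then have "((u, p), (snd (adj ! u ! i), p + 1)) \<in> ?A"
      using * unfolding parse_rpq_string(2) by blast
    then show "z \<in> ?f ` ?A" by (rule rev_image_eqI) (simp add: z node_def)
  next
    fix z assume "z \<in> ?f ` ?A"
    then obtain u p v a where *: "p < L" "ts ! p = TSym a" "u < n" "(a, v) \<in> set (adj ! u)"
      and z: "z = (u * K + p, v * K + Suc p)"
      unfolding parse_rpq_string(2) by (auto simp: node_def)
    then obtain i where "i < length (adj ! u)" "adj ! u ! i = (a, v)" by (auto simp: in_set_conv_nth)
    then have "z \<in> arc_edges u (adj ! u ! i) L" "i < length (adj ! u)"
      using * z by (auto simp: arc_edges_def)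
    then show "z \<in> ?S" using *(3) by (auto simp: row_edges_def)
  qed
  moreover have "product = {((u, p), (u, p')) |u p p'. u < n \<and> (p, p') \<in> eps_edges q 0} \<union>
      {((u, p), (v, p + 1)) |u p v. \<exists>a. (p, a) \<in> sym_edges q 0 \<and> u < n \<and> (a, v) \<in> set (adj ! u)}"
    by (simp add: product_edges_def index_db_def)
  ultimately show ?thesis by (simp only: image_Un)
qed

end

section \<open>Selection of the answers\<close>

text \<open>Here \<open>f u\<close> is \<open>0\<close> or one more than a chosen \<open>v\<close> such that \<open>(u, v)\<close> is an answer, and
  \<open>g v\<close> is \<open>0\<close> or one more than a chosen \<open>u\<close>.  The condition on the second pair excludes the
  pairs that are chosen by both \<open>f\<close> and \<open>g\<close>.\<close>

definition chosen :: "(nat \<Rightarrow> nat) \<Rightarrow> (nat \<Rightarrow> nat) \<Rightarrow> nat \<Rightarrow> (nat \<times> nat) list" where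
  "chosen f g u = (if f u \<noteq> 0 then [(u, f u - 1)] else []) @
     (if g u \<noteq> 0 \<and> f (g u - 1) \<noteq> Suc u then [(g u - 1, u)] else [])"

lemma set_chosen: "set (concat (map (chosen f g) [0..<u])) =
    {(x, f x - 1) |x. x < u \<and> f x \<noteq> 0} \<union>
    {(g x - 1, x) |x. x < u \<and> g x \<noteq> 0 \<and> f (g x - 1) \<noteq> Suc x}"
  by (auto simp: chosen_def split: if_splits)

lemma distinct_chosen: "distinct (concat (map (chosen f g) [0..<u]))"
proof (induction u)
  case (Suc u)
  have "distinct (chosen f g u)" by (auto simp: chosen_def)
  moreover have "set (concat (map (chosen f g) [0..<u])) \<inter> set (chosen f g u) = {}"
    unfolding set_chosen by (auto simp: chosen_def)
  ultimately show ?case using Suc by simp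
qed simp

definition put :: "expr \<Rightarrow> expr \<Rightarrow> com" where
  "put e f = Write 14 (Var 18) e ;; Write 15 (Var 18) f ;; Assign 18 (EAdd (Var 18) (Lit 1))"

text \<open>The labels of interest sit at the far end of each search: array \<open>13\<close>,
  filled against the edges, is read at state \<open>0\<close> and gives \<open>f\<close>; array
  \<open>9\<close> is read at state \<open>L\<close> and gives \<open>g\<close>.\<close>

definition select_com :: com where
  "select_com = For 12 0
     (Assign 19 (Arr 13 (EMul (Var 12) (Var 2))) ;;
      IfLess (Lit 0) (Var 19) (put (Var 12) (ESub (Var 19) (Lit 1))) Skip ;;
      Assign 19 (Arr 9 (EAdd (EMul (Var 12) (Var 2)) (Var 1))) ;;
      IfLess (Lit 0) (Var 19)
        (IfEq (Arr 13 (EMul (ESub (Var 19) (Lit 1)) (Var 2))) (EAdd (Var 12) (Lit 1)) Skip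
          (put (ESub (Var 19) (Lit 1)) (Var 12))) Skip)"

text \<open>The product edges are stored in the arrays \<open>0\<close> and \<open>1\<close>.  The search along these edges
  stores the labels in array \<open>9\<close>, the search against them in array \<open>13\<close>, and the chosen pairs
  are stored in the arrays \<open>14\<close> and \<open>15\<close>.\<close>

definition main_com :: com where
  "main_com = Assign 0 (Inp (Lit 0)) ;; Assign 1 (Inp (Lit 1)) ;;
     IfLess (Lit 0) (Var 0)
       (Assign 2 (EAdd (Var 1) (Lit 1)) ;; parse_com ;; eps_com ;; sym_com ;;
        Assign 4 (Lit 0) ;; search 0 1 6 7 8 9 ;;
        Assign 4 (Var 1) ;; search 1 0 10 11 12 13 ;; select_com)
       Skip"

lemma legal_main_com: "legal main_com"
  by (simp add: main_com_def legal_parse_com legal_search select_com_def put_def)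

definition selection :: "state \<Rightarrow> (nat \<times> nat) list" where
  "selection s = map (\<lambda>i. (arrs s 14 i, arrs s 15 i)) [0..<vars s 18]"

lemma selection_simps [simp]:
  "x \<noteq> 18 \<Longrightarrow> selection (s\<lparr>vars := (vars s)(x := y)\<rparr>) = selection s"
  "selection (s\<lparr>ticks := t\<rparr>) = selection s"
  by (simp_all add: selection_def)

section \<open>Correctness of the selection and of the whole preprocessing\<close>

context encoded_input
begin

text \<open>The values are required for every array state \<open>A\<close> because \<open>f\<close>
  is evaluated after the first component has been written.\<close>

lemma wp_put:
  assumes e: "\<And>A. val (s\<lparr>arrs := A\<rparr>) e = x \<and> safe (s\<lparr>arrs := A\<rparr>) e"
    and f: "\<And>A. val (s\<lparr>arrs := A\<rparr>) f = y \<and> safe (s\<lparr>arrs := A\<rparr>) f"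
    and small: "vars s 18 + 1 < Z"
    and post: "\<And>s'. selection s' = selection s @ [(x, y)] \<Longrightarrow>
      vars s' = (vars s)(18 := Suc (vars s 18)) \<Longrightarrow> frame (put e f) s s' \<Longrightarrow> ticks s' = ticks s \<Longrightarrow> Q s'"
  shows "wp (put e f) Q s"
proof (rule wp_frame)
  let ?A = "(arrs s)(14 := (arrs s 14)(vars s 18 := x), 15 := (arrs s 15)(vars s 18 := y))"
  let ?s = "s\<lparr>arrs := ?A, vars := (vars s)(18 := Suc (vars s 18))\<rparr>"
  have "selection ?s = selection s @ [(x, y)]" by (auto simp: selection_def)
  then have "frame (put e f) s ?s \<longrightarrow> Q ?s" by (intro impI post) auto
  then show "wp (put e f) (\<lambda>s'. frame (put e f) s s' \<longrightarrow> Q s') s"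
    using small e[of "arrs s"] e[of "(arrs s)(14 := (arrs s 14)(vars s 18 := x))"] f
    by (simp add: put_def)
qed

lemma wp_select:
  defines "f \<equiv> \<lambda>s u. arrs s 13 (u * K)" and "g \<equiv> \<lambda>s u. arrs s 9 (u * K + L)"
  assumes v: "vars s0 0 = n" "vars s0 1 = L" "vars s0 2 = K" "vars s0 18 = 0"
    and gn: "\<And>u. u < n \<Longrightarrow> g s0 u \<le> n"
    and post: "\<And>s. selection s = concat (map (chosen (f s0) (g s0)) [0..<n]) \<Longrightarrow>
      ticks s \<le> ticks s0 + n \<Longrightarrow> Q s"
  shows "wp select_com Q s0"
  unfolding select_com_def
proof (rule wp_For[where n = n and T = "\<lambda>_. 0" and J = "\<lambda>u s. vars s 18 \<le> 2 * u \<and>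
      selection s = concat (map (chosen (f s0) (g s0)) [0..<u])"], goal_cases)
  case (7 u s)
  then have fr: "vars s 1 = L" "vars s 2 = K" "arrs s 9 = arrs s0 9" "arrs s 13 = arrs s0 13"
    using v by (auto simp: frame_def put_def)
  have Z: "n * K < Z" "u * K + L < Z" "u * K < Z" "2 * n + 3 < Z" "0 < Z" "1 < Z"
  proof -
    have "n * 1 \<le> n * K" by (intro mult_le_mono2) simp
    then show "2 * n + 3 < Z" using large' by linarith
    have "u * K + L < n * K" using 7 node_less by simp
    then show "n * K < Z" "u * K + L < Z" "u * K < Z" using large' by linarith+
  qed (use large' in auto)
  \<comment> \<open>The duplicate test looks up \<open>f\<close> at the node \<open>g - 1\<close>;
    the bound \<open>gn\<close> keeps the computed index below \<open>Z\<close>.\<close>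
  have "(g s0 u - 1) * K \<le> n * K" using gn[of u] 7 by (intro mult_le_mono1) simp
  then have gZ: "(g s0 u - 1) * K < Z" using Z by simp
  define xs where "xs = (if f s0 u \<noteq> 0 then [(u, f s0 u - 1)] else [])"
  define ys where "ys = (if g s0 u \<noteq> 0 \<and> f s0 (g s0 u - 1) \<noteq> Suc u then [(g s0 u - 1, u)] else [])"
  let ?mid = "\<lambda>s'. selection s' = selection s @ xs \<and> vars s' 18 \<le> Suc (vars s 18) \<and>
    vars s' 1 = L \<and> vars s' 2 = K \<and> vars s' 12 = u \<and> arrs s' 9 = arrs s0 9 \<and>
    arrs s' 13 = arrs s0 13 \<and> ticks s' = ticks s"
  let ?end = "\<lambda>s'. selection s' = selection s @ xs @ ys \<and> vars s' 18 \<le> Suc (Suc (vars s 18)) \<and>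
    ticks s' = ticks s"
  let ?c = "Assign 19 (Arr 13 (EMul (Var 12) (Var 2))) ;;
      IfLess (Lit 0) (Var 19) (put (Var 12) (ESub (Var 19) (Lit 1))) Skip"
  let ?d = "Assign 19 (Arr 9 (EAdd (EMul (Var 12) (Var 2)) (Var 1))) ;;
      IfLess (Lit 0) (Var 19)
        (IfEq (Arr 13 (EMul (ESub (Var 19) (Lit 1)) (Var 2))) (EAdd (Var 12) (Lit 1)) Skip
          (put (ESub (Var 19) (Lit 1)) (Var 12))) Skip"
  have "wp ?c ?mid s"
  proof -
    let ?s = "s\<lparr>vars := (vars s)(19 := f s0 u)\<rparr>"
    have "wp (put (Var 12) (ESub (Var 19) (Lit 1))) ?mid ?s" if "f s0 u \<noteq> 0"
      by (rule wp_put[where x = u and y = "f s0 u - 1"])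
        (use 7 fr Z that in \<open>auto simp: xs_def frame_def put_def\<close>)
    then show ?thesis using 7 fr Z by (auto simp: xs_def f_def)
  qed
  moreover have "wp ?d ?end s'" if mid: "?mid s'" for s'
  proof -
    let ?s = "s'\<lparr>vars := (vars s')(19 := g s0 u)\<rparr>"
    have "wp (put (ESub (Var 19) (Lit 1)) (Var 12)) ?end ?s"
      if "g s0 u \<noteq> 0" "f s0 (g s0 u - 1) \<noteq> Suc u"
      by (rule wp_put[where x = "g s0 u - 1" and y = u])
        (use 7 mid Z that in \<open>auto simp: ys_def frame_def put_def\<close>)
    moreover have "?end ?s" if "g s0 u = 0 \<or> f s0 (g s0 u - 1) = Suc u"
      using that mid by (auto simp: ys_def)
    ultimately show ?thesis using 7 mid Z gZ
      by (auto simp: f_def g_def simp del: mult_Suc_right)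
  qed
  ultimately have "wp ?c (wp ?d ?end) s" by (rule wp_mono)
  then have "wp (Assign 19 (Arr 13 (EMul (Var 12) (Var 2))) ;;
      IfLess (Lit 0) (Var 19) (put (Var 12) (ESub (Var 19) (Lit 1))) Skip ;; ?d) ?end s"
    by (simp only: wp_Seq[abs_def])
  then show ?case
  proof (rule wp_mono)
    fix s' assume "?end s'"
    moreover have "chosen (f s0) (g s0) u = xs @ ys" by (simp add: chosen_def xs_def ys_def)
    ultimately show "(vars (s'\<lparr>vars := (vars s')(12 := Suc u), ticks := Suc (ticks s')\<rparr>) 18 \<le> 2 * Suc u \<and>
        selection (s'\<lparr>vars := (vars s')(12 := Suc u), ticks := Suc (ticks s')\<rparr>) =
        concat (map (chosen (f s0) (g s0)) [0..<Suc u])) \<and> ticks s' \<le> ticks s + 0"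
      using 7(2) selection_simps(1)[of 12 "s'\<lparr>ticks := Suc (ticks s')\<rparr>" "Suc u"] by simp
  qed
next
  case (8 s)
  then show ?case by (intro post) auto
qed (use v large in \<open>auto simp: put_def selection_def\<close>)

lemma product_bounds: "(x, y) \<in> product \<Longrightarrow> snd x \<le> L \<and> snd y \<le> L"
  using eps_edges_bounds[of _ _ q 0] sym_edges_bounds[of _ _ q 0]
  by (fastforce simp: product_edges_def)

lemma node_inj: "node x = node y \<Longrightarrow> snd x \<le> L \<Longrightarrow> snd y \<le> L \<Longrightarrow> x = y"
proof -
  assume a: "node x = node y" "snd x \<le> L" "snd y \<le> L"
  have "node z div K = fst z" "node z mod K = snd z" if "snd z \<le> L" for z
    using that by (auto simp: node_def simp del: mult_Suc_right)
  then show "x = y" using a by (metis prod_eqI)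
qed

text \<open>\<open>node\<close> is injective only for states up to \<open>L\<close>. A path of
  numbers is therefore lifted edge by edge, with \<open>product_bounds\<close> keeping all states in
  that range.\<close>

lemma reach_node:
  assumes "snd x \<le> L" "snd y \<le> L"
  shows "(node x, node y) \<in> ((\<lambda>(x, y). (node x, node y)) ` product)\<^sup>* \<longleftrightarrow> (x, y) \<in> product\<^sup>*"
proof
  have "\<exists>y. z = node y \<and> snd y \<le> L \<and> (x, y) \<in> product\<^sup>*"
    if "(node x, z) \<in> ((\<lambda>(x, y). (node x, node y)) ` product)\<^sup>*" for z
    using that
  proof (induction rule: rtrancl_induct)
    case base
    then show ?case using assms by blast
  next
    case (step z z')
    then obtain y a b where y: "z = node y" "snd y \<le> L" "(x, y) \<in> product\<^sup>*"
      and ab: "(a, b) \<in> product" "z = node a" "z' = node b" by auto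
    then have "y = a" using node_inj[of y a] product_bounds[OF ab(1)] by simp
    then have "(x, b) \<in> product\<^sup>*" using y(3) ab(1) by simp
    then show ?case using ab product_bounds[OF ab(1)] by blast
  qed
  then show "(node x, node y) \<in> ((\<lambda>(x, y). (node x, node y)) ` product)\<^sup>* \<Longrightarrow> (x, y) \<in> product\<^sup>*"
    using node_inj assms by blast
  show "(x, y) \<in> product\<^sup>* \<Longrightarrow> (node x, node y) \<in> ((\<lambda>(x, y). (node x, node y)) ` product)\<^sup>*"
  proof (induction rule: rtrancl_induct)
    case (step y z)
    then have "(node y, node z) \<in> (\<lambda>(x, y). (node x, node y)) ` product" by force
    with step.IH show ?case by simp
  qed simp
qed

lemma reach_answers:
  "(u * K, v * K + L) \<in> ((\<lambda>(x, y). (node x, node y)) ` product)\<^sup>* \<longleftrightarrow> (u, v) \<in> answers q index_db"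
  using reach_node[of "(u, 0)" "(v, L)"] product_answers[OF graph_db_index_db, of u v q]
  by (simp add: node_def)

lemma answers_less: "(u, v) \<in> answers q index_db \<Longrightarrow> u < n \<and> v < n"
  using answers_nodes[OF graph_db_index_db, of q] by (auto simp: index_db_def)

lemma selection_correct:
  assumes f: "\<And>u. f u \<noteq> 0 \<Longrightarrow> (u, f u - 1) \<in> answers q index_db"
      "\<And>u v. (u, v) \<in> answers q index_db \<Longrightarrow> f u \<noteq> 0"
    and g: "\<And>v. g v \<noteq> 0 \<Longrightarrow> (g v - 1, v) \<in> answers q index_db"
      "\<And>u v. (u, v) \<in> answers q index_db \<Longrightarrow> g v \<noteq> 0"
  shows "approximation q index_db (set (concat (map (chosen f g) [0..<n])))"
  unfolding approximation_def
proof (intro conjI; clarify)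
  let ?A = "set (concat (map (chosen f g) [0..<n]))"
  show "(u, v) \<in> ?A \<Longrightarrow> (u, v) \<in> answers q index_db" for u v
    unfolding set_chosen using f(1) g(1) by auto
  fix u v assume uv: "(u, v) \<in> answers q index_db"
  then have "(u, f u - 1) \<in> ?A" unfolding set_chosen using f(2) answers_less by blast
  moreover have "(g v - 1, v) \<in> ?A"
  proof (cases "f (g v - 1) = Suc v")
    \<comment> \<open>The pair omitted for \<open>v\<close> is the one that \<open>f\<close> chose
      for the node \<open>g v - 1\<close>.\<close>
    case True
    have "(g v - 1, v) \<in> answers q index_db" using g uv by blast
    then have "g v - 1 < n" using answers_less by blast
    moreover have "f (g v - 1) - 1 = v" "f (g v - 1) \<noteq> 0" using True by auto
    ultimately have "(g v - 1, v) \<in> {(x, f x - 1) |x. x < n \<and> f x \<noteq> 0}" by force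
    then show ?thesis unfolding set_chosen by blast
  next
    case False
    then show ?thesis unfolding set_chosen using g(2)[OF uv] answers_less[OF uv] by blast
  qed
  ultimately show "(\<exists>v'. (u, v') \<in> ?A) \<and> (\<exists>u'. (u', v) \<in> ?A)" by blast
qed

lemma edges_converse: "edges M T S = (edges M S T)\<inverse>"
  by (auto simp: edges_def)

text \<open>Products are replaced by variables so that linear arithmetic applies: \<open>X\<close>
  stands for nodes times \<open>L\<close>, \<open>Y\<close> for arcs times \<open>L\<close>,
  \<open>M\<close> for the number of product edges. The sum is at most
  \<open>21 * X + 6 * Y\<close>, hence \<open>27 * b\<close>; \<open>30\<close> is rounded
  up.\<close>

lemma total_ticks:
  fixes t l a m kd nk M X Y b d :: nat
  assumes "t \<le> l + a + m + kd + m + nk + 2 * M + m + nk + 2 * M + m" "a = 2 * X + 2 * l"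
    "kd = d + Y" "nk = m + X" "M \<le> 2 * X + Y" "X \<le> b" "Y \<le> b" "m \<le> X" "d \<le> Y" "l \<le> X"
  shows "t \<le> 30 * b"
  using assms by linarith

text \<open>Each search has list heads and labels of its own, which are still zero when it starts
  (facts \<open>a2\<close> to \<open>a5\<close>), so no time is spent on clearing them.\<close>

theorem wp_main:
  assumes z: "vars s0 = (\<lambda>_. 0)" "arrs s0 = (\<lambda>_ _. 0)" "ticks s0 = 0"
  shows "wp main_com (\<lambda>s. distinct (selection s) \<and>
    approximation q index_db (set (selection s)) \<and>
    ticks s \<le> 30 * (max n (degrees adj n) * L)) s0"
proof -
  let ?Q = "\<lambda>s. distinct (selection s) \<and> approximation q index_db (set (selection s)) \<and>
    ticks s \<le> 30 * (max n (degrees adj n) * L)"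
  let ?G = "(\<lambda>(x, y). (node x, node y)) ` product"
  let ?s1 = "s0\<lparr>vars := (vars s0)(0 := n, Suc 0 := L)\<rparr>"
  have inp2: "Suc 0 < length inp" by (simp add: length_inp pos_def)
  have Lpos: "0 < L" by (rule rpq_size_pos)
  note Z = large'
  have "wp (Assign 2 (EAdd (Var 1) (Lit 1)) ;; parse_com ;; eps_com ;; sym_com ;;
        Assign 4 (Lit 0) ;; search 0 1 6 7 8 9 ;;
        Assign 4 (Var 1) ;; search 1 0 10 11 12 13 ;; select_com) ?Q ?s1" if n: "0 < n"
    unfolding wp_Seq wp_Assign
  proof (intro conjI, goal_cases)
    case 2
    show ?case
    proof (rule wp_parse, goal_cases)
      case (6 s2)
      then have v2: "vars s2 0 = n" "vars s2 1 = L" "vars s2 2 = K" "vars s2 3 = 0" "vars s2 18 = 0"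
        and a2: "\<And>a. 6 \<le> a \<Longrightarrow> arrs s2 a = (\<lambda>_. 0)" and t2: "ticks s2 \<le> L"
        using z by (auto simp: frame_def written_parse_com written_arrs_parse_com)
      show ?case
      proof (rule wp_eps, goal_cases)
        case (5 j)
        then have "(arrs s2 2 j, arrs s2 3 j) \<in> eps_edges q 0"
          using 6(1) by (auto simp: edges_def)
        then show ?case using eps_edges_bounds by fastforce
      next
        case (6 s3)
        then have v3: "vars s3 0 = n" "vars s3 1 = L" "vars s3 2 = K" "vars s3 18 = 0"
          and a3: "\<And>a. 6 \<le> a \<Longrightarrow> arrs s3 a = (\<lambda>_. 0)" and t3: "ticks s3 \<le> L + 2 * L * (n + 1)"
          using v2 a2 t2 by (auto simp: frame_def)
        show ?case
        proof (rule wp_sym, goal_cases)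
          case (5 s4)
          then have v4: "vars s4 0 = n" "vars s4 1 = L" "vars s4 2 = K" "vars s4 18 = 0"
            and a4: "\<And>a. 6 \<le> a \<Longrightarrow> arrs s4 a = (\<lambda>_. 0)"
            and t4: "ticks s4 \<le> L + 2 * L * (n + 1) + n + K * degrees adj n"
            using v3 a3 t3 by (auto simp: frame_def)
          define M where "M = vars s4 3"
          have M: "M \<le> 2 * L * n + L * degrees adj n" using 5(2) by (simp add: M_def)
          have G: "edges M (arrs s4 0) (arrs s4 1) = ?G"
            using 5(1) 6(1) \<open>edges _ _ _ = eps_edges q 0\<close> product_eq
            by (simp add: graph_edges_def M_def)
          have bound: "arrs s4 0 j < n * K \<and> arrs s4 1 j < n * K" if "j < M" for j
          proof -
            have "(arrs s4 0 j, arrs s4 1 j) \<in> ?G" using that unfolding G[symmetric] edges_def by blast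
            then obtain x y where xy: "(x, y) \<in> product" "arrs s4 0 j = node x" "arrs s4 1 j = node y"
              by auto
            then have "fst x < n" "fst y < n" using targets[OF nth_mem]
              by (auto simp: product_edges_def index_db_def)
            then show ?thesis using xy product_bounds[OF xy(1)] node_less
              by (simp add: node_def del: mult_Suc_right)
          qed
          have small: "n * K + n + M + 1 < Z" using M Z by linarith
          show ?case unfolding wp_Assign
          proof (intro conjI, goal_cases)
            case 2
            show ?case
            proof (rule wp_search[where n = n and M = M and K = K and off = 0], goal_cases)
              case (11 s5)
              have v5: "vars s5 0 = n" "vars s5 1 = L" "vars s5 2 = K" "vars s5 18 = 0" "vars s5 3 = M"
                and a5: "\<And>a. 10 \<le> a \<Longrightarrow> arrs s5 a = (\<lambda>_. 0)" "arrs s5 0 = arrs s4 0" "arrs s5 1 = arrs s4 1"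
                using 11(3) v4 a4 by (auto simp: frame_def written_search written_arrs_search M_def)
              have "ticks s5 \<le> ticks s4 + n + n * K + 2 * M" using 11(4) by simp
              then have t5: "ticks s5 \<le> L + 2 * L * (n + 1) + n + K * degrees adj n + n + n * K + 2 * M"
                using t4 by linarith
              have g: "g \<noteq> 0 \<longrightarrow> g \<le> n \<and> (g - 1, u) \<in> answers q index_db"
                if gd: "g = arrs s5 9 (u * K + L)" for g u
              proof
                assume "g \<noteq> 0"
                then obtain v where "v < n" "g = Suc v" "(v * K, u * K + L) \<in> ?G\<^sup>*"
                  using 11(1)[of "u * K + L"] gd G by auto
                then show "g \<le> n \<and> (g - 1, u) \<in> answers q index_db" using reach_answers by simp
              qed
              have g': "arrs s5 9 (v * K + L) \<noteq> 0" if "(u, v) \<in> answers q index_db" for u v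
                using 11(2)[of u "v * K + L"] that answers_less[OF that] reach_answers[of u v] G by simp
              show ?case unfolding wp_Assign
              proof (intro conjI, goal_cases)
                case 2
                show ?case
                proof (rule wp_search[where n = n and M = M and K = K and off = L], goal_cases)
                  case (11 s6)
                  have v6: "vars s6 0 = n" "vars s6 1 = L" "vars s6 2 = K" "vars s6 18 = 0"
                    and a6: "arrs s6 9 = arrs s5 9"
                    using 11(3) v5 by (auto simp: frame_def written_search written_arrs_search)
                  have "ticks s6 \<le> ticks s5 + n + n * K + 2 * M" using 11(4) by simp
                  then have t6: "ticks s6 \<le> L + 2 * L * (n + 1) + n + K * degrees adj n + n + n * K
                      + 2 * M + n + n * K + 2 * M"
                    using t5 by linarith
                  \<comment> \<open>Exchanging the two edge arrays reverses the graph: a label at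
                    \<open>(u, 0)\<close> that comes from \<open>(v, L)\<close> certifies the answer
                    \<open>(u, v)\<close>.\<close>
                  have G': "edges M (arrs s5 1) (arrs s5 0) = ?G\<inverse>"
                    using G edges_converse[of M "arrs s4 1" "arrs s4 0"] a5 by simp
                  have f: "(u, f - 1) \<in> answers q index_db"
                    if fd: "f = arrs s6 13 (u * K)" "f \<noteq> 0" for f u
                  proof -
                    obtain v where "f = Suc v" "(v * K + L, u * K) \<in> (?G\<inverse>)\<^sup>*"
                      using 11(1)[of "u * K"] fd G' by auto
                    then show ?thesis using reach_answers[of u v] by (simp add: rtrancl_converse)
                  qed
                  have f': "arrs s6 13 (u * K) \<noteq> 0" if "(u, v) \<in> answers q index_db" for u v
                    using 11(2)[of v "u * K"] that answers_less[OF that] reach_answers[of u v] G'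
                    by (simp add: rtrancl_converse)
                  show ?case
                  proof (rule wp_select, goal_cases)
                    case (5 u)
                    then show ?case using g[OF refl, of u] a6 by fastforce
                  next
                    case (6 s7)
                    have "approximation q index_db (set (selection s7))"
                      unfolding 6(1)
                    proof (rule selection_correct)
                      show "(u, v) \<in> answers q index_db \<Longrightarrow> arrs s6 9 (v * K + L) \<noteq> 0" for u v
                        using g' a6 by simp
                      show "arrs s6 9 (v * K + L) \<noteq> 0 \<Longrightarrow>
                          (arrs s6 9 (v * K + L) - 1, v) \<in> answers q index_db" for v
                        using g[OF refl, of v] a6 by simp
                    qed (use f f' in auto)
                    moreover have "distinct (selection s7)" unfolding 6(1) by (rule distinct_chosen)
                    moreover have "ticks s7 \<le> 30 * (max n (degrees adj n) * L)"
                    proof -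
                      let ?m = "max n (degrees adj n)"
                      have 1: "n * L \<le> ?m * L" "degrees adj n * L \<le> ?m * L" by simp_all
                      have "1 \<le> n" "1 \<le> L" using Lpos n by linarith+
                      then have 2: "n * 1 \<le> n * L" "degrees adj n * 1 \<le> degrees adj n * L"
                        "1 * L \<le> n * L"
                        using mult_le_mono1 mult_le_mono2 by blast+
                      have t7: "ticks s7 \<le> L + 2 * L * (n + 1) + n + K * degrees adj n + n + n * K + 2 * M
                          + n + n * K + 2 * M + n" using 6(2) t6 by simp
                      have eq: "2 * L * (n + 1) = 2 * (n * L) + 2 * L"
                        "K * degrees adj n = degrees adj n + degrees adj n * L" "n * K = n + n * L"
                        "M \<le> 2 * (n * L) + degrees adj n * L"
                        using M by (simp_all add: algebra_simps)
                      show ?thesis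
                        using total_ticks[OF t7 eq 1] 2 by (simp only: mult_1 mult_1_right)
                    qed
                    ultimately show ?case by simp
                  qed (use v6 in auto)
                qed (use v5 a5 bound small in auto)
              qed (use Z in auto)
            qed (use v4 a4 bound small in \<open>auto simp: M_def\<close>)
          qed (use Z in auto)
        qed (use v3 6 in auto)
      qed (use v2 in auto)
    qed (use z in auto)
  qed (use Z in auto)
  \<comment> \<open>The tick bound is \<open>0\<close> here, so not even the query may be parsed;
    the empty selection is the right answer.\<close>
  moreover have "?Q ?s1" if "n = 0"
    using that answers_less z
    by (auto simp: selection_def approximation_def)
  ultimately show ?thesis using Z inp2 z by (auto simp: main_com_def simp del: length_0_conv length_greater_0_conv)
qed

end

section \<open>The machine program\<close>

text \<open>A round takes 8 steps and outputs at offset 4. Consecutive outputs are thus 8 steps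
  apart, the first comes 4 steps after \<open>T\<close>, and termination follows 5 steps after the
  last output, or 1 step after \<open>T\<close> if there is none.\<close>

lemma enumerates_loop:
  fixes out :: "nat \<Rightarrow> nat \<times> nat" and T m w :: nat and P :: "instr list" and inp :: "nat list"
  defines "c \<equiv> config_at P w inp"
  assumes pre: "\<And>t. t < T \<Longrightarrow> \<not> halted P (c t) \<and> emitted P (c t) = None"
    and loop: "\<And>i r. i < m \<Longrightarrow> r < 8 \<Longrightarrow> \<not> halted P (c (T + 8 * i + r)) \<and>
      emitted P (c (T + 8 * i + r)) = (if r = 4 then Some (out i) else None)"
    and last: "\<not> halted P (c (T + 8 * m))" "emitted P (c (T + 8 * m)) = None"
    and final: "halted P (c (T + 8 * m + 1))"
    and distinct: "distinct (map out [0..<m])"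
  shows "enumerates P w inp T 8 (out ` {..<m})"
proof -
  let ?H = "T + 8 * m + 1" and ?ts = "map (\<lambda>i. T + 8 * i + 4) [0..<m]"
  have stop: "halted P (c (?H + j))" for j
  proof (induction j)
    case (Suc j)
    then show ?case by (simp add: c_def config_at_def step_def)
  qed (use final in simp)
  have split: "t < T \<or> (\<exists>i r. i < m \<and> r < 8 \<and> t = T + 8 * i + r) \<or> t = T + 8 * m" if "t < ?H" for t
  proof -
    have "t = T + 8 * ((t - T) div 8) + (t - T) mod 8" if "T \<le> t" using that by simp
    moreover have "(t - T) div 8 < m" if "t < T + 8 * m" "T \<le> t" using that by (simp add: less_mult_imp_div_less)
    moreover have "(t - T) mod 8 < 8" by simp
    ultimately show ?thesis using that by (metis less_SucE Suc_eq_plus1 not_le)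
  qed
  have emit: "emitted P (c t) \<noteq> None \<longleftrightarrow> (\<exists>i<m. t = T + 8 * i + 4)" for t
  proof (cases "t < ?H")
    case True
    then consider "t < T" | i r where "i < m" "r < 8" "t = T + 8 * i + r" | "t = T + 8 * m"
      using split by blast
    then show ?thesis
    proof cases
      case (2 i r)
      then show ?thesis using loop[OF 2(1,2)] by auto presburger
    qed (use pre last in auto)
  next
    case False
    then have "halted P (c t)" using stop[of "t - ?H"] by simp
    then show ?thesis using False by (auto simp: emitted_def)
  qed
  have out: "the (emitted P (c (T + 8 * i + 4))) = out i" if "i < m" for i
    using loop[OF that, of 4] by simp
  have events: "(T # ?ts @ [?H]) ! j = (if j = 0 then T else if j \<le> m then T + 8 * (j - 1) + 4 else ?H)"
    if "j \<le> m + 1" for j using that by (cases j) (auto simp: nth_append)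
  show ?thesis
    unfolding enumerates_def Let_def c_def[symmetric]
  proof (intro exI[of _ ?ts] exI[of _ ?H] conjI)
    show "\<forall>t<?H. \<not> halted P (c t)" using split pre loop last by metis
    show "sorted_wrt (<) ?ts" by (auto simp: sorted_wrt_map strict_sorted_iff intro: sorted_wrt_mono_rel[of _ "(<)"])
    show "set ?ts = {t. emitted P (c t) \<noteq> None}" using emit by auto
    have *: "map (\<lambda>t. the (emitted P (c t))) ?ts = map out [0..<m]" using out by simp
    show "distinct (map (\<lambda>t. the (emitted P (c t))) ?ts)" using distinct by (simp only: *)
    show "set (map (\<lambda>t. the (emitted P (c t))) ?ts) = out ` {..<m}" by (simp only: *) auto
    show "\<forall>i. Suc i < length (T # ?ts @ [?H]) \<longrightarrow>
        (T # ?ts @ [?H]) ! Suc i - (T # ?ts @ [?H]) ! i \<le> 8"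
    proof (intro allI impI)
      fix i assume "Suc i < length (T # ?ts @ [?H])"
      then have "Suc i \<le> m + 1" by simp
      then show "(T # ?ts @ [?H]) ! Suc i - (T # ?ts @ [?H]) ! i \<le> 8"
        using events[of i] events[of "Suc i"] by auto
    qed
  qed (use final in auto)
qed

text \<open>Register \<open>32\<close> counts the pairs and register \<open>33\<close> points to the next pair in memory.\<close>

definition output_code :: "nat \<Rightarrow> instr list" where
  "output_code h = [Const 31 1, Const 34 16, Const 32 0, Const 33 14, Add 33 33 30,
     JumpLess 32 18 (h + 7), Halt,
     Load 35 33, Add 36 33 31, Load 36 36, Output 35 36,
     Add 32 32 31, Add 33 33 34, Jump (h + 5)]"

section \<open>Execution of the output loop\<close>

locale complete_program = compiled +
  assumes P: "P = take h P @ output_code h"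
begin

lemma nth_output: "k < 14 \<Longrightarrow> P ! (h + k) = output_code h ! k"
  by (subst P) (use h in \<open>simp add: nth_append\<close>)

lemma length_P: "length P = h + 14"
  using arg_cong[OF P, of length] h by (simp add: output_code_def)

lemma halted_iff: "pc c = h + k \<Longrightarrow> k < 14 \<Longrightarrow> halted P c \<longleftrightarrow> output_code h ! k = Halt"
  by (simp add: halted_def length_P nth_output)

lemma step_output: "pc c = h + k \<Longrightarrow> k < 14 \<Longrightarrow> step P w c = exec_instr w (output_code h ! k) c"
  by (simp add: step_def halted_iff nth_output)

lemma emitted_iff: "pc c = h + k \<Longrightarrow> k < 14 \<Longrightarrow>
    emitted P c = (case output_code h ! k of Output r s \<Rightarrow> Some (regs c r, regs c s) | _ \<Rightarrow> None)"
  by (auto simp: emitted_def halted_iff nth_output)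

lemma silent_before: "pc c < h \<Longrightarrow> \<not> halted P c \<and> emitted P c = None"
  using h silent_P[of "pc c"] by (cases "P ! pc c") (auto simp: halted_def emitted_def)

lemma sim_mem:
  assumes "sim s c"
  shows "a < 16 \<Longrightarrow> i < Z \<Longrightarrow> mem c (B + 16 * i + a) = arrs s a i" and "arrs s a i < Z"
  using assms by (auto simp: sim_def)

definition loop_head :: "nat \<Rightarrow> nat \<Rightarrow> (nat \<Rightarrow> nat) \<Rightarrow> config \<Rightarrow> bool" where
  "loop_head m i M c \<longleftrightarrow> pc c = h + 5 \<and> regs c 31 = 1 \<and> regs c 34 = 16 \<and> regs c 32 = i \<and>
     regs c 33 = B + 16 * i + 14 \<and> regs c 18 = m \<and> mem c = M"

lemma loop_start:
  assumes "sim s c" "pc c = h"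
  shows "loop_head (vars s 18) 0 (mem c) ((step P w ^^ 5) c)"
    and "t < 5 \<Longrightarrow> \<not> halted P ((step P w ^^ t) c) \<and> emitted P ((step P w ^^ t) c) = None"
proof -
  have B: "regs c 30 = B" "regs c 18 = vars s 18" using assms by (auto simp: sim_def)
  have W: "16 < (2::nat) ^ w" "14 < (2::nat) ^ w" "B + 14 < 2 ^ w"
    using word Z by linarith+
  moreover have "0 < w" using W(1) by (cases w) auto
  note W = W this
  define d where "d t = (step P w ^^ t) c" for t
  have S: "d (Suc t) = step P w (d t)" for t by (simp add: d_def)
  have 0: "pc (d 0) = h + 0 \<and> regs (d 0) = regs c \<and> mem (d 0) = mem c"
    using assms by (simp add: d_def)
  have 1: "pc (d 1) = h + 1 \<and> regs (d 1) = (regs c)(31 := 1) \<and> mem (d 1) = mem c"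
    using S[of 0] 0 step_output[of "d 0" 0] W by (simp add: output_code_def set_reg_def)
  have 2: "pc (d 2) = h + 2 \<and> regs (d 2) = (regs c)(31 := 1, 34 := 16) \<and> mem (d 2) = mem c"
    using S[of 1] 1 step_output[of "d 1" 1] W
    by (simp add: output_code_def set_reg_def numeral_2_eq_2)
  have 3: "pc (d 3) = h + 3 \<and> regs (d 3) = (regs c)(31 := 1, 34 := 16, 32 := 0) \<and> mem (d 3) = mem c"
    using S[of 2] 2 step_output[of "d 2" 2] W
    by (simp add: output_code_def set_reg_def)
  have 4: "pc (d 4) = h + 4 \<and> regs (d 4) = (regs c)(31 := 1, 34 := 16, 32 := 0, 33 := 14) \<and> mem (d 4) = mem c"
    using S[of 3] 3 step_output[of "d 3" 3] W
    by (simp add: output_code_def set_reg_def)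
  have 5: "pc (d 5) = h + 5 \<and> regs (d 5) = (regs c)(31 := 1, 34 := 16, 32 := 0, 33 := B + 14) \<and> mem (d 5) = mem c"
    using S[of 4] 4 step_output[of "d 4" 4] W B
    by (simp add: output_code_def set_reg_def add.commute)
  show "loop_head (vars s 18) 0 (mem c) ((step P w ^^ 5) c)"
    using 5 B by (simp add: loop_head_def d_def)
  assume "t < 5"
  then have "t \<in> {0, 1, 2, 3, 4}" by auto
  moreover have "\<not> halted P (d k) \<and> emitted P (d k) = None" if "pc (d k) = h + k" "k < 5" for k
    using that halted_iff[of "d k" k] emitted_iff[of "d k" k]
    by (auto simp: less_Suc_eq numeral_eq_Suc output_code_def)
  ultimately have "\<not> halted P (d t) \<and> emitted P (d t) = None" using 0 1 2 3 4 by auto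
  then show "\<not> halted P ((step P w ^^ t) c) \<and> emitted P ((step P w ^^ t) c) = None" by (simp add: d_def)
qed

lemma loop_step:
  assumes c: "loop_head m i M c" and i: "i < m" "m < Z"
    and xy: "M (B + 16 * i + 14) = x" "M (B + 16 * i + 15) = y" "x < Z" "y < Z"
  shows "loop_head m (Suc i) M ((step P w ^^ 8) c)"
    and "r < 8 \<Longrightarrow> \<not> halted P ((step P w ^^ r) c) \<and>
      emitted P ((step P w ^^ r) c) = (if r = 4 then Some (x, y) else None)"
proof -
  define a where "a = B + 16 * i + 14"
  have R: "regs c 31 = 1" "regs c 34 = 16" "regs c 32 = i" "regs c 33 = a"
    "regs c 18 = m" "mem c = M" using c by (auto simp: loop_head_def a_def)
  have W: "x < 2 ^ w" "y < 2 ^ w" "Suc i < 2 ^ w" "Suc a < 2 ^ w" "a + 16 < 2 ^ w"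
  proof -
    \<comment> \<open>From \<open>i < m < Z\<close> follows \<open>i + 2 \<le> Z\<close>, which
      leaves room for the pointer to advance to \<open>a + 16\<close> even past the last
      pair.\<close>
    have "16 * i + 30 < 16 * Z" using i by simp
    then have "B + 16 * i + 30 < 2 ^ w" using word by linarith
    then show "Suc i < 2 ^ w" "Suc a < 2 ^ w" "a + 16 < 2 ^ w"
      by (simp_all add: a_def)
  qed (use xy word in linarith)+
  have M: "M a = x" "M (Suc a) = y" using xy by (simp_all add: a_def ac_simps)
  define d where "d t = (step P w ^^ t) c" for t
  have S: "d (Suc t) = step P w (d t)" for t by (simp add: d_def)
  have 0: "pc (d 0) = h + 5 \<and> regs (d 0) = regs c \<and> mem (d 0) = M"
    using c by (simp add: d_def loop_head_def)
  have 1: "pc (d 1) = h + 7 \<and> regs (d 1) = regs c \<and> mem (d 1) = M"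
    using S[of 0] 0 step_output[of "d 0" 5] R i by (simp add: output_code_def jump_if_def)
  have 2: "pc (d 2) = h + 8 \<and> regs (d 2) = (regs c)(35 := x) \<and> mem (d 2) = M"
    using S[of 1] 1 step_output[of "d 1" 7] R W M
    by (simp add: output_code_def set_reg_def numeral_2_eq_2)
  have 3: "pc (d 3) = h + 9 \<and> regs (d 3) = (regs c)(35 := x, 36 := Suc a) \<and> mem (d 3) = M"
    using S[of 2] 2 step_output[of "d 2" 8] R W
    by (simp add: output_code_def set_reg_def)
  have 4: "pc (d 4) = h + 10 \<and> regs (d 4) = (regs c)(35 := x, 36 := y) \<and> mem (d 4) = M"
    using S[of 3] 3 step_output[of "d 3" 9] R W M
    by (simp add: output_code_def set_reg_def)
  have 5: "pc (d 5) = h + 11 \<and> regs (d 5) = (regs c)(35 := x, 36 := y) \<and> mem (d 5) = M"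
    using S[of 4] 4 step_output[of "d 4" 10] R W
    by (simp add: output_code_def)
  have 6: "pc (d 6) = h + 12 \<and> regs (d 6) = (regs c)(35 := x, 36 := y, 32 := Suc i) \<and> mem (d 6) = M"
    using S[of 5] 5 step_output[of "d 5" 11] R W
    by (simp add: output_code_def set_reg_def)
  have 7: "pc (d 7) = h + 13 \<and> regs (d 7) = (regs c)(35 := x, 36 := y, 32 := Suc i,
      33 := a + 16) \<and> mem (d 7) = M"
    using S[of 6] 6 step_output[of "d 6" 12] R W
    by (simp add: output_code_def set_reg_def)
  have 8: "pc (d 8) = h + 5 \<and> regs (d 8) = (regs c)(35 := x, 36 := y, 32 := Suc i,
      33 := a + 16) \<and> mem (d 8) = M"
    using S[of 7] 7 step_output[of "d 7" 13] R W
    by (simp add: output_code_def jump_if_def)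
  show "loop_head m (Suc i) M ((step P w ^^ 8) c)"
    using 8 R by (simp add: loop_head_def d_def a_def)
  assume "r < 8"
  then have "r \<in> {0, 1, 2, 3, 4, 5, 6, 7}" by auto
  then have "\<not> halted P (d r) \<and> emitted P (d r) = (if r = 4 then Some (x, y) else None)"
    using 0 1 2 3 4 5 6 7
      halted_iff[of "d 0" 5] emitted_iff[of "d 0" 5] halted_iff[of "d 1" 7] emitted_iff[of "d 1" 7]
      halted_iff[of "d 2" 8] emitted_iff[of "d 2" 8] halted_iff[of "d 3" 9] emitted_iff[of "d 3" 9]
      halted_iff[of "d 4" 10] emitted_iff[of "d 4" 10] halted_iff[of "d 5" 11] emitted_iff[of "d 5" 11]
      halted_iff[of "d 6" 12] emitted_iff[of "d 6" 12] halted_iff[of "d 7" 13] emitted_iff[of "d 7" 13]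
    by (elim insertE) (simp_all add: output_code_def)
  then show "\<not> halted P ((step P w ^^ r) c) \<and>
      emitted P ((step P w ^^ r) c) = (if r = 4 then Some (x, y) else None)" by (simp add: d_def)
qed

text \<open>The five instructions that set up the output loop are counted as preprocessing, hence
  \<open>T + 5\<close>.\<close>

theorem enumerates_selection:
  assumes runs: "runs T (initial w inp) c" and c: "sim s c" "pc c = h"
    and dist: "distinct (selection s)"
  shows "enumerates P w inp (T + 5) 8 (set (selection s))"
proof -
  let ?c = "config_at P w inp" and ?m = "vars s 18"
  let ?out = "\<lambda>i. (arrs s 14 i, arrs s 15 i)"
  have add: "?c (t + r) = (step P w ^^ r) (?c t)" for t r
    by (simp add: config_at_def add.commute[of t] funpow_add)
  have cT: "?c T = c" using runs by (simp add: runs_def config_at_def)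
  have m: "?m < Z" using c by (simp add: sim_def)
  have head: "loop_head ?m i (mem c) (?c (T + 5 + 8 * i))" if "i \<le> ?m" for i
    using that
  proof (induction i)
    case 0
    then show ?case using loop_start(1)[OF c] add[of T 5] cT by simp
  next
    case (Suc i)
    then have "mem c (B + 16 * i + 14) = arrs s 14 i" "mem c (B + 16 * i + 15) = arrs s 15 i"
      "arrs s 14 i < Z" "arrs s 15 i < Z" using sim_mem[OF c(1)] m by auto
    then have "loop_head ?m (Suc i) (mem c) ((step P w ^^ 8) (?c (T + 5 + 8 * i)))"
      using Suc loop_step(1) m by simp
    then show ?case using add[of "T + 5 + 8 * i" 8] by (simp add: algebra_simps)
  qed
  have "enumerates P w inp (T + 5) 8 (?out ` {..<?m})"
  proof (rule enumerates_loop)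
    fix t assume t: "t < T + 5"
    show "\<not> halted P (?c t) \<and> emitted P (?c t) = None"
    proof (cases "t < T")
      case True
      then have "pc (?c t) < h" using runs by (simp add: runs_def config_at_def)
      then show ?thesis by (rule silent_before)
    next
      case False
      then show ?thesis using loop_start(2)[OF c, of "t - T"] add[of T "t - T"] cT t by simp
    qed
  next
    fix i r assume i: "i < ?m" and r: "r < (8::nat)"
    then have "mem c (B + 16 * i + 14) = arrs s 14 i" "mem c (B + 16 * i + 15) = arrs s 15 i"
      "arrs s 14 i < Z" "arrs s 15 i < Z" using sim_mem[OF c(1)] m by auto
    then show "\<not> halted P (?c (T + 5 + 8 * i + r)) \<and>
        emitted P (?c (T + 5 + 8 * i + r)) = (if r = 4 then Some (?out i) else None)"
      using loop_step(2)[OF head i m _ _ _ _ r] i add by simp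
  next
    let ?d = "?c (T + 5 + 8 * ?m)"
    have d: "pc ?d = h + 5" "regs ?d 32 = ?m" "regs ?d 18 = ?m"
      using head[of ?m] by (auto simp: loop_head_def)
    show "\<not> halted P ?d" using halted_iff[of ?d 5] d by (simp add: output_code_def)
    show "emitted P ?d = None" using emitted_iff[of ?d 5] d by (simp add: output_code_def)
    have "pc (step P w ?d) = h + 6"
      using step_output[of ?d 5] d by (simp add: output_code_def jump_if_def)
    then have "halted P (step P w ?d)" using halted_iff[of _ 6] by (simp add: output_code_def)
    then show "halted P (?c (T + 5 + 8 * ?m + 1))" using add[of "T + 5 + 8 * ?m" 1] by simp
  qed (use dist in \<open>simp add: selection_def\<close>)
  then show ?thesis by (simp add: selection_def atLeast0LessThan)
qed

end

text \<open>The base address \<open>2 + L + n + 2 * s * n * n\<close>, for \<open>n\<close> nodes, a query of length \<open>L\<close> and an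
  alphabet of size \<open>s\<close>, exceeds all addresses of input words and is computed without a scan of
  the input.\<close>

definition base_code :: "nat \<Rightarrow> instr list" where
  "base_code s = [Const 31 0, Load 31 31, Const 32 1, Load 32 32,
     Mul 33 31 31, Const 34 (2 * s), Mul 33 33 34, Add 33 33 31, Add 33 33 32,
     Const 34 2, Add 30 33 34]"

definition base :: "nat \<Rightarrow> nat \<Rightarrow> nat \<Rightarrow> nat" where
  "base s n L = n * n * (2 * s) + n + L + 2"

definition program :: "nat \<Rightarrow> instr list" where
  "program s = (let p = base_code s @ compile main_com 11 in p @ output_code (length p))"

text \<open>The assumption on \<open>w\<close> covers every intermediate result, so no instruction
  of \<open>base_code\<close> wraps around.\<close>

lemma fold_base_code:
  assumes inp: "2 \<le> length inp" "n = inp ! 0" "L = inp ! 1"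
    and w: "2 * s + n * n + base s n L < 2 ^ w"
    and less: "\<And>i. i < length inp \<Longrightarrow> inp ! i < 2 ^ w"
  defines "c \<equiv> fold (exec_instr w) (base_code s) (initial w inp)"
  shows "regs c 30 = base s n L" "x < 30 \<Longrightarrow> regs c x = 0" "pc c = 11"
    "mem c = (\<lambda>i. if i < length inp then inp ! i else 0)"
proof -
  have m: "mem (initial w inp) = (\<lambda>i. if i < length inp then inp ! i else 0)"
    using less by (auto simp: initial_def)
  have i: "pc (initial w inp) = 0" "regs (initial w inp) = (\<lambda>_. 0)" by (simp_all add: initial_def)
  have W: "2 < (2::nat) ^ w" "n < 2 ^ w" "L < 2 ^ w" "n * n < 2 ^ w" "2 * s < 2 ^ w" "n * n * (2 * s) < 2 ^ w"
     "n * n * (2 * s) + n < 2 ^ w" "n * n * (2 * s) + n + L < 2 ^ w" "n * n * (2 * s) + n + L + 2 < 2 ^ w"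
    using w less inp by (simp_all add: base_def)
  moreover have "0 < w" using W(1) by (cases w) auto
  moreover have "0 < length inp" "Suc 0 < length inp" using inp by auto
  ultimately show "regs c 30 = base s n L" "x < 30 \<Longrightarrow> regs c x = 0" "pc c = 11"
    "mem c = (\<lambda>i. if i < length inp then inp ! i else 0)"
    using inp(2,3) unfolding c_def base_code_def
    by (simp_all add: set_reg_def i m base_def del: mult_2)
qed

section \<open>Bounds on sizes and on the word length\<close>

text \<open>The first two bounds relate running time to \<open>db_size\<close>. The third counts all
  possible arcs over the fixed alphabet and shows that the base address lies beyond the
  input.\<close>

lemma max_degrees:
  assumes "adj_lists D vs adj" "graph_db (D :: ('v, 'a::finite) graph_db)"
  shows "length adj = card (fst D)" and "degrees adj (length adj) \<le> card (snd D)"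
    and "degrees adj (length adj) \<le> CARD('a) * length adj * length adj"
proof -
  have d: "distinct vs" "set vs = fst D" "length adj = length vs"
    and adj: "\<And>i. i < length vs \<Longrightarrow> distinct (adj ! i) \<and>
      set (adj ! i) = {(a, j). j < length vs \<and> (vs ! i, a, vs ! j) \<in> snd D}"
    using assms(1) by (auto simp: adj_lists_def)
  show n: "length adj = card (fst D)" using d distinct_card by metis
  have len: "length (adj ! i) = card (set (adj ! i))" if "i < length vs" for i
    using adj[OF that] distinct_card[of "adj ! i"] by metis
  let ?A = "Sigma {..<length vs} (\<lambda>i. set (adj ! i))"
  have "degrees adj (length adj) = card ?A"
    using d(3) len by (simp add: degrees_def)
  also have "\<dots> \<le> card (snd D)"
  proof (rule card_inj_on_le)
    show "inj_on (\<lambda>(i, a, j). (vs ! i, a, vs ! j)) ?A"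
      using d(1) adj by (auto simp: inj_on_def nth_eq_iff_index_eq)
    show "(\<lambda>(i, a, j). (vs ! i, a, vs ! j)) ` ?A \<subseteq> snd D" using adj by auto
    have "snd D \<subseteq> fst D \<times> UNIV \<times> fst D" "finite (fst D)" using assms(2) by (auto simp: graph_db_def)
    then show "finite (snd D)" by (meson finite_SigmaI finite_UNIV finite_subset finite)
  qed
  finally show "degrees adj (length adj) \<le> card (snd D)" .
  have "length (adj ! i) \<le> CARD('a) * length vs" if "i < length vs" for i
  proof -
    have "set (adj ! i) \<subseteq> UNIV \<times> {..<length vs}" using adj[OF that] by auto
    then have "card (set (adj ! i)) \<le> card ((UNIV :: 'a set) \<times> {..<length vs})"
      by (intro card_mono) auto
    then show ?thesis using len[OF that] by (simp add: card_cartesian_product)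
  qed
  then have "(\<Sum>i<length vs. length (adj ! i)) \<le> (\<Sum>i<length vs. CARD('a) * length vs)"
    by (intro sum_mono) auto
  then show "degrees adj (length adj) \<le> CARD('a) * length adj * length adj"
    using d(3) by (simp add: degrees_def mult.commute mult.left_commute)
qed

lemma log_bound: "2 ^ nat \<lceil>log 2 (real l + 2)\<rceil> \<ge> l + 2"
proof -
  define k where "k = nat \<lceil>log 2 (real l + 2)\<rceil>"
  have "log 2 (real l + 2) \<le> real k" unfolding k_def by (rule real_nat_ceiling_ge)
  then have "2 powr log 2 (real l + 2) \<le> 2 powr real k" by (intro powr_mono) auto
  then have "real (l + 2) \<le> real (2 ^ k)" by (simp add: powr_realpow)
  then show ?thesis by (simp only: k_def of_nat_le_iff)
qed

text \<open>Words of \<open>m + 2\<close> logarithms can hold the power \<open>m + 2\<close> of the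
  length plus two: two factors give the square, and the other \<open>m\<close>, each at least
  \<open>2\<close>, absorb the constant \<open>m \<le> 2 ^ m\<close>.\<close>

lemma word_size_large: "m * (length inp + 2)\<^sup>2 \<le> 2 ^ word_size (m + 2) inp"
proof -
  let ?x = "length inp + 2"
  have "m \<le> 2 ^ m" using less_exp[of m] by simp
  also have "(2::nat) ^ m \<le> ?x ^ m" by (rule power_mono) auto
  finally have "m * ?x\<^sup>2 \<le> ?x ^ m * ?x\<^sup>2" by (rule mult_le_mono1)
  also have "\<dots> = ?x ^ (m + 2)" by (simp only: power_add)
  also have "\<dots> \<le> (2 ^ nat \<lceil>log 2 (real (length inp) + 2)\<rceil>) ^ (m + 2)"
    by (rule power_mono[OF log_bound]) simp
  also have "\<dots> = 2 ^ word_size (m + 2) inp"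
    by (simp only: word_size_def power_mult[symmetric] mult.commute)
  finally show ?thesis .
qed

section \<open>Transfer from node numbers to nodes\<close>

context encoded_input
begin

lemma db_path_index:
  assumes "adj_lists D vs adj" "graph_db D"
  shows "db_path index_db i w j \<Longrightarrow> j < n \<and> db_path D (vs ! i) w (vs ! j)"
    and "i < n \<Longrightarrow> db_path D (vs ! i) w v \<Longrightarrow> \<exists>j<n. vs ! j = v \<and> db_path index_db i w j"
proof -
  have d: "distinct vs" "set vs = fst D" "length adj = length vs"
    and adj: "\<And>i. i < n \<Longrightarrow> set (adj ! i) = {(a, j). j < length vs \<and> (vs ! i, a, vs ! j) \<in> snd D}"
    using assms(1) by (auto simp: adj_lists_def)
  show "db_path index_db i w j \<Longrightarrow> j < n \<and> db_path D (vs ! i) w (vs ! j)"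
  proof (induction rule: db_path.induct)
    case (path_Nil u)
    then have "u < n" by (simp add: index_db_def)
    then have "vs ! u \<in> fst D" using d nth_mem[of u vs] by simp
    then show ?case using \<open>u < n\<close> by (simp add: db_path.path_Nil)
  next
    case (path_Cons u a x w v)
    then have "u < n" "(a, x) \<in> set (adj ! u)" by (simp_all add: index_db_def)
    then have "(vs ! u, a, vs ! x) \<in> snd D" using adj[of u] by simp
    then show ?case using path_Cons.IH db_path.path_Cons[of "vs ! u" a "vs ! x" D w "vs ! v"] by simp
  qed
  have "\<exists>j<n. vs ! j = v \<and> db_path index_db i w j" if "db_path D u w v" "i < n" "vs ! i = u" for u
    using that
  proof (induction arbitrary: i rule: db_path.induct)
    case (path_Nil u)
    then have "db_path index_db i [] i" by (intro db_path.path_Nil) (simp add: index_db_def)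
    then show ?case using path_Nil by blast
  next
    case (path_Cons u a x w v)
    then have "x \<in> set vs" using assms(2) d by (auto simp: graph_db_def)
    then obtain k where k: "k < n" "vs ! k = x" using d(3) by (auto simp: in_set_conv_nth)
    then obtain j where "j < n" "vs ! j = v" "db_path index_db k w j" using path_Cons.IH by blast
    moreover have "(i, a, k) \<in> snd index_db"
      using path_Cons.prems path_Cons.hyps(1) k adj[of i] d(3) by (simp add: index_db_def)
    ultimately show ?case using db_path.path_Cons[of i a k index_db w j] by blast
  qed
  then show "i < n \<Longrightarrow> db_path D (vs ! i) w v \<Longrightarrow> \<exists>j<n. vs ! j = v \<and> db_path index_db i w j"
    by blast
qed

lemma answers_index:
  assumes "adj_lists D vs adj" "graph_db D"
  shows "(i, j) \<in> answers q index_db \<Longrightarrow> (vs ! i, vs ! j) \<in> answers q D"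
    and "(u, v) \<in> answers q D \<Longrightarrow>
      \<exists>i j. u = vs ! i \<and> v = vs ! j \<and> (i, j) \<in> answers q index_db"
proof -
  show "(i, j) \<in> answers q index_db \<Longrightarrow> (vs ! i, vs ! j) \<in> answers q D"
    using db_path_index(1)[OF assms] unfolding answers_def by fast
  assume uv: "(u, v) \<in> answers q D"
  then have "u \<in> set vs" "length vs = n"
    using answers_nodes[OF assms(2), of q] assms(1) by (auto simp: adj_lists_def)
  then obtain i where "i < n" "u = vs ! i" by (auto simp: in_set_conv_nth)
  then show "\<exists>i j. u = vs ! i \<and> v = vs ! j \<and> (i, j) \<in> answers q index_db"
    using uv db_path_index(2)[OF assms, of i] unfolding answers_def by fast
qed

text \<open>As \<open>vs\<close> has no repetitions, translating \<open>S\<close> to nodes and back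
  returns \<open>S\<close> itself and no further pairs, so the machine outputs exactly the required
  set.\<close>

lemma approximation_index:
  assumes "adj_lists D vs adj" "graph_db D" "approximation q index_db S"
  defines "A \<equiv> (\<lambda>(i, j). (vs ! i, vs ! j)) ` S"
  shows "approximation q D A"
    and "{(i, j). i < length vs \<and> j < length vs \<and> (vs ! i, vs ! j) \<in> A} = S"
proof -
  have S: "S \<subseteq> answers q index_db" using assms(3) by (simp add: approximation_def)
  show "approximation q D A"
    unfolding approximation_def
  proof (intro conjI; clarify)
    fix u v assume "(u, v) \<in> A"
    then show "(u, v) \<in> answers q D" using S answers_index(1)[OF assms(1,2)] by (auto simp: A_def)
  next
    fix u v assume "(u, v) \<in> answers q D"
    then obtain i j where ij: "u = vs ! i" "v = vs ! j" "(i, j) \<in> answers q index_db"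
      using answers_index(2)[OF assms(1,2)] by blast
    then obtain i' j' where "(i, j') \<in> S" "(i', j) \<in> S"
      using assms(3) by (fastforce simp: approximation_def)
    then show "(\<exists>v'. (u, v') \<in> A) \<and> (\<exists>u'. (u', v) \<in> A)" using ij by (force simp: A_def)
  qed
  have vs: "distinct vs" "length vs = n" using assms(1) by (auto simp: adj_lists_def)
  have less: "i < n \<and> j < n" if "(i, j) \<in> S" for i j using that S answers_less by blast
  show "{(i, j). i < length vs \<and> j < length vs \<and> (vs ! i, vs ! j) \<in> A} = S"
  proof (intro set_eqI iffI; clarify)
    fix i j assume "i < length vs" "j < length vs" "(vs ! i, vs ! j) \<in> A"
    moreover from this obtain i' j' where "(i', j') \<in> S" "vs ! i = vs ! i'" "vs ! j = vs ! j'"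
      by (auto simp: A_def)
    ultimately show "(i, j) \<in> S" using vs less nth_eq_iff_index_eq by metis
  next
    fix i j assume "(i, j) \<in> S"
    then show "i < length vs \<and> j < length vs \<and> (vs ! i, vs ! j) \<in> A" using less vs by (auto simp: A_def)
  qed
qed

lemma inp_less:
  assumes "\<And>a. code a < s" "x \<in> set inp"
  shows "x < s + 6 + length inp"
proof -
  have "token_code code t < s + 6" for t
    using assms(1) by (cases t) (auto simp: add.commute intro: trans_less_add1)
  moreover have "y < s + length inp" if l: "l \<in> set adj" and y: "y \<in> set (row code l)" for l y
  proof -
    obtain u where u: "u < n" "adj ! u = l" using l by (auto simp: in_set_conv_nth)
    have "length l < length inp" using pos_less[OF u(1)] u(2) by simp
    moreover have "n < length inp" by (simp add: length_inp pos_def)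
    moreover have "y = length l \<or> y < s \<or> y < n"
      using y assms(1) targets[OF l] by (auto simp: row_def)
    ultimately show ?thesis by auto
  qed
  moreover have "x = n \<or> x = L \<or> (\<exists>t. x = token_code code t) \<or> (\<exists>l\<in>set adj. x \<in> set (row code l))"
    using assms(2) by (auto simp: inp_eq)
  moreover have "n < length inp" "L < length inp" by (simp_all add: length_inp pos_def)
  ultimately show ?thesis by (metis add.assoc add.commute trans_less_add1)
qed

end

theorem theorem7p5:
  fixes code :: "'a::finite \<Rightarrow> nat"
  assumes "bij_betw code UNIV {..<CARD('a)}"
  shows "\<exists>(P :: instr list) (k :: nat) (C :: nat) (d :: nat).
    \<forall>(D :: ('v, 'a) graph_db) (q :: 'a rpq) (vs :: 'v list) (adj :: ('a \<times> nat) list list).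
      graph_db D \<and> adj_lists D vs adj \<longrightarrow>
      (\<exists>(A :: ('v \<times> 'v) set) (T :: nat).
         approximation q D A \<and>
         T \<le> C * (db_size D * rpq_size q + 1) \<and>
         enumerates P (word_size k (input_words code adj q)) (input_words code adj q) T d
           {(i, j). i < length vs \<and> j < length vs \<and> (vs ! i, vs ! j) \<in> A})"
proof -
  define s where "s = CARD('a)"
  \<comment> \<open>With \<open>Z = (20 + s) * x\<^sup>2\<close>, the arrays take
    \<open>16 * s + 320\<close> multiples of \<open>x\<^sup>2\<close>; the base address and the
    values in its computation need at most \<open>4 * s + 2\<close> more.\<close>
  define m where "m = 20 * s + 400"
  \<comment> \<open>Setting up the base address takes 11 steps and the output loop 5; the main
    program takes at most \<open>cost main_com * Suc (30 * X)\<close> steps, where \<open>X\<close>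
    is \<open>db_size D * rpq_size q\<close>.\<close>
  define C where "C = 31 * cost main_com + 16"
  have code: "inj code" "code a < s" for a using assms by (auto simp: bij_betw_def s_def)
  have s: "0 < s" by (simp add: s_def)
  show ?thesis
  proof (rule exI[of _ "program s"], rule exI[of _ "m + 2"], rule exI[of _ C], rule exI[of _ 8],
      intro allI impI)
    fix D :: "('v, 'a) graph_db" and q :: "'a rpq" and vs :: "'v list"
      and adj :: "('a \<times> nat) list list"
    assume "graph_db D \<and> adj_lists D vs adj"
    then have D: "graph_db D" and adj: "adj_lists D vs adj" by auto
    let ?inp = "input_words code adj q"
    define n where "n = length adj"
    define L where "L = rpq_size q"
    define x where "x = length ?inp + 2"
    \<comment> \<open>The part \<open>20 * x\<^sup>2\<close> dominates the counts in
      \<open>large\<close>, and \<open>s * x\<^sup>2\<close> makes room for the letter codes, which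
      are below \<open>s\<close>.\<close>
    define Z where "Z = (20 + s) * x\<^sup>2"
    define w where "w = word_size (m + 2) ?inp"
    define B where "B = base s n L"
    define h where "h = 11 + length (compile main_com 11)"
    note deg = max_degrees[OF adj D]
    have targets: "j < length adj" if "l \<in> set adj" "(a, j) \<in> set l" for l a j
    proof -
      obtain i where "i < length adj" "adj ! i = l" using \<open>l \<in> set adj\<close> by (auto simp: in_set_conv_nth)
      then show ?thesis using adj that(2) by (fastforce simp: adj_lists_def)
    qed
    have len: "length ?inp = 2 + L + n + 2 * degrees adj n"
    proof -
      have "length (concat (map (row code) adj)) = n + 2 * degrees adj n"
        using length_rows[of n adj code] by (simp add: n_def)
      then show ?thesis by (simp add: input_words_def row_def[abs_def] L_def)
    qed
    have x: "n + L + 2 * degrees adj n + 4 = x" using len by (simp add: x_def)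
    have sq: "i * j \<le> x\<^sup>2" if "i \<le> x" "j \<le> x" for i j
      using mult_le_mono[OF that] by (simp add: power2_eq_square)
    have xx: "4 * x \<le> x\<^sup>2" "16 \<le> x\<^sup>2" "1 \<le> s * x\<^sup>2" "s \<le> s * x\<^sup>2"
    proof -
      have "4 \<le> x" using x by simp
      then show "4 * x \<le> x\<^sup>2" by (simp add: power2_eq_square)
      with \<open>4 \<le> x\<close> show "16 \<le> x\<^sup>2" by linarith
      then have "1 \<le> x\<^sup>2" by linarith
      then have "s * 1 \<le> s * x\<^sup>2" by (intro mult_le_mono2)
      then show "s \<le> s * x\<^sup>2" "1 \<le> s * x\<^sup>2" using s by linarith+
    qed
    have Z_eq: "Z = 20 * x\<^sup>2 + s * x\<^sup>2" by (simp add: Z_def algebra_simps)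
    have large: "n * (L + 1) + n + 2 * L * n + L * degrees adj n + length ?inp + 2 * L + 20 < Z"
    proof -
      have "n * (L + 1) \<le> x\<^sup>2" "L * n \<le> x\<^sup>2" "L * degrees adj n \<le> x\<^sup>2"
        using x by (intro sq; simp)+
      moreover have "2 * L * n = 2 * (L * n)" by simp
      ultimately show ?thesis using x len xx unfolding Z_eq by linarith
    qed
    have BZ: "2 * s + n * n + B + 16 * Z \<le> 2 ^ w"
    proof -
      have arith: "2 * s + p + (r + n + L + 2) + 16 * (20 * y + z) \<le> W"
        if "20 * z + 400 * y \<le> W" "p \<le> y" "r \<le> 2 * z" "n + L + 4 \<le> x" "4 * x \<le> y" "s \<le> z"
        for p r y z W using that by simp
      have p: "n * n \<le> x\<^sup>2" using x by (intro sq; simp)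
      then have "n * n * (2 * s) \<le> x\<^sup>2 * (2 * s)" by (rule mult_le_mono1)
      then have r: "n * n * (2 * s) \<le> 2 * (s * x\<^sup>2)" by (simp add: ac_simps)
      have "m * x\<^sup>2 \<le> 2 ^ w" using word_size_large[of m ?inp] by (simp only: x_def w_def)
      moreover have "m * x\<^sup>2 = 20 * (s * x\<^sup>2) + 400 * x\<^sup>2" by (simp add: m_def algebra_simps)
      ultimately have W: "20 * (s * x\<^sup>2) + 400 * x\<^sup>2 \<le> 2 ^ w" by simp
      have "n + L + 4 \<le> x" using x by simp
      from arith[OF W p r this xx(1,4)] show ?thesis unfolding Z_eq B_def base_def .
    qed
    have lenB: "length ?inp \<le> B"
      using deg(3) len by (simp add: B_def base_def n_def s_def algebra_simps)
    have codeZ: "code a + 6 < Z" for a using code(2)[of a] xx unfolding Z_eq by linarith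
    interpret e: encoded_input Z code adj q
    proof
      show "j < length adj" if "l \<in> set adj" "(a, j) \<in> set l" for l a j using targets that .
    qed (use code codeZ large in \<open>simp_all add: n_def L_def\<close>)
    have small: "y < Z" if "y \<in> set ?inp" for y
      using e.inp_less[OF code(2) that] x len xx unfolding Z_eq by linarith
    have lb: "length (base_code s) = 11" by (simp add: base_code_def)
    have program: "program s = base_code s @ compile main_com 11 @ output_code h"
      by (simp add: program_def Let_def h_def lb)
    have silent: "silent (program s ! i)" if "i < h" for i
    proof -
      let ?pre = "base_code s @ compile main_com 11"
      have "i < length ?pre" using that lb by (simp add: h_def)
      moreover have "program s = ?pre @ output_code h" by (simp add: program)
      ultimately have "program s ! i \<in> set ?pre" by (metis nth_append nth_mem)
      then show ?thesis using silent_compile by (auto simp: base_code_def)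
    qed
    interpret c: complete_program Z ?inp "program s" w B h
    proof
      show "2 \<le> Z" using xx unfolding Z_eq by linarith
      show "B + 16 * Z \<le> 2 ^ w" using BZ by linarith
    qed (use silent small lenB lb in \<open>auto simp: program h_def\<close>)
    let ?s0 = "\<lparr>vars = \<lambda>_. 0, arrs = \<lambda>_ _. 0, ticks = 0\<rparr>"
    obtain s' where s': "e.big main_com ?s0 s'" "distinct (selection s')"
      "approximation q e.index_db (set (selection s'))" "ticks s' \<le> 30 * (max n (degrees adj n) * L)"
      using e.wp_main[of ?s0] by (auto simp: e.wp_def n_def L_def)
    define c1 where "c1 = fold (exec_instr w) (base_code s) (initial w ?inp)"
    have c1: "regs c1 30 = B" "\<And>x. x < 30 \<Longrightarrow> regs c1 x = 0" "pc c1 = 11"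
      "mem c1 = (\<lambda>i. if i < length ?inp then ?inp ! i else 0)"
    proof -
      have "2 * s + n * n + base s n L < 2 ^ w" "Z \<le> 2 ^ w"
        using BZ c.Z unfolding B_def by linarith+
      moreover have "y < 2 ^ w" if "y \<in> set ?inp" for y
        using small[OF that] \<open>Z \<le> 2 ^ w\<close> by linarith
      moreover have "2 \<le> length ?inp" using len by simp
      ultimately show "regs c1 30 = B" "\<And>x. x < 30 \<Longrightarrow> regs c1 x = 0" "pc c1 = 11"
        "mem c1 = (\<lambda>i. if i < length ?inp then ?inp ! i else 0)"
        using fold_base_code[of ?inp n L s w] unfolding c1_def B_def
        by (simp_all add: n_def L_def)
    qed
    have r1: "c.runs 11 (initial w ?inp) c1"
    proof -
      have "c.code_at 0 (base_code s)"
        unfolding c.code_at_def by (auto simp: lb h_def program nth_append)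
      moreover have "pc (initial w ?inp) = 0" by (simp add: initial_def)
      ultimately have "c.code_at (pc (initial w ?inp)) (base_code s)" by (simp only:)
      moreover have "straight i" if "i \<in> set (base_code s)" for i
        using that by (auto simp: base_code_def)
      ultimately show ?thesis using c.runs_straight unfolding c1_def lb[symmetric] by blast
    qed
    have sim: "c.sim ?s0 c1"
      using c1 c.Z lenB unfolding c.sim_def by auto
    obtain t c2 where t: "t \<le> cost main_com * Suc (ticks s' - 0)" and c2: "c.runs t c1 c2"
      "c.sim s' c2" "pc c2 = h"
    proof -
      have "c.code_at 11 (compile main_com 11)"
        unfolding c.code_at_def by (auto simp: lb h_def program nth_append)
      then show thesis
        using c.run_compile[OF s'(1) sim legal_main_com] that c1(3) by (auto simp: h_def)
    qed
    have "enumerates (program s) w ?inp (11 + t + 5) 8 (set (selection s'))"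
      using c.enumerates_selection[OF c.runs_trans[OF r1 c2(1)] c2(2,3) s'(2)] .
    moreover have "11 + t + 5 \<le> C * (db_size D * rpq_size q + 1)"
    proof -
      let ?X = "db_size D * rpq_size q"
      have "max n (degrees adj n) \<le> db_size D"
        using deg by (auto simp: db_size_def n_def)
      then have "max n (degrees adj n) * L \<le> ?X" unfolding L_def by (rule mult_le_mono1)
      then have "ticks s' \<le> 30 * ?X" using s'(4) by linarith
      then have "cost main_com * Suc (ticks s' - 0) \<le> cost main_com * Suc (30 * ?X)"
        by (intro mult_le_mono2) simp
      then have "11 + t + 5 \<le> 16 + cost main_com * Suc (30 * ?X)" using t by linarith
      also have "\<dots> \<le> C * (?X + 1)" by (simp add: C_def algebra_simps del: cost.simps)
      finally show ?thesis .
    qed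
    ultimately show "\<exists>A T. approximation q D A \<and> T \<le> C * (db_size D * rpq_size q + 1) \<and>
        enumerates (program s) (word_size (m + 2) (input_words code adj q)) (input_words code adj q) T 8
          {(i, j). i < length vs \<and> j < length vs \<and> (vs ! i, vs ! j) \<in> A}"
      using e.approximation_index[OF adj D s'(3)] unfolding w_def
      by (intro exI[of _ "(\<lambda>(i, j). (vs ! i, vs ! j)) ` set (selection s')"] exI[of _ "11 + t + 5"] conjI)
        (simp_all only:)
  qed
qed

end
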